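(* Suppose that $\{X_t,t\in\mathbb{R}\}$ is a h.-i.s.r.m.-process on $\mathbb{R}^d$, $c>0$, and $b>1$. Then $\mathcal{L}(X_1)\in I_{\log}(\mathbb{R}^d)$ if and only if the Langevin type equation $$Z_t-Z_s=X_{[ct]/c}-X_{[cs]/c}-(b-1)\int_s^t Z_u\,d[cu],\qquad -\infty<s\le t<\infty,\tag{$*$}$$ has a semi-stationary solution. If $\mathcal{L}(X_1)\in I_{\log}(\mathbb{R}^d)$, then $$Z_t=b^{-[ct]}\int_{-\infty}^{[ct]/c}b^{[cu]}\,dX_u,\qquad t\in\mathbb{R},$$ is an almost surely unique semi-stationary solution of $( * )$, and it satisfies $\mathcal{L}(Z_t)=\mathcal{L}\left(\int_0^\infty b^{-[cu]-1}\,dX_u\right)\in L(b,\mathbb{R}^d)$ for all $t\in\mathbb{R}$. In this case, the semi-stationary process $\{Z_t\}$ has a period $1/c$.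
   Context: $\mathcal{L}(X)$ is the law of $X$; $[x]$ is the largest integer not greater than $x$. $I(\mathbb{R}^d)$ is the class of infinitely divisible distributions on $\mathbb{R}^d$, and $I_{\log}(\mathbb{R}^d)=\{\mu\in I(\mathbb{R}^d):\int_{\mathbb{R}^d}\log^+|x|\,\mu(dx)<\infty\}$ with $\log^+|x|=(\log|x|)\vee 0$. $L(b,\mathbb{R}^d)$ is the class of semi-selfdecomposable distributions with span $b$: those $\mu\in I(\mathbb{R}^d)$ for which there is $\rho\in I(\mathbb{R}^d)$ with $\widehat\mu(z)=\widehat\mu(b^{-1}z)\widehat\rho(z)$ for all $z$ ($\widehat\mu$ is the characteristic function). An $\mathbb{R}^d$-valued independently scattered random measure (i.s.r.m.) over $\mathbb{R}$ is a family $X=\{X(B)\}$ of $\mathbb{R}^d$-valued random variables indexed by the bounded Borel sets $B\subset\mathbb{R}$ such that $X(B_1),\dots,X(B_n)$ are independent for disjoint $B_1,\dots,B_n$; $X(\bigcup_n B_n)=\sum_n X(B_n)$ a.s. (with a.s. convergence) for disjoint $B_n$ with bounded union; and $X(\{a\})=0$ a.s. for every $a$. It is homogeneous if $\mathcal{L}(X(B))=\mathcal{L}(X(B+a))$ for all $B$ and $a\in\mathbb{R}$. A process $\{X_t,t\in\mathbb{R}\}$ is a h.-i.s.r.m.-process if there is a homogeneous i.s.r.m. $X$ over $\mathbb{R}$ with $X_t=X((0,t])$ for $t>0$, $X_0=0$, $X_t=-X((t,0])$ for $t<0$, taken in a càdlàg modification (i.e. a two-sided Lévy process). For $s\le t$,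 $\int_s^t f(u)\,dX_u$ is the stochastic integral of a nonrandom function over $(s,t]$ with respect to $X$; for the step functions here it is a finite sum, e.g. $\int_{k/c}^{n/c}b^{[cu]}dX_u=\sum_{\ell=k+1}^{n}b^{\ell-1}(X_{\ell/c}-X_{(\ell-1)/c})$ for integers $k\le n$. Improper integrals $\int_{-\infty}^t f(u)\,dX_u$ and $\int_0^\infty f(u)\,dX_u$ are limits in probability of $\int_s^t f(u)\,dX_u$ as $s\to-\infty$, respectively of $\int_0^t f(u)\,dX_u$ as $t\to\infty$, when these exist; $\int_{-\infty}^tf(u)\,dX_u$, $t\in\mathbb{R}$, is regarded as a càdlàg process. $d[cu]$ is the Lebesgue–Stieltjes measure of $u\mapsto[cu]$, i.e. $\sum_{k\in\mathbb{Z}}\delta_{k/c}(du)$, and $\int_s^t$ with respect to it is over $(s,t]$. A process $\{Z_t,t\in\mathbb{R}\}$ is a solution of $( * )$ if its sample paths are right-continuous with left limits and it satisfies $( * )$ almost surely. $\{Z_t\}$ is semi-stationary with period $p>0$ if $\{Z_{t+p},t\in\mathbb{R}\}$ and $\{Z_t,t\in\mathbb{R}\}$ have the same finite-dimensional distributions; it is semi-stationary if this holds for some $p>0$. Almost sure uniqueness means that two such processes coincide for all $t\in\mathbb{R}$ with probability one. *)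

theory Defs
  imports "HOL-Probability.Probability"
begin

subsection \<open>Distributions on $R^d$\<close>

definition inf_divisible :: "(real ^ 'd) measure set" where
  "inf_divisible = {\<mu>. prob_space \<mu> \<and> sets \<mu> = sets borel \<and>
     (\<forall>n\<ge>1. \<exists>\<nu>. prob_space \<nu> \<and> sets \<nu> = sets borel \<and>
        \<mu> = (convolution \<nu> ^^ n) (return borel 0))}"

text \<open>Since \<^term>\<open>ln (0::real) = 0\<close>, the integrand below is
  \<open>log\<^sup>+ |x|\<close> also at \<open>x = 0\<close>.\<close>

definition inf_divisible_log :: "(real ^ 'd) measure set" where
  "inf_divisible_log =
     {\<mu> \<in> inf_divisible. (\<integral>\<^sup>+ x. ennreal (max (ln (norm x)) 0) \<partial>\<mu>) < \<infinity>}"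

text \<open>The library's \<^const>\<open>char\<close> is for measures on the real line only.\<close>

definition char_vec :: "(real ^ 'd) measure \<Rightarrow> real ^ 'd \<Rightarrow> complex" where
  "char_vec \<mu> z = (CLINT x|\<mu>. iexp (z \<bullet> x))"

definition semi_selfdecomposable :: "real \<Rightarrow> (real ^ 'd) measure set" where
  "semi_selfdecomposable b = {\<mu> \<in> inf_divisible.
     \<exists>\<rho>\<in>inf_divisible. \<forall>z. char_vec \<mu> z = char_vec \<mu> ((1 / b) *\<^sub>R z) * char_vec \<rho> z}"


subsection \<open>Independently scattered random measures and their processes\<close>

text \<open>A random measure is a total function on sets of reals; only its values on
  bounded Borel sets are constrained or used.\<close>

definition bounded_borel :: "real set set" where
  "bounded_borel = {B. B \<in> sets borel \<and> bounded B}"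

definition isrm :: "'w measure \<Rightarrow> (real set \<Rightarrow> 'w \<Rightarrow> real ^ 'd) \<Rightarrow> bool" where
  "isrm M \<Lambda> \<longleftrightarrow>
     (\<forall>B\<in>bounded_borel. \<Lambda> B \<in> borel_measurable M) \<and>
     (\<forall>(n::nat) B. (\<forall>i<n. B i \<in> bounded_borel) \<longrightarrow> disjoint_family_on B {..<n} \<longrightarrow>
        prob_space.indep_vars M (\<lambda>_. borel) (\<lambda>i. \<Lambda> (B i)) {..<n}) \<and>
     (\<forall>B::nat \<Rightarrow> real set. (\<forall>n. B n \<in> bounded_borel) \<longrightarrow> disjoint_family B \<longrightarrow>
        bounded (\<Union>n. B n) \<longrightarrow> (AE \<omega> in M. (\<lambda>n. \<Lambda> (B n) \<omega>) sums \<Lambda> (\<Union>n. B n) \<omega>)) \<and>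
     (\<forall>a. AE \<omega> in M. \<Lambda> {a} \<omega> = 0)"

definition homogeneous_isrm :: "'w measure \<Rightarrow> (real set \<Rightarrow> 'w \<Rightarrow> real ^ 'd) \<Rightarrow> bool" where
  "homogeneous_isrm M \<Lambda> \<longleftrightarrow> isrm M \<Lambda> \<and>
     (\<forall>B\<in>bounded_borel. \<forall>a. distr M borel (\<Lambda> B) = distr M borel (\<Lambda> ((\<lambda>x. x + a) ` B)))"

definition cadlag :: "(real \<Rightarrow> 'a::topological_space) \<Rightarrow> bool" where
  "cadlag f \<longleftrightarrow> (\<forall>t. continuous (at_right t) f \<and> (\<exists>l. (f \<longlongrightarrow> l) (at_left t)))"

definition cadlag_process :: "'w measure \<Rightarrow> (real \<Rightarrow> 'w \<Rightarrow> real ^ 'd) \<Rightarrow> bool" where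
  "cadlag_process M Z \<longleftrightarrow>
     (\<forall>t. Z t \<in> borel_measurable M) \<and> (\<forall>\<omega>\<in>space M. cadlag (\<lambda>t. Z t \<omega>))"

text \<open>The random measure \<open>\<Lambda>\<close> that generates the process \<open>X\<close> is kept as an explicit
  argument, because integrals with respect to \<open>X\<close> are integrals with respect to \<open>\<Lambda>\<close>.\<close>

definition hisrm_process ::
  "'w measure \<Rightarrow> (real set \<Rightarrow> 'w \<Rightarrow> real ^ 'd) \<Rightarrow> (real \<Rightarrow> 'w \<Rightarrow> real ^ 'd) \<Rightarrow> bool" where
  "hisrm_process M \<Lambda> X \<longleftrightarrow> homogeneous_isrm M \<Lambda> \<and> cadlag_process M X \<and>
     (\<forall>t>0. AE \<omega> in M. X t \<omega> = \<Lambda> {0<..t} \<omega>) \<and>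
     (AE \<omega> in M. X 0 \<omega> = 0) \<and>
     (\<forall>t<0. AE \<omega> in M. X t \<omega> = - \<Lambda> {t<..0} \<omega>)"


subsection \<open>Stochastic integrals of nonrandom step functions\<close>

text \<open>The integral over \<open>(s, t]\<close> of an \<open>f\<close> that takes finitely many values there,
  that is, of \<open>f = (\<Sum>a. a 1\<^bsub>B(a)\<^esub>)\<close> with \<open>B(a) = {u \<in> (s, t]. f u = a}\<close>.
  On bounded intervals the functions \<open>b\<^bsup>[cu]\<^esup>\<close> and \<open>b\<^bsup>-[cu]-1\<^esup>\<close> are of this kind.\<close>

definition step_integral ::
  "(real set \<Rightarrow> 'w \<Rightarrow> real ^ 'd) \<Rightarrow> (real \<Rightarrow> real) \<Rightarrow> real \<Rightarrow> real \<Rightarrow> 'w \<Rightarrow> real ^ 'd" where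
  "step_integral \<Lambda> f s t \<omega> = (\<Sum>a\<in>f ` {s<..t}. a *\<^sub>R \<Lambda> {u\<in>{s<..t}. f u = a} \<omega>)"

definition tendsto_in_prob ::
  "'w measure \<Rightarrow> ('i \<Rightarrow> 'w \<Rightarrow> real ^ 'd) \<Rightarrow> ('w \<Rightarrow> real ^ 'd) \<Rightarrow> 'i filter \<Rightarrow> bool" where
  "tendsto_in_prob M Y L F \<longleftrightarrow>
     (\<forall>\<epsilon>>0. ((\<lambda>i. measure M {\<omega>\<in>space M. norm (Y i \<omega> - L \<omega>) > \<epsilon>}) \<longlongrightarrow> 0) F)"

text \<open>Improper integrals are determined only almost surely, so they are rendered as
  relations: \<open>Y\<close> is a version of \<open>\<integral>\<^bsub>-\<infinity>\<^esub>\<^bsup>t\<^esup> f dX\<close>, respectively of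
  \<open>\<integral>\<^bsub>0\<^esub>\<^bsup>\<infinity>\<^esup> f dX\<close>.\<close>

definition is_integral_from_minf ::
  "'w measure \<Rightarrow> (real set \<Rightarrow> 'w \<Rightarrow> real ^ 'd) \<Rightarrow> (real \<Rightarrow> real) \<Rightarrow> real \<Rightarrow> ('w \<Rightarrow> real ^ 'd) \<Rightarrow> bool"
where
  "is_integral_from_minf M \<Lambda> f t Y \<longleftrightarrow> Y \<in> borel_measurable M \<and>
     tendsto_in_prob M (\<lambda>s. step_integral \<Lambda> f s t) Y at_bot"

definition is_integral_0_inf ::
  "'w measure \<Rightarrow> (real set \<Rightarrow> 'w \<Rightarrow> real ^ 'd) \<Rightarrow> (real \<Rightarrow> real) \<Rightarrow> ('w \<Rightarrow> real ^ 'd) \<Rightarrow> bool"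
where
  "is_integral_0_inf M \<Lambda> f Y \<longleftrightarrow> Y \<in> borel_measurable M \<and>
     tendsto_in_prob M (\<lambda>t. step_integral \<Lambda> f 0 t) Y at_top"

definition cadlag_integral_from_minf ::
  "'w measure \<Rightarrow> (real set \<Rightarrow> 'w \<Rightarrow> real ^ 'd) \<Rightarrow> (real \<Rightarrow> real) \<Rightarrow> (real \<Rightarrow> 'w \<Rightarrow> real ^ 'd) \<Rightarrow> bool"
where
  "cadlag_integral_from_minf M \<Lambda> f Y \<longleftrightarrow>
     cadlag_process M Y \<and> (\<forall>t. is_integral_from_minf M \<Lambda> f t (Y t))"


subsection \<open>The Langevin type equation and semi-stationarity\<close>

text \<open>The exceptional null set in the equation does not depend on \<open>s\<close> and \<open>t\<close>.\<close>

definition langevin_solution ::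
  "'w measure \<Rightarrow> (real \<Rightarrow> 'w \<Rightarrow> real ^ 'd) \<Rightarrow> real \<Rightarrow> real \<Rightarrow> (real \<Rightarrow> 'w \<Rightarrow> real ^ 'd) \<Rightarrow> bool" where
  "langevin_solution M X b c Z \<longleftrightarrow> cadlag_process M Z \<and>
     (AE \<omega> in M. \<forall>s t. s \<le> t \<longrightarrow>
        Z t \<omega> - Z s \<omega> =
          X (of_int \<lfloor>c * t\<rfloor> / c) \<omega> - X (of_int \<lfloor>c * s\<rfloor> / c) \<omega>
          - (b - 1) *\<^sub>R (LINT u:{s<..t}|interval_measure (\<lambda>u. of_int \<lfloor>c * u\<rfloor>). Z u \<omega>))"

definition same_fdd ::
  "'w measure \<Rightarrow> (real \<Rightarrow> 'w \<Rightarrow> real ^ 'd) \<Rightarrow> (real \<Rightarrow> 'w \<Rightarrow> real ^ 'd) \<Rightarrow> bool" where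
  "same_fdd M Z W \<longleftrightarrow> (\<forall>J. finite J \<longrightarrow>
     distr M (Pi\<^sub>M J (\<lambda>_. borel)) (\<lambda>\<omega>. \<lambda>t\<in>J. Z t \<omega>) =
     distr M (Pi\<^sub>M J (\<lambda>_. borel)) (\<lambda>\<omega>. \<lambda>t\<in>J. W t \<omega>))"

definition semi_stationary_with_period ::
  "'w measure \<Rightarrow> real \<Rightarrow> (real \<Rightarrow> 'w \<Rightarrow> real ^ 'd) \<Rightarrow> bool" where
  "semi_stationary_with_period M p Z \<longleftrightarrow> p > 0 \<and> same_fdd M (\<lambda>t. Z (t + p)) Z"

definition semi_stationary :: "'w measure \<Rightarrow> (real \<Rightarrow> 'w \<Rightarrow> real ^ 'd) \<Rightarrow> bool" where
  "semi_stationary M Z \<longleftrightarrow> (\<exists>p. semi_stationary_with_period M p Z)"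

end

theory Submission
  imports Defs
begin

text \<open>
  Let \<open>\<xi>\<^sub>k\<close> be the value of the random measure on \<open>(k/c, (k+1)/c]\<close>; these are i.i.d. The equation
  says exactly that \<open>Z\<close> is constant on every \<open>[k/c, (k+1)/c)\<close> and that \<open>Z\<^sub>k = Z\<^bsub>k/c\<^esub>\<close> obeys the
  autoregression \<open>b Z\<^sub>k = Z\<^bsub>k-1\<^esub> + \<xi>\<^bsub>k-1\<^esub>\<close>, which \<open>W\<^sub>k = \<Sum>\<^sub>i b\<^bsup>-i-1\<^esup> \<xi>\<^bsub>k-1-i\<^esub>\<close> solves.
  Under the logarithmic moment condition this series converges absolutely by the Borel--Cantelli
  lemma. Conversely, a semi-stationary cadlag solution is tight over all times, because its paths
  are bounded on one period; hence so are the partial sums \<open>Z\<^sub>0 - b\<^bsup>-n\<^esup> Z\<^bsub>-n\<^esub>\<close> of the series, and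
  Ottaviani's inequality turns this into \<open>\<Sum>\<^sub>j P(|\<xi>| > C b\<^sup>j) < \<infinity>\<close>, i.e. the logarithmic
  moment. Uniqueness follows since the difference of two solutions satisfies \<open>D\<^bsub>k-n\<^esub> = b\<^sup>n D\<^sub>k\<close>
  and is tight. Infinite divisibility of the stationary law comes from refining the grid.
\<close>

subsection \<open>Cadlag functions and convergence in probability\<close>

text \<open>Two obstacles shape the development. The random measure is additive, and agrees with the
  process, only almost surely for each fixed choice of sets; identities between paths are therefore
  reduced to the countably many grid points \<open>k / c\<close>. And the improper integrals are
  limits along all real endpoints, so an incomplete cell remains at the moving end. No single path
  controls its increment, since the cell runs off to infinity, but homogeneity carries its law back
  to a fixed bounded interval. Nearly all identities in law have one source:
  \<open>geom_sum b\<close> is a measurable function of an i.i.d. family, whose law is unchanged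
  when distinct indices are replaced by other distinct ones. This gives the period
  \<open>1 / c\<close>, identifies sums over past cells with sums over future ones, and makes the
  pieces from a finer grid identically distributed. The hypothesis speaks of an interval of length
  1, the series of cells of length \<open>1 / c\<close> or shorter. Longer intervals follow from
  subadditivity of the logarithmic moment up to a constant, shorter ones from the fact that adding
  an independent variable cannot remove a heavy tail.\<close>

lemma eventually_floor_at_right:
  assumes "c > 0"
  shows "eventually (\<lambda>u. \<lfloor>c * u\<rfloor> = \<lfloor>c * t\<rfloor>) (at_right (t::real))"
proof -
  have "t < (of_int \<lfloor>c * t\<rfloor> + 1) / c"
    using assms by (simp add: field_simps) linarith
  then have "eventually (\<lambda>u. u \<in> {t<..<(of_int \<lfloor>c * t\<rfloor> + 1) / c}) (at_right t)"
    by (rule eventually_at_right_real)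
  then show ?thesis
  proof eventually_elim
    case (elim u)
    have "c * t < c * u" "c * u < of_int \<lfloor>c * t\<rfloor> + 1"
      using elim assms by (simp_all add: field_simps)
    then show ?case by linarith
  qed
qed

text \<open>The value \<open>\<lceil>c * t\<rceil> - 1\<close> covers both cases: it is
  \<open>\<lfloor>c * t\<rfloor>\<close> inside a cell and one less at a grid point.\<close>

lemma eventually_floor_at_left:
  assumes "c > 0"
  shows "eventually (\<lambda>u. \<lfloor>c * u\<rfloor> = \<lceil>c * t\<rceil> - 1) (at_left (t::real))"
proof -
  have "(of_int \<lceil>c * t\<rceil> - 1) / c < t"
    using assms by (simp add: field_simps) linarith
  then have "eventually (\<lambda>u. u \<in> {(of_int \<lceil>c * t\<rceil> - 1) / c<..<t}) (at_left t)"
    by (rule eventually_at_left_real)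
  then show ?thesis
  proof eventually_elim
    case (elim u)
    have "c * u < c * t" "of_int \<lceil>c * t\<rceil> - 1 < c * u"
      using elim assms by (simp_all add: field_simps)
    then show ?case by linarith
  qed
qed

text \<open>Near \<open>t\<close>, on either side, the coefficients are eventually constant, so only
  \<open>f\<close> has to converge. The affine form serves pure step paths (\<open>h = 0\<close>) as
  well as the integral process, which adds a multiple of \<open>X\<close> on each cell.\<close>

lemma cadlag_floor_affine:
  fixes f :: "real \<Rightarrow> 'a::real_normed_vector"
  assumes "cadlag f" "c > 0"
  shows "cadlag (\<lambda>t. g \<lfloor>c * t\<rfloor> + h \<lfloor>c * t\<rfloor> *\<^sub>R f t)"
  unfolding cadlag_def
proof (intro allI conjI)
  fix t
  have r: "(f \<longlongrightarrow> f t) (at_right t)"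
    using assms(1) by (simp add: cadlag_def continuous_within)
  have "((\<lambda>u. g \<lfloor>c * t\<rfloor> + h \<lfloor>c * t\<rfloor> *\<^sub>R f u) \<longlongrightarrow> g \<lfloor>c * t\<rfloor> + h \<lfloor>c * t\<rfloor> *\<^sub>R f t) (at_right t)"
    by (intro tendsto_intros r)
  then have "((\<lambda>u. g \<lfloor>c * u\<rfloor> + h \<lfloor>c * u\<rfloor> *\<^sub>R f u) \<longlongrightarrow> g \<lfloor>c * t\<rfloor> + h \<lfloor>c * t\<rfloor> *\<^sub>R f t) (at_right t)"
    by (rule Lim_transform_eventually)
      (use eventually_floor_at_right[OF assms(2), of t] in eventually_elim, simp)
  then show "continuous (at_right t) (\<lambda>t. g \<lfloor>c * t\<rfloor> + h \<lfloor>c * t\<rfloor> *\<^sub>R f t)"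
    by (simp add: continuous_within)
  obtain l where l: "(f \<longlongrightarrow> l) (at_left t)"
    using assms(1) by (auto simp: cadlag_def)
  let ?k = "\<lceil>c * t\<rceil> - 1"
  have "((\<lambda>u. g ?k + h ?k *\<^sub>R f u) \<longlongrightarrow> g ?k + h ?k *\<^sub>R l) (at_left t)"
    by (intro tendsto_intros l)
  then have "((\<lambda>u. g \<lfloor>c * u\<rfloor> + h \<lfloor>c * u\<rfloor> *\<^sub>R f u) \<longlongrightarrow> g ?k + h ?k *\<^sub>R l) (at_left t)"
    by (rule Lim_transform_eventually)
      (use eventually_floor_at_left[OF assms(2), of t] in eventually_elim, simp)
  then show "\<exists>l. ((\<lambda>t. g \<lfloor>c * t\<rfloor> + h \<lfloor>c * t\<rfloor> *\<^sub>R f t) \<longlongrightarrow> l) (at_left t)"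
    by blast
qed

text \<open>By right continuity, \<open>f\<close> is the pointwise limit of step functions that
  sample it slightly to the right. Needed to integrate a path against \<open>d[cu]\<close>.\<close>

lemma cadlag_measurable:
  fixes f :: "real \<Rightarrow> 'a::metric_space"
  assumes "cadlag f"
  shows "f \<in> borel_measurable borel"
proof (rule borel_measurable_LIMSEQ_metric)
  fix i :: nat
  have "(\<lambda>u. \<lfloor>real (Suc i) * u\<rfloor>) \<in> borel \<rightarrow>\<^sub>M count_space UNIV"
    by measurable
  then have "(\<lambda>k. f ((of_int k + 1) / real (Suc i))) \<circ> (\<lambda>u. \<lfloor>real (Suc i) * u\<rfloor>) \<in> borel_measurable borel"
    by (rule measurable_comp) simp
  then show "(\<lambda>u. f ((of_int \<lfloor>real (Suc i) * u\<rfloor> + 1) / real (Suc i))) \<in> borel_measurable borel"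
    by (simp add: comp_def)
next
  fix u :: real
  \<comment> \<open>The \<open>+ 1\<close> puts the sample point strictly to the right of
    \<open>u\<close>, as the filter \<open>at_right u\<close> demands.\<close>
  define a where "a i = (of_int \<lfloor>real (Suc i) * u\<rfloor> + 1) / real (Suc i)" for i
  have gt: "u < a i" for i
    unfolding a_def by (simp add: field_simps del: of_nat_Suc) linarith
  have le: "a i \<le> u + 1 / real (Suc i)" for i
    unfolding a_def by (simp add: field_simps del: of_nat_Suc)
  have "(\<lambda>i. u + 1 / real (Suc i)) \<longlonglongrightarrow> u + 0"
    by (intro tendsto_intros LIMSEQ_inverse_real_of_nat[unfolded inverse_eq_divide])
  then have *: "(\<lambda>i. u + 1 / real (Suc i)) \<longlonglongrightarrow> u" by simp
  have "a \<longlonglongrightarrow> u"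
  proof (rule tendsto_sandwich)
    show "\<forall>\<^sub>F n in sequentially. u \<le> a n"
      by (intro always_eventually allI less_imp_le gt)
    show "\<forall>\<^sub>F n in sequentially. a n \<le> u + 1 / real (Suc n)"
      by (intro always_eventually allI le)
  qed (use * in simp_all)
  then have "filterlim a (at_right u) sequentially"
    unfolding filterlim_at using gt by (simp add: less_imp_neq[OF gt, symmetric])
  moreover have "(f \<longlongrightarrow> f u) (at_right u)"
    using assms by (simp add: cadlag_def continuous_within)
  ultimately show "(\<lambda>i. f ((of_int \<lfloor>real (Suc i) * u\<rfloor> + 1) / real (Suc i))) \<longlonglongrightarrow> f u"
    unfolding a_def[symmetric] by (rule filterlim_compose[rotated])
qed

text \<open>Compactness by bisection: the two one-sided limits and the value at the point bound
  \<open>f\<close> locally, and boundedness passes to adjacent intervals.\<close>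

lemma cadlag_bounded:
  fixes f :: "real \<Rightarrow> 'a::real_normed_vector"
  assumes "cadlag f"
  shows "bounded (f ` {u..v})"
proof (cases "u \<le> v")
  case True
  then show ?thesis
  proof (induction rule: Bolzano)
    case (trans a b c)
    then have "{a..c} = {a..b} \<union> {b..c}" by auto
    then show ?case using trans by (simp add: image_Un)
  next
    case (local x)
    have ev: "\<exists>B. eventually (\<lambda>u. norm (f u) \<le> B) F" if "(f \<longlongrightarrow> l) F" for l F
    proof -
      have "eventually (\<lambda>u. dist (f u) l < 1) F"
        using that by (rule tendstoD) simp
      then have "eventually (\<lambda>u. norm (f u) \<le> norm l + 1) F"
        by eventually_elim (smt (verit) dist_norm norm_triangle_ineq2)
      then show ?thesis by blast
    qed
    obtain l where l: "(f \<longlongrightarrow> l) (at_left x)"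
      using assms by (auto simp: cadlag_def)
    have r: "(f \<longlongrightarrow> f x) (at_right x)"
      using assms by (simp add: cadlag_def continuous_within)
    obtain B1 B2 where "eventually (\<lambda>u. norm (f u) \<le> B1) (at_left x)"
        "eventually (\<lambda>u. norm (f u) \<le> B2) (at_right x)"
      using ev[OF l] ev[OF r] by blast
    then obtain y z where yz: "y < x" "\<And>u. y < u \<Longrightarrow> u < x \<Longrightarrow> norm (f u) \<le> B1"
      "x < z" "\<And>u. x < u \<Longrightarrow> u < z \<Longrightarrow> norm (f u) \<le> B2"
      unfolding eventually_at_left_field eventually_at_right_field by blast
    define d where "d = min (x - y) (z - x)"
    have "d > 0" using yz by (simp add: d_def)
    moreover have "bounded (f ` {a..b})" if "a \<le> x" "x \<le> b" "b - a < d" for a b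
    proof (rule boundedI)
      fix w assume "w \<in> f ` {a..b}"
      then obtain u where u: "w = f u" "a \<le> u" "u \<le> b" by auto
      then have "u < x \<Longrightarrow> y < u" "x < u \<Longrightarrow> u < z" using that by (auto simp: d_def)
      then show "norm w \<le> max (max B1 B2) (norm (f x))"
        using yz(2,4)[of u] u(1) by (cases u x rule: linorder_cases) auto
    qed
    ultimately show ?case by blast
  qed
qed auto

section \<open>Convergence in probability and tightness\<close>

context prob_space
begin

lemma AE_tendsto_imp_prob_tendsto_0:
  fixes Y :: "nat \<Rightarrow> 'a \<Rightarrow> 'b::{second_countable_topology, real_normed_vector}"
  assumes [measurable]: "\<And>n. Y n \<in> borel_measurable M"
    and "AE \<omega> in M. (\<lambda>n. Y n \<omega>) \<longlonglongrightarrow> 0" "\<epsilon> > 0"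
  shows "(\<lambda>n. prob {\<omega>\<in>space M. norm (Y n \<omega>) > \<epsilon>}) \<longlonglongrightarrow> 0"
proof -
  have "(\<lambda>n. \<integral>\<omega>. indicator {\<omega>\<in>space M. norm (Y n \<omega>) > \<epsilon>} \<omega> \<partial>M) \<longlonglongrightarrow> (\<integral>\<omega>. 0 \<partial>M :: real)"
  proof (rule integral_dominated_convergence[where w="\<lambda>_. 1"])
    show "AE \<omega> in M. (\<lambda>n. indicator {\<omega>\<in>space M. norm (Y n \<omega>) > \<epsilon>} \<omega> :: real) \<longlonglongrightarrow> 0"
      using assms(2)
    proof eventually_elim
      case (elim \<omega>)
      then have "eventually (\<lambda>n. norm (Y n \<omega>) < \<epsilon>) sequentially"
        using assms(3) by (auto dest: tendstoD)
      then have "eventually (\<lambda>n. indicator {\<omega>\<in>space M. norm (Y n \<omega>) > \<epsilon>} \<omega> = (0::real)) sequentially"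
        by eventually_elim (auto simp: indicator_def)
      then show ?case by (rule tendsto_eventually)
    qed
  qed (auto simp: indicator_def)
  then show ?thesis by simp
qed

text \<open>If tightness failed, there would be times \<open>t n\<close> with
  \<open>norm (Z (t n)) > n + 1\<close> on an event of probability above \<open>\<epsilon>\<close>.
  But each path is bounded on \<open>{u..v}\<close>, so \<open>Z (t n) / (n + 1)\<close> tends to 0
  everywhere. Arguing along a sequence keeps suprema over uncountably many times, and their
  measurability, out of the proof.\<close>

lemma cadlag_process_tight:
  fixes Z :: "real \<Rightarrow> 'a \<Rightarrow> real ^ 'd"
  assumes Z: "cadlag_process M Z" and "\<epsilon> > 0"
  shows "\<exists>a>0. \<forall>t\<in>{u..v}. prob {\<omega>\<in>space M. norm (Z t \<omega>) > a} \<le> \<epsilon>"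
proof (rule ccontr)
  assume "\<not> ?thesis"
  then have "\<forall>n::nat. \<exists>t\<in>{u..v}. prob {\<omega>\<in>space M. norm (Z t \<omega>) > real (Suc n)} > \<epsilon>"
    by (metis not_le of_nat_0_less_iff zero_less_Suc)
  then obtain t where t: "\<And>n. t n \<in> {u..v}"
    "\<And>n. prob {\<omega>\<in>space M. norm (Z (t n) \<omega>) > real (Suc n)} > \<epsilon>"
    by metis
  have [measurable]: "Z s \<in> borel_measurable M" for s
    using Z by (simp add: cadlag_process_def)
  have "(\<lambda>n. prob {\<omega>\<in>space M. norm ((1 / real (Suc n)) *\<^sub>R Z (t n) \<omega>) > 1}) \<longlonglongrightarrow> 0"
  proof (rule AE_tendsto_imp_prob_tendsto_0)
    show "AE \<omega> in M. (\<lambda>n. (1 / real (Suc n)) *\<^sub>R Z (t n) \<omega>) \<longlonglongrightarrow> 0"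
    proof (rule AE_I2)
      fix \<omega> assume "\<omega> \<in> space M"
      then have "bounded ((\<lambda>t. Z t \<omega>) ` {u..v})"
        using Z by (intro cadlag_bounded) (auto simp: cadlag_process_def)
      then have "Bseq (\<lambda>n. Z (t n) \<omega>)"
        using t(1) by (auto simp: Bseq_eq_bounded intro: bounded_subset)
      then obtain K where K: "\<And>n. norm (Z (t n) \<omega>) \<le> K"
        by (metis BseqE)
      have "(\<lambda>n. 1 / real (Suc n) * K) \<longlonglongrightarrow> 0"
        using LIMSEQ_inverse_real_of_nat unfolding inverse_eq_divide
        by (rule tendsto_mult_left_zero)
      then show "(\<lambda>n. (1 / real (Suc n)) *\<^sub>R Z (t n) \<omega>) \<longlonglongrightarrow> 0"
        by (rule Lim_null_comparison[rotated])
          (auto intro!: always_eventually divide_right_mono K simp del: of_nat_Suc)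
    qed
  qed auto
  moreover have "{\<omega>\<in>space M. norm ((1 / real (Suc n)) *\<^sub>R Z (t n) \<omega>) > 1}
      = {\<omega>\<in>space M. norm (Z (t n) \<omega>) > real (Suc n)}" for n
    by (auto simp: field_simps simp del: of_nat_Suc)
  ultimately have "(\<lambda>n. prob {\<omega>\<in>space M. norm (Z (t n) \<omega>) > real (Suc n)}) \<longlonglongrightarrow> 0"
    by simp
  then have "eventually (\<lambda>n. prob {\<omega>\<in>space M. norm (Z (t n) \<omega>) > real (Suc n)} < \<epsilon>) sequentially"
    using assms(2) by (auto dest: order_tendstoD)
  then show False
    using t(2) by (auto simp: eventually_sequentially dest: less_asym)
qed

lemma tendsto_in_prob_AE:
  fixes Y :: "nat \<Rightarrow> 'a \<Rightarrow> real ^ 'd"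
  assumes [measurable]: "\<And>n. Y n \<in> borel_measurable M" "L \<in> borel_measurable M"
    and "AE \<omega> in M. (\<lambda>n. Y n \<omega>) \<longlonglongrightarrow> L \<omega>"
  shows "tendsto_in_prob M Y L sequentially"
  unfolding tendsto_in_prob_def
proof (intro allI impI)
  fix \<epsilon> :: real assume "\<epsilon> > 0"
  have "AE \<omega> in M. (\<lambda>n. Y n \<omega> - L \<omega>) \<longlonglongrightarrow> 0"
    using assms(3) by eventually_elim (rule LIM_zero)
  then show "(\<lambda>n. prob {\<omega>\<in>space M. norm (Y n \<omega> - L \<omega>) > \<epsilon>}) \<longlonglongrightarrow> 0"
    by (intro AE_tendsto_imp_prob_tendsto_0 \<open>\<epsilon> > 0\<close>) auto
qed

lemma prob_norm_add_gt_le: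
  fixes U V :: "'a \<Rightarrow> 'b::{second_countable_topology, real_normed_vector}"
  assumes [measurable]: "U \<in> borel_measurable M" "V \<in> borel_measurable M"
  shows "prob {\<omega>\<in>space M. norm (U \<omega> + V \<omega>) > u + v}
    \<le> prob {\<omega>\<in>space M. norm (U \<omega>) > u} + prob {\<omega>\<in>space M. norm (V \<omega>) > v}"
proof -
  have "prob {\<omega>\<in>space M. norm (U \<omega> + V \<omega>) > u + v}
      \<le> prob ({\<omega>\<in>space M. norm (U \<omega>) > u} \<union> {\<omega>\<in>space M. norm (V \<omega>) > v})"
    by (intro finite_measure_mono subsetI, safe)
      (auto intro: order_trans[OF norm_triangle_ineq] simp: not_less,
       smt (verit) norm_triangle_ineq)
  also have "\<dots> \<le> prob {\<omega>\<in>space M. norm (U \<omega>) > u} + prob {\<omega>\<in>space M. norm (V \<omega>) > v}"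
    by (rule measure_Un_le) auto
  finally show ?thesis .
qed

lemma prob_norm_AE_eq:
  fixes U V :: "'a \<Rightarrow> 'b::{second_countable_topology, real_normed_vector}"
  assumes [measurable]: "U \<in> borel_measurable M" "V \<in> borel_measurable M"
    and "AE \<omega> in M. U \<omega> = V \<omega>"
  shows "prob {\<omega>\<in>space M. norm (U \<omega>) > u} = prob {\<omega>\<in>space M. norm (V \<omega>) > u}"
  using assms(3) by (intro measure_eq_AE) (auto elim: eventually_mono)

lemma prob_norm_distr:
  assumes [measurable]: "U \<in> borel_measurable M"
  shows "prob {\<omega>\<in>space M. norm (U \<omega>) > u} = measure (distr M borel U) {x. norm x > u}"
  by (subst measure_distr) (auto intro!: arg_cong[where f=prob])

lemma distr_AE_cong:
  assumes "U \<in> borel_measurable M" "V \<in> borel_measurable M" "AE \<omega> in M. U \<omega> = V \<omega>"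
  shows "distr M borel U = distr M borel V"
  by (rule distr_cong_AE) (use assms in auto)

lemma tendsto_in_prob_cong:
  fixes Y Y' :: "'i \<Rightarrow> 'a \<Rightarrow> real ^ 'd"
  assumes [measurable]: "\<And>i. Y i \<in> borel_measurable M" "\<And>i. Y' i \<in> borel_measurable M"
     "L \<in> borel_measurable M" "L' \<in> borel_measurable M"
    and "eventually (\<lambda>i. AE \<omega> in M. Y i \<omega> = Y' i \<omega>) F" "AE \<omega> in M. L \<omega> = L' \<omega>"
    and lim: "tendsto_in_prob M Y L F"
  shows "tendsto_in_prob M Y' L' F"
  unfolding tendsto_in_prob_def
proof (intro allI impI)
  fix \<epsilon> :: real assume "\<epsilon> > 0"
  then have "((\<lambda>i. prob {\<omega>\<in>space M. norm (Y i \<omega> - L \<omega>) > \<epsilon>}) \<longlongrightarrow> 0) F"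
    using lim by (simp add: tendsto_in_prob_def)
  then show "((\<lambda>i. prob {\<omega>\<in>space M. norm (Y' i \<omega> - L' \<omega>) > \<epsilon>}) \<longlongrightarrow> 0) F"
  proof (rule Lim_transform_eventually)
    show "eventually (\<lambda>i. prob {\<omega>\<in>space M. norm (Y i \<omega> - L \<omega>) > \<epsilon>}
      = prob {\<omega>\<in>space M. norm (Y' i \<omega> - L' \<omega>) > \<epsilon>}) F"
      using assms(5)
    proof eventually_elim
      case (elim i)
      show ?case
        by (rule prob_norm_AE_eq) (use elim assms(6) in auto)
    qed
  qed
qed

text \<open>In the applications \<open>N\<close> is the incomplete cell at the moving end of an
  improper integral, which vanishes in probability, while the complete cells converge almost
  surely.\<close>

lemma tendsto_in_prob_add_null:
  fixes Y N :: "'i \<Rightarrow> 'a \<Rightarrow> real ^ 'd"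
  assumes [measurable]: "\<And>i. Y i \<in> borel_measurable M" "\<And>i. N i \<in> borel_measurable M"
     "L \<in> borel_measurable M"
    and Y: "tendsto_in_prob M Y L F" and N: "tendsto_in_prob M N (\<lambda>_. 0) F"
  shows "tendsto_in_prob M (\<lambda>i \<omega>. Y i \<omega> + N i \<omega>) L F"
  unfolding tendsto_in_prob_def
proof (intro allI impI)
  fix \<epsilon> :: real assume "\<epsilon> > 0"
  then have "\<epsilon>/2 > 0" by simp
  then have 1: "((\<lambda>i. prob {\<omega>\<in>space M. norm (Y i \<omega> - L \<omega>) > \<epsilon>/2}) \<longlongrightarrow> 0) F"
    and 2: "((\<lambda>i. prob {\<omega>\<in>space M. norm (N i \<omega>) > \<epsilon>/2}) \<longlongrightarrow> 0) F"
    using Y[unfolded tendsto_in_prob_def, rule_format, of "\<epsilon>/2"]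
      N[unfolded tendsto_in_prob_def diff_zero, rule_format, of "\<epsilon>/2"] by blast+
  have le: "prob {\<omega>\<in>space M. norm (Y i \<omega> + N i \<omega> - L \<omega>) > \<epsilon>}
     \<le> prob {\<omega>\<in>space M. norm (Y i \<omega> - L \<omega>) > \<epsilon>/2} + prob {\<omega>\<in>space M. norm (N i \<omega>) > \<epsilon>/2}" for i
    using prob_norm_add_gt_le[of "\<lambda>\<omega>. Y i \<omega> - L \<omega>" "N i" "\<epsilon>/2" "\<epsilon>/2"]
    by (simp add: algebra_simps)
  have "((\<lambda>i. prob {\<omega>\<in>space M. norm (Y i \<omega> - L \<omega>) > \<epsilon>/2}
      + prob {\<omega>\<in>space M. norm (N i \<omega>) > \<epsilon>/2}) \<longlongrightarrow> 0) F"
    using tendsto_add[OF 1 2] by simp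
  then show "((\<lambda>i. prob {\<omega>\<in>space M. norm (Y i \<omega> + N i \<omega> - L \<omega>) > \<epsilon>}) \<longlongrightarrow> 0) F"
    by (rule Lim_null_comparison[rotated])
      (intro always_eventually allI, simp only: real_norm_def abs_of_nonneg[OF measure_nonneg] le)
qed

lemma AE_eq_0_if_prob_small:
  fixes U :: "'a \<Rightarrow> 'b::{second_countable_topology, real_normed_vector}"
  assumes [measurable]: "U \<in> borel_measurable M"
    and small: "\<And>\<epsilon> \<delta>. \<epsilon> > 0 \<Longrightarrow> \<delta> > 0 \<Longrightarrow> prob {\<omega>\<in>space M. norm (U \<omega>) > \<epsilon>} \<le> \<delta>"
  shows "AE \<omega> in M. U \<omega> = 0"
proof -
  have "AE \<omega> in M. \<forall>n. \<not> norm (U \<omega>) > 1 / real (Suc n)"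
  proof (subst AE_all_countable, rule allI)
    fix n
    have "prob {\<omega>\<in>space M. norm (U \<omega>) > 1 / real (Suc n)} = 0"
      by (rule antisym[OF field_le_epsilon measure_nonneg]) (use small in auto)
    then show "AE \<omega> in M. \<not> norm (U \<omega>) > 1 / real (Suc n)"
      by (subst (asm) prob_eq_0) (auto elim!: eventually_mono)
  qed
  then show ?thesis
  proof eventually_elim
    case (elim \<omega>)
    show ?case
    proof (rule ccontr)
      assume "U \<omega> \<noteq> 0"
      then obtain n where "inverse (real (Suc n)) < norm (U \<omega>)"
        using reals_Archimedean[of "norm (U \<omega>)"] by auto
      then show False using elim by (auto simp: inverse_eq_divide)
    qed
  qed
qed

lemma tendsto_in_prob_unique:
  fixes Y :: "'i \<Rightarrow> 'a \<Rightarrow> real ^ 'd"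
  assumes [measurable]: "\<And>i. Y i \<in> borel_measurable M" "L \<in> borel_measurable M"
     "L' \<in> borel_measurable M"
    and Y: "tendsto_in_prob M Y L F" "tendsto_in_prob M Y L' F" and "F \<noteq> bot"
  shows "AE \<omega> in M. L \<omega> = L' \<omega>"
proof -
  have "AE \<omega> in M. L \<omega> - L' \<omega> = 0"
  proof (rule AE_eq_0_if_prob_small)
    fix \<epsilon> \<delta> :: real assume "\<epsilon> > 0" "\<delta> > 0"
    have lim: "eventually (\<lambda>i. prob {\<omega>\<in>space M. norm (Y i \<omega> - K \<omega>) > \<epsilon>/2} < \<delta>/2) F"
      if "tendsto_in_prob M Y K F" for K
    proof (rule order_tendstoD(2)[of _ 0])
      show "((\<lambda>i. prob {\<omega>\<in>space M. norm (Y i \<omega> - K \<omega>) > \<epsilon>/2}) \<longlongrightarrow> 0) F"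
        using that half_gt_zero[OF \<open>\<epsilon> > 0\<close>] unfolding tendsto_in_prob_def by blast
    qed (use \<open>\<delta> > 0\<close> in simp)
    have "eventually (\<lambda>i. prob {\<omega>\<in>space M. norm (L \<omega> - L' \<omega>) > \<epsilon>} \<le> \<delta>) F"
      using lim[OF Y(1)] lim[OF Y(2)]
    proof eventually_elim
      case (elim i)
      have "prob {\<omega>\<in>space M. norm ((L \<omega> - Y i \<omega>) + (Y i \<omega> - L' \<omega>)) > \<epsilon>/2 + \<epsilon>/2}
        \<le> prob {\<omega>\<in>space M. norm (L \<omega> - Y i \<omega>) > \<epsilon>/2} + prob {\<omega>\<in>space M. norm (Y i \<omega> - L' \<omega>) > \<epsilon>/2}"
        by (rule prob_norm_add_gt_le) auto
      then show ?case using elim by (simp add: norm_minus_commute)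
    qed
    \<comment> \<open>The bound no longer mentions \<open>i\<close>, so holding eventually along a
      proper filter means holding outright.\<close>
    then show "prob {\<omega>\<in>space M. norm (L \<omega> - L' \<omega>) > \<epsilon>} \<le> \<delta>"
      using \<open>F \<noteq> bot\<close> by (simp add: eventually_const)
  qed auto
  then show ?thesis by simp
qed

end

subsection \<open>Independent sums and logarithmic moments\<close>

text \<open>The weights start at \<open>1 / b\<close> because the autoregression divides the newest
  noise term by \<open>b\<close>. The sum is a measurable function of all families, divergent ones
  included, so laws can be compared before convergence is known.\<close>

definition geom_sum :: "real \<Rightarrow> (nat \<Rightarrow> real ^ 'd) \<Rightarrow> real ^ 'd" where
  "geom_sum b x = (\<Sum>i. (1 / b) ^ Suc i *\<^sub>R x i)"

lemma geom_sum_measurable [measurable (raw)]: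
  assumes [measurable]: "\<And>i. f i \<in> borel_measurable N"
  shows "(\<lambda>\<omega>. geom_sum b (\<lambda>i. f i \<omega>)) \<in> borel_measurable N"
  unfolding geom_sum_def by measurable

text \<open>Splitting off the head term. Pathwise this is the autoregression for \<open>W\<close>;
  in law it is the factorisation behind semi-selfdecomposability.\<close>

lemma geom_sum_Suc:
  assumes "summable (\<lambda>i. (1 / b) ^ Suc i *\<^sub>R x i)"
  shows "geom_sum b x = (1 / b) *\<^sub>R (x 0 + geom_sum b (\<lambda>i. x (Suc i)))"
proof (cases "b = 0")
  case False
  have s: "summable (\<lambda>i. (1 / b) *\<^sub>R ((1 / b) ^ Suc i *\<^sub>R x (Suc i)))"
    using summable_Suc_iff[THEN iffD2, OF assms] by simp
  \<comment> \<open>Undoing the factor \<open>1 / b\<close> gives the summability of the shifted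
    series, which is needed to pull that factor out of the sum.\<close>
  then have s': "summable (\<lambda>i. b *\<^sub>R ((1 / b) *\<^sub>R ((1 / b) ^ Suc i *\<^sub>R x (Suc i))))"
    by (rule summable_scaleR_right)
  have "geom_sum b x = (\<Sum>i. (1 / b) ^ Suc (Suc i) *\<^sub>R x (Suc i)) + (1 / b) *\<^sub>R x 0"
    unfolding geom_sum_def using suminf_split_head[OF assms] by simp
  also have "(\<Sum>i. (1 / b) ^ Suc (Suc i) *\<^sub>R x (Suc i))
      = (\<Sum>i. (1 / b) *\<^sub>R ((1 / b) ^ Suc i *\<^sub>R x (Suc i)))"
    by simp
  also have "\<dots> = (1 / b) *\<^sub>R geom_sum b (\<lambda>i. x (Suc i))"
    unfolding geom_sum_def using s' False by (subst suminf_scaleR_right) simp_all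
  finally show ?thesis by (simp add: algebra_simps)
\<comment> \<open>For \<open>b = 0\<close> both sides vanish by the convention
  \<open>1 / 0 = 0\<close>.\<close>
qed (simp add: geom_sum_def)

text \<open>Such \<open>n\<close> lie below \<open>ln y / ln r\<close>, and the 1 pays for rounding
  up. With \<open>y\<close> the norm of a random variable, this bounds a sum of tail indicators by a
  logarithm.\<close>

lemma card_power_less_le:
  fixes r y :: real
  assumes "r > 1"
  shows "real (card {n\<in>{..<N}. r ^ n < y}) \<le> 1 + max (ln y) 0 / ln r"
proof (cases "y > 1")
  case True
  define L where "L = ln y / ln r"
  have L: "L > 0" using True assms by (simp add: L_def)
  have "{n\<in>{..<N}. r ^ n < y} \<subseteq> {..<nat \<lceil>L\<rceil>}"
  proof
    fix n assume "n \<in> {n\<in>{..<N}. r ^ n < y}"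
    then have "ln (r ^ n) < ln y" using assms True by simp
    then have "real n < L" using assms by (simp add: L_def ln_realpow field_simps)
    then show "n \<in> {..<nat \<lceil>L\<rceil>}" by (simp, linarith)
  qed
  then have "card {n\<in>{..<N}. r ^ n < y} \<le> card {..<nat \<lceil>L\<rceil>}"
    by (rule card_mono[rotated]) simp
  then have "real (card {n\<in>{..<N}. r ^ n < y}) \<le> 1 + L"
    using L by simp linarith
  then show ?thesis using True by (simp add: L_def max_def)
next
  case False
  have "\<not> r ^ n < y" for n
    using False assms one_le_power[of r n] by linarith
  then show ?thesis using assms by (simp add: ln_gt_zero)
qed

section \<open>Independence under reindexing and laws of i.i.d. families\<close>

context prob_space
begin

lemma indep_vars_inj_reindex:
  assumes f: "inj_on f I" and X: "indep_vars M' X (f ` I)"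
  shows "indep_vars (\<lambda>i. M' (f i)) (\<lambda>i. X (f i)) I"
  unfolding indep_vars_def2
proof (intro conjI ballI indep_setsI)
  fix J A assume J: "J \<noteq> {}" "J \<subseteq> I" "finite J"
    and A: "\<forall>j\<in>J. A j \<in> {X (f j) -` B \<inter> space M |B. B \<in> sets (M' (f j))}"
  then have "\<forall>j\<in>J. \<exists>B. A j = X (f j) -` B \<inter> space M \<and> B \<in> sets (M' (f j))"
    by auto
  then obtain B where B: "\<And>j. j \<in> J \<Longrightarrow> A j = X (f j) -` B j \<inter> space M"
    "\<And>j. j \<in> J \<Longrightarrow> B j \<in> sets (M' (f j))"
    by (auto dest!: bchoice)
  define g where "g = the_inv_into I f"
  have g: "g (f j) = j" if "j \<in> J" for j
    using that J f by (auto simp: g_def intro!: the_inv_into_f_f)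
  have inj: "inj_on f J" using f J inj_on_subset by blast
  have "prob (\<Inter>i\<in>f ` J. X i -` B (g i) \<inter> space M) = (\<Prod>i\<in>f ` J. prob (X i -` B (g i) \<inter> space M))"
    by (rule indep_varsD[OF X]) (use J B g in auto)
  moreover have "(\<Inter>i\<in>f ` J. X i -` B (g i) \<inter> space M) = (\<Inter>j\<in>J. A j)"
    using B g by auto
  moreover have "(\<Prod>i\<in>f ` J. prob (X i -` B (g i) \<inter> space M)) = (\<Prod>j\<in>J. prob (A j))"
    using B g by (subst prod.reindex[OF inj]) (auto intro!: prod.cong)
  ultimately show "prob (\<Inter>j\<in>J. A j) = (\<Prod>j\<in>J. prob (A j))" by simp
qed (use X in \<open>auto simp: indep_vars_def2\<close>)

text \<open>The common law is an argument, so that different families with the same law can be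
  compared.\<close>

definition iid :: "('i \<Rightarrow> 'a \<Rightarrow> real ^ 'd) \<Rightarrow> (real ^ 'd) measure \<Rightarrow> bool" where
  "iid \<xi> \<nu> \<longleftrightarrow> indep_vars (\<lambda>_. borel) \<xi> UNIV \<and> (\<forall>i. distr M borel (\<xi> i) = \<nu>)"

lemma iid_measurable: "iid \<xi> \<nu> \<Longrightarrow> \<xi> i \<in> borel_measurable M"
  by (simp add: iid_def indep_vars_def)

lemma iid_prob_eq:
  assumes "iid \<xi> \<nu>"
  shows "prob {\<omega>\<in>space M. norm (\<xi> i \<omega>) > u} = prob {\<omega>\<in>space M. norm (\<xi> j \<omega>) > u}"
  using assms by (simp add: prob_norm_distr iid_measurable[OF assms]) (simp add: iid_def)

lemma iid_reindex:
  assumes "iid \<xi> \<nu>" "inj \<sigma>"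
  shows "iid (\<lambda>i. \<xi> (\<sigma> i)) \<nu>"
  using assms indep_vars_inj_reindex[of \<sigma> UNIV "\<lambda>_. borel" \<xi>]
  by (auto simp: iid_def intro: indep_vars_subset)

lemma iid_compose:
  assumes \<xi>: "iid \<xi> \<nu>" and f: "f \<in> borel_measurable borel"
  shows "iid (\<lambda>i \<omega>. f (\<xi> i \<omega>)) (distr \<nu> borel f)"
  unfolding iid_def
proof (intro conjI allI)
  show "indep_vars (\<lambda>_. borel) (\<lambda>i \<omega>. f (\<xi> i \<omega>)) UNIV"
    using \<xi> f by (intro indep_vars_compose2[where Y="\<lambda>_. f" and M'="\<lambda>_. borel"]) (auto simp: iid_def)
  fix i
  show "distr M borel (\<lambda>\<omega>. f (\<xi> i \<omega>)) = distr \<nu> borel f"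
    using \<xi> distr_distr[OF f iid_measurable[OF \<xi>], of i] by (simp add: iid_def comp_def)
qed

lemma iid_distr_PiM:
  assumes \<xi>: "iid \<xi> \<nu>"
  shows "distr M (Pi\<^sub>M UNIV (\<lambda>_. borel)) (\<lambda>\<omega> i. \<xi> i \<omega>) = Pi\<^sub>M UNIV (\<lambda>_. \<nu>)"
proof -
  have "indep_vars (\<lambda>_. borel) \<xi> UNIV"
    using \<xi> by (simp add: iid_def)
  from this[THEN indep_vars_iff_distr_eq_PiM[THEN iffD1, rotated 2]]
  show ?thesis
    using \<xi> by (simp add: iid_measurable) (simp add: iid_def restrict_UNIV)
qed

text \<open>Both sides are images under \<open>h\<close> of the same product measure. Together with
  \<open>iid_reindex\<close>, relabelling indices by an injection leaves every such law
  unchanged.\<close>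

lemma iid_distr_fun_eq:
  assumes \<xi>: "iid \<xi> \<nu>" and \<eta>: "iid \<eta> \<nu>" and h: "h \<in> Pi\<^sub>M UNIV (\<lambda>_. borel) \<rightarrow>\<^sub>M N"
  shows "distr M N (\<lambda>\<omega>. h (\<lambda>i. \<xi> i \<omega>)) = distr M N (\<lambda>\<omega>. h (\<lambda>i. \<eta> i \<omega>))"
proof -
  have "distr M N (\<lambda>\<omega>. h (\<lambda>i. \<zeta> i \<omega>)) = distr (Pi\<^sub>M UNIV (\<lambda>_. \<nu>)) N h" if "iid \<zeta> \<nu>" for \<zeta>
    unfolding iid_distr_PiM[OF that, symmetric]
    by (subst distr_distr[OF h]) (auto simp: comp_def intro!: measurable_PiM_single' iid_measurable[OF that])
  then show ?thesis using \<xi> \<eta> by metis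
qed

lemma distr_sum_iid_eq_convolution_power:
  fixes Y :: "nat \<Rightarrow> 'a \<Rightarrow> real ^ 'd"
  assumes "indep_vars (\<lambda>_. borel) Y {..<n}" and "\<And>i. i < n \<Longrightarrow> distr M borel (Y i) = \<nu>"
  shows "distr M borel (\<lambda>\<omega>. \<Sum>i<n. Y i \<omega>) = (convolution \<nu> ^^ n) (return borel 0)"
  using assms
proof (induction n)
  case 0
  show ?case by (simp add: distr_const)
next
  case (Suc n)
  have [measurable]: "\<And>i. i < Suc n \<Longrightarrow> Y i \<in> borel_measurable M"
    using Suc.prems(1) by (auto simp: indep_vars_def)
  have "indep_var (PiM {n} (\<lambda>_. borel)) (\<lambda>\<omega>. restrict (\<lambda>i. Y i \<omega>) {n})
      (PiM {..<n} (\<lambda>_. borel)) (\<lambda>\<omega>. restrict (\<lambda>i. Y i \<omega>) {..<n})"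
    by (rule indep_var_restrict[OF Suc.prems(1)]) auto
  then have "indep_var borel ((\<lambda>x. x n) \<circ> (\<lambda>\<omega>. restrict (\<lambda>i. Y i \<omega>) {n}))
      borel ((\<lambda>x. \<Sum>i<n. x i) \<circ> (\<lambda>\<omega>. restrict (\<lambda>i. Y i \<omega>) {..<n}))"
    by (rule indep_var_compose) (auto intro!: borel_measurable_sum)
  then have "indep_var borel (Y n) borel (\<lambda>\<omega>. \<Sum>i<n. Y i \<omega>)"
    by (simp add: comp_def cong: sum.cong_simp)
  then have "distr M borel (\<lambda>\<omega>. Y n \<omega> + (\<Sum>i<n. Y i \<omega>))
      = convolution (distr M borel (Y n)) (distr M borel (\<lambda>\<omega>. \<Sum>i<n. Y i \<omega>))"
    by (rule sum_indep_random_variable) (auto intro!: borel_measurable_sum)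
  moreover have "distr M borel (\<lambda>\<omega>. \<Sum>i<n. Y i \<omega>) = (convolution \<nu> ^^ n) (return borel 0)"
    using Suc.prems by (intro Suc.IH) (auto intro: indep_vars_subset)
  ultimately show ?case
    using Suc.prems(2)[of n] by (simp add: add.commute)
qed

text \<open>The common law of the summands is the convolution root. The decomposition is required
  almost surely only, which is what splitting a random measure provides.\<close>

lemma distr_sum_in_inf_divisible:
  fixes U :: "'a \<Rightarrow> real ^ 'd"
  assumes U: "U \<in> borel_measurable M"
    and decomp: "\<And>n::nat. n \<ge> 1 \<Longrightarrow> \<exists>Y \<nu>. indep_vars (\<lambda>_. borel) Y {..<n} \<and>
      (\<forall>i<n. distr M borel (Y i) = \<nu>) \<and> (AE \<omega> in M. U \<omega> = (\<Sum>i<n. Y i \<omega>))"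
  shows "distr M borel U \<in> inf_divisible"
  unfolding inf_divisible_def
proof (intro CollectI conjI allI impI)
  show "prob_space (distr M borel U)" by (rule prob_space_distr[OF U])
  fix n :: nat assume "n \<ge> 1"
  then obtain Y \<nu> where Y: "indep_vars (\<lambda>_. borel) Y {..<n}" "\<And>i. i < n \<Longrightarrow> distr M borel (Y i) = \<nu>"
      "AE \<omega> in M. U \<omega> = (\<Sum>i<n. Y i \<omega>)"
    using decomp by blast
  have m: "\<And>i. i < n \<Longrightarrow> Y i \<in> borel_measurable M"
    using Y(1) by (auto simp: indep_vars_def)
  have \<nu>: "prob_space \<nu>" "sets \<nu> = sets borel"
    using Y(2)[of 0] m[of 0] \<open>n \<ge> 1\<close> by (auto intro: prob_space_distr)
  have "distr M borel U = distr M borel (\<lambda>\<omega>. \<Sum>i<n. Y i \<omega>)"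
    by (rule distr_AE_cong[OF U _ Y(3)]) (auto intro: borel_measurable_sum m)
  also have "\<dots> = (convolution \<nu> ^^ n) (return borel 0)"
    by (rule distr_sum_iid_eq_convolution_power[OF Y(1,2)])
  finally show "\<exists>\<nu>. prob_space \<nu> \<and> sets \<nu> = sets borel \<and>
      distr M borel U = (convolution \<nu> ^^ n) (return borel 0)"
    using \<nu> by blast
qed simp

section \<open>Logarithmic moments, tail sums and Ottaviani's inequality\<close>

definition log_integrable :: "('a \<Rightarrow> real ^ 'd) \<Rightarrow> bool" where
  "log_integrable U \<longleftrightarrow> integrable M (\<lambda>\<omega>. max (ln (norm (U \<omega>))) 0)"

text \<open>A partial sum of the tails is the expected number of \<open>n\<close> with
  \<open>r ^ n < norm U\<close>, which \<open>card_power_less_le\<close> bounds by an integrable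
  variable.\<close>

lemma summable_tail_of_log_integrable:
  assumes [measurable]: "U \<in> borel_measurable M" and U: "log_integrable U" and "r > 1"
  shows "summable (\<lambda>n. prob {\<omega>\<in>space M. norm (U \<omega>) > r ^ n})"
proof (rule summableI_nonneg_bounded)
  fix N
  have "(\<Sum>n<N. prob {\<omega>\<in>space M. norm (U \<omega>) > r ^ n})
      = (\<Sum>n<N. \<integral>\<omega>. indicator {\<omega>\<in>space M. norm (U \<omega>) > r ^ n} \<omega> \<partial>M)"
    by simp
  also have "\<dots> = (\<integral>\<omega>. (\<Sum>n<N. indicator {\<omega>\<in>space M. norm (U \<omega>) > r ^ n} \<omega>) \<partial>M)"
    by (subst Bochner_Integration.integral_sum) (auto intro!: integrable_real_indicator simp: emeasure_eq_measure)
  also have "\<dots> \<le> (\<integral>\<omega>. 1 + max (ln (norm (U \<omega>))) 0 / ln r \<partial>M)"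
  proof (rule integral_mono)
    fix \<omega> assume "\<omega> \<in> space M"
    then have "(\<Sum>n<N. indicator {\<omega>\<in>space M. norm (U \<omega>) > r ^ n} \<omega> :: real)
        = real (card {n\<in>{..<N}. r ^ n < norm (U \<omega>)})"
      by (simp add: indicator_def sum.If_cases Int_def)
    also have "\<dots> \<le> 1 + max (ln (norm (U \<omega>))) 0 / ln r"
      by (rule card_power_less_le[OF \<open>r > 1\<close>])
    finally show "(\<Sum>n<N. indicator {\<omega>\<in>space M. norm (U \<omega>) > r ^ n} \<omega>)
       \<le> 1 + max (ln (norm (U \<omega>))) 0 / ln r" .
  qed (use U in \<open>auto simp: log_integrable_def intro!: Bochner_Integration.integrable_sum
        integrable_real_indicator simp: emeasure_eq_measure\<close>)
  finally show "(\<Sum>n<N. prob {\<omega>\<in>space M. norm (U \<omega>) > r ^ n})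
    \<le> (\<integral>\<omega>. 1 + max (ln (norm (U \<omega>))) 0 / ln r \<partial>M)" .
qed simp

text \<open>The number \<open>K\<close> of levels \<open>a * b ^ n\<close> below
  \<open>norm U\<close> satisfies \<open>ln (norm U) \<le> ln a + K * ln b\<close>, and the
  expectation of \<open>K\<close> is the sum of the tails.\<close>

lemma log_integrable_of_summable_tail:
  assumes [measurable]: "U \<in> borel_measurable M" and "b > 1" "a > 0"
    and sum: "summable (\<lambda>n. prob {\<omega>\<in>space M. norm (U \<omega>) > a * b ^ n})"
  shows "log_integrable U"
  unfolding log_integrable_def
proof (rule integrableI_nonneg)
  have pw: "ennreal (max (ln (norm (U \<omega>))) 0)
      \<le> ennreal (max (ln a) 0) + ennreal (ln b) * (\<Sum>n. indicator {\<omega>\<in>space M. norm (U \<omega>) > a * b ^ n} \<omega>)"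
    if "\<omega> \<in> space M" for \<omega>
  proof (cases "U \<omega> = 0")
    case False
    define P where "P n \<longleftrightarrow> norm (U \<omega>) \<le> a * b ^ n" for n
    obtain n where "norm (U \<omega>) / a < b ^ n"
      using real_arch_pow[OF \<open>b > 1\<close>] by blast
    then have "P n" using \<open>a > 0\<close> by (simp add: P_def field_simps)
    \<comment> \<open>By minimality the indicators with index below \<open>K\<close> all equal 1, so
      \<open>K\<close> is at most their full sum.\<close>
    define K where "K = (LEAST n. P n)"
    have K: "P K" "\<And>n. n < K \<Longrightarrow> \<not> P n"
      unfolding K_def using \<open>P n\<close> by (auto intro: LeastI dest: not_less_Least)
    have "ln (norm (U \<omega>)) \<le> ln (a * b ^ K)"
      using K(1) False \<open>a > 0\<close> \<open>b > 1\<close> by (subst ln_le_cancel_iff) (simp_all add: P_def)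
    also have "\<dots> = ln a + real K * ln b"
      using \<open>a > 0\<close> \<open>b > 1\<close> by (simp add: ln_mult ln_realpow)
    finally have "max (ln (norm (U \<omega>))) 0 \<le> max (ln a) 0 + ln b * real K"
      using \<open>b > 1\<close> by (auto simp: max_def mult.commute ln_gt_zero)
    then have "ennreal (max (ln (norm (U \<omega>))) 0) \<le> ennreal (max (ln a) 0 + ln b * real K)"
      by (rule ennreal_leI)
    also have "\<dots> = ennreal (max (ln a) 0) + ennreal (ln b) * of_nat K"
      using \<open>b > 1\<close> by (simp add: ennreal_plus ennreal_mult ennreal_of_nat_eq_real_of_nat ln_ge_zero)
    also have "of_nat K = (\<Sum>n<K. indicator {\<omega>\<in>space M. norm (U \<omega>) > a * b ^ n} \<omega> :: ennreal)"
      using K(2) that by (simp add: P_def not_le)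
    also have "\<dots> \<le> (\<Sum>n. indicator {\<omega>\<in>space M. norm (U \<omega>) > a * b ^ n} \<omega>)"
      by (rule sum_le_suminf) auto
    finally show ?thesis
      by (simp add: add_left_mono mult_left_mono)
  qed simp
  have "(\<integral>\<^sup>+ \<omega>. ennreal (max (ln (norm (U \<omega>))) 0) \<partial>M)
    \<le> (\<integral>\<^sup>+ \<omega>. ennreal (max (ln a) 0) + ennreal (ln b) * (\<Sum>n. indicator {\<omega>\<in>space M. norm (U \<omega>) > a * b ^ n} \<omega>) \<partial>M)"
    by (rule nn_integral_mono) (rule pw)
  also have "\<dots> = ennreal (max (ln a) 0) + ennreal (ln b) * (\<Sum>n. emeasure M {\<omega>\<in>space M. norm (U \<omega>) > a * b ^ n})"
    by (simp add: nn_integral_add nn_integral_cmult nn_integral_suminf emeasure_space_1)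
  also have "(\<Sum>n. emeasure M {\<omega>\<in>space M. norm (U \<omega>) > a * b ^ n})
      = ennreal (\<Sum>n. prob {\<omega>\<in>space M. norm (U \<omega>) > a * b ^ n})"
    unfolding emeasure_eq_measure by (rule suminf_ennreal2) (auto intro: sum)
  also have "ennreal (max (ln a) 0) + ennreal (ln b) * \<dots> < \<infinity>"
    by (simp add: ennreal_mult_less_top)
  finally show "(\<integral>\<^sup>+ \<omega>. ennreal (max (ln (norm (U \<omega>))) 0) \<partial>M) < \<infinity>" .
qed auto

lemma geom_sum_AE_summable:
  assumes \<xi>: "iid \<xi> \<nu>" and L: "log_integrable (\<xi> 0)" and "b > 1"
  shows "AE \<omega> in M. summable (\<lambda>i::nat. (1 / b) ^ Suc i *\<^sub>R \<xi> i \<omega>)"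
proof -
  note [measurable] = iid_measurable[OF \<xi>]
  \<comment> \<open>Any \<open>r\<close> strictly between 1 and \<open>b\<close> would do:
    \<open>r > 1\<close> makes the tails at the levels \<open>r ^ n\<close> summable,
    \<open>r < b\<close> gives the convergent majorant \<open>(r / b) ^ n\<close>.\<close>
  define r where "r = (1 + b) / 2"
  have r: "r > 1" "r < b" using \<open>b > 1\<close> by (simp_all add: r_def)
  have "summable (\<lambda>n. prob {\<omega>\<in>space M. norm (\<xi> 0 \<omega>) > r ^ n})"
    by (rule summable_tail_of_log_integrable[OF _ L r(1)]) simp
  then have "summable (\<lambda>n. prob {\<omega>\<in>space M. norm (\<xi> n \<omega>) > r ^ n})"
    by (subst iid_prob_eq[OF \<xi>, of _ _ 0])
  then have "AE \<omega> in M. eventually (\<lambda>n. \<omega> \<in> space M - {\<omega>\<in>space M. norm (\<xi> n \<omega>) > r ^ n}) sequentially"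
    by (intro borel_cantelli_AE1) (auto simp: emeasure_eq_measure)
  then show ?thesis
  proof eventually_elim
    case (elim \<omega>)
    show ?case
    proof (rule summable_comparison_test_ev)
      show "summable (\<lambda>n. (1 / b) * (r / b) ^ n)"
        using r by (intro summable_mult summable_geometric) auto
      show "eventually (\<lambda>n. norm ((1 / b) ^ Suc n *\<^sub>R \<xi> n \<omega>) \<le> (1 / b) * (r / b) ^ n) sequentially"
        using elim
      proof eventually_elim
        case (elim n)
        then have "norm (\<xi> n \<omega>) \<le> r ^ n" by auto
        then have "(1 / b) ^ Suc n * norm (\<xi> n \<omega>) \<le> (1 / b) ^ Suc n * r ^ n"
          using \<open>b > 1\<close> by (intro mult_left_mono) auto
        then show ?case
          using \<open>b > 1\<close> by (simp add: power_divide field_simps)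
      qed
    qed
  qed
qed

text \<open>Decompose by the first \<open>k\<close> at which the partial sum exceeds
  \<open>2 * a\<close>. This event \<open>F k\<close> is independent of the remaining sum, which is
  at most \<open>a\<close> with probability at least 3/4; when both occur, the full sum exceeds
  \<open>a\<close>. Hence 3/4 of the probability sought is at most 1/4.\<close>

lemma ottaviani_inequality:
  fixes \<eta> :: "nat \<Rightarrow> 'a \<Rightarrow> real ^ 'd"
  assumes ind: "indep_vars (\<lambda>_. borel) \<eta> UNIV"
    and tight: "\<And>k. k \<le> n \<Longrightarrow> prob {\<omega>\<in>space M. norm (\<Sum>i\<in>{k..<n}. \<eta> i \<omega>) > a} \<le> 1/4"
  shows "prob {\<omega>\<in>space M. \<exists>k\<le>n. norm (\<Sum>i<k. \<eta> i \<omega>) > 2 * a} \<le> 1/3"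
proof -
  have [measurable]: "\<eta> i \<in> borel_measurable M" for i
    using ind by (simp add: indep_vars_def)
  define S where "S k \<omega> = (\<Sum>i<k. \<eta> i \<omega>)" for k \<omega>
  define R where "R k \<omega> = (\<Sum>i\<in>{k..<n}. \<eta> i \<omega>)" for k \<omega>
  have [measurable]: "S k \<in> borel_measurable M" "R k \<in> borel_measurable M" for k
    unfolding S_def[abs_def] R_def[abs_def] by measurable
  define F where "F k = {\<omega>\<in>space M. (\<forall>j<k. norm (S j \<omega>) \<le> 2 * a) \<and> norm (S k \<omega>) > 2 * a}" for k
  define G where "G k = {\<omega>\<in>space M. norm (R k \<omega>) \<le> a}" for k
  have [measurable]: "F k \<in> events" "G k \<in> events" for k
    unfolding F_def G_def by measurable
  have disj: "disjoint_family_on F {..n}"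
    unfolding disjoint_family_on_def F_def
    by (auto, metis linorder_neqE_nat not_le)
  have un: "{\<omega>\<in>space M. \<exists>k\<le>n. norm (\<Sum>i<k. \<eta> i \<omega>) > 2 * a} = (\<Union>k\<le>n. F k)"
  proof safe
    fix \<omega> k assume *: "\<omega> \<in> space M" "k \<le> n" "2 * a < norm (\<Sum>i<k. \<eta> i \<omega>)"
    define m where "m = (LEAST k. 2 * a < norm (S k \<omega>))"
    have "2 * a < norm (S m \<omega>)" "m \<le> k" "\<And>j. j < m \<Longrightarrow> \<not> 2 * a < norm (S j \<omega>)"
      unfolding m_def using * by (auto simp: S_def intro: LeastI Least_le dest: not_less_Least)
    then show "\<omega> \<in> (\<Union>k\<le>n. F k)"
      using * by (auto simp: F_def not_less intro!: bexI[of _ m])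
  qed (auto simp: F_def S_def)
  have FG: "prob (F k) * (3/4) \<le> prob (F k \<inter> G k)" if "k \<le> n" for k
  proof -
    have "space M - G k = {\<omega>\<in>space M. norm (R k \<omega>) > a}"
      by (auto simp: G_def)
    then have "prob (space M - G k) \<le> 1/4"
      using tight[OF that] by (simp add: R_def)
    then have G: "prob (G k) \<ge> 3/4"
      by (simp add: prob_compl)
    \<comment> \<open>Padding by zero makes every coordinate measurable on the product over
      \<open>{..<k}\<close>, so that the event about all earlier partial sums is visibly measurable
      there.\<close>
    define ext where "ext x i = (if i < k then x i else 0 :: real ^ 'd)" for x i
    have [measurable]: "(\<lambda>x. ext x i) \<in> borel_measurable (Pi\<^sub>M {..<k} (\<lambda>_. borel))" for i
      by (cases "i < k") (auto simp: ext_def)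
    have ext: "ext (restrict (\<lambda>i. \<eta> i \<omega>) {..<k}) i = \<eta> i \<omega>" if "i < k" for i \<omega>
      using that by (simp add: ext_def)
    define XA where "XA = {x\<in>space (PiM {..<k} (\<lambda>_. borel)).
      (\<forall>j<k. norm (\<Sum>i<j. ext x i) \<le> 2 * a) \<and> norm (\<Sum>i<k. ext x i) > 2 * a}"
    define XB where "XB = {x\<in>space (PiM {k..<n} (\<lambda>_. borel)). norm (\<Sum>i\<in>{k..<n}. x i :: real ^ 'd) \<le> a}"
    have [measurable]: "(\<lambda>x. \<Sum>i\<in>{k..<n}. x i :: real ^ 'd) \<in> borel_measurable (PiM {k..<n} (\<lambda>_. borel))"
      by (intro borel_measurable_sum measurable_component_singleton)
    have iv: "indep_var (PiM {..<k} (\<lambda>_. borel)) (\<lambda>\<omega>. restrict (\<lambda>i. \<eta> i \<omega>) {..<k})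
      (PiM {k..<n} (\<lambda>_. borel)) (\<lambda>\<omega>. restrict (\<lambda>i. \<eta> i \<omega>) {k..<n})"
      by (rule indep_var_restrict[OF ind]) auto
    have XA: "XA \<in> sets (PiM {..<k} (\<lambda>_. borel))" unfolding XA_def by measurable
    have XB: "XB \<in> sets (PiM {k..<n} (\<lambda>_. borel))" unfolding XB_def by measurable
    have eq1: "(\<lambda>\<omega>. (restrict (\<lambda>i. \<eta> i \<omega>) {..<k}, restrict (\<lambda>i. \<eta> i \<omega>) {k..<n})) -` (XA \<times> XB) \<inter> space M
        = F k \<inter> G k"
      by (auto simp: XA_def XB_def F_def G_def S_def R_def ext space_PiM cong: sum.cong_simp)
    have eq2: "(\<lambda>\<omega>. restrict (\<lambda>i. \<eta> i \<omega>) {..<k}) -` XA \<inter> space M = F k"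
      by (auto simp: XA_def F_def S_def ext space_PiM cong: sum.cong_simp)
    have eq3: "(\<lambda>\<omega>. restrict (\<lambda>i. \<eta> i \<omega>) {k..<n}) -` XB \<inter> space M = G k"
      by (auto simp: XB_def G_def R_def space_PiM)
    have "prob (F k \<inter> G k) = prob (F k) * prob (G k)"
      using indep_varD[OF iv XA XB] unfolding eq1 eq2 eq3 .
    then show ?thesis
      using mult_left_mono[OF G, of "prob (F k)"] by simp
  qed
  have "(3/4) * prob (\<Union>k\<le>n. F k) = (\<Sum>k\<le>n. prob (F k) * (3/4))"
    by (subst finite_measure_finite_Union) (use disj in \<open>auto simp: sum_distrib_left mult.commute\<close>)
  also have "\<dots> \<le> (\<Sum>k\<le>n. prob (F k \<inter> G k))"
    by (intro sum_mono FG) auto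
  also have "\<dots> = prob (\<Union>k\<le>n. F k \<inter> G k)"
    using disj by (subst finite_measure_finite_Union) (auto simp: disjoint_family_on_def)
  also have "\<dots> \<le> prob {\<omega>\<in>space M. norm (\<Sum>i\<in>{0..<n}. \<eta> i \<omega>) > a}"
  proof (rule finite_measure_mono)
    show "(\<Union>k\<le>n. F k \<inter> G k) \<subseteq> {\<omega>\<in>space M. norm (\<Sum>i\<in>{0..<n}. \<eta> i \<omega>) > a}"
    proof safe
      fix \<omega> k assume k: "k \<le> n" "\<omega> \<in> F k" "\<omega> \<in> G k"
      have "(\<Sum>i\<in>{0..<n}. \<eta> i \<omega>) = S k \<omega> + R k \<omega>"
        using sum.atLeastLessThan_concat[of 0 k n "\<lambda>i. \<eta> i \<omega>"] k(1)
        by (simp add: S_def R_def atLeast0LessThan)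
      then show "norm (\<Sum>i\<in>{0..<n}. \<eta> i \<omega>) > a"
        using k(2,3) norm_diff_ineq[of "S k \<omega>" "R k \<omega>"] by (auto simp: F_def G_def)
    qed (auto simp: F_def)
  qed measurable
  also have "\<dots> \<le> 1/4" by (rule tight) simp
  finally show ?thesis unfolding un by simp
qed

text \<open>A summand above \<open>4 * a\<close> forces one of the two adjacent partial sums above
  \<open>2 * a\<close>, so by Ottaviani no summand is that large with probability at least 2/3.
  Independence turns this probability into the product of the \<open>1 - p j\<close>, and
  \<open>1 - p \<le> exp (- p)\<close> bounds the sum of the \<open>p j\<close> by
  \<open>ln (3/2)\<close>, uniformly in \<open>n\<close>.\<close>

lemma summable_tail_of_tight_sums:
  fixes \<eta> :: "nat \<Rightarrow> 'a \<Rightarrow> real ^ 'd"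
  assumes ind: "indep_vars (\<lambda>_. borel) \<eta> UNIV"
    and tight: "\<And>k n. k \<le> n \<Longrightarrow> prob {\<omega>\<in>space M. norm (\<Sum>i\<in>{k..<n}. \<eta> i \<omega>) > a} \<le> 1/4"
  shows "summable (\<lambda>j. prob {\<omega>\<in>space M. norm (\<eta> j \<omega>) > 4 * a})"
proof (rule summableI_nonneg_bounded)
  have [measurable]: "\<eta> i \<in> borel_measurable M" for i
    using ind by (simp add: indep_vars_def)
  fix n
  define p where "p j = prob {\<omega>\<in>space M. norm (\<eta> j \<omega>) > 4 * a}" for j
  have "(\<Sum>j<n. p j) \<le> ln (3/2)"
  proof (cases "n = 0")
    \<comment> \<open>The product formula for independent events is stated for nonempty index sets,
      hence the case distinction.\<close>
    case False
    have "prob {\<omega>\<in>space M. \<exists>j<n. norm (\<eta> j \<omega>) > 4 * a}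
        \<le> prob {\<omega>\<in>space M. \<exists>k\<le>n. norm (\<Sum>i<k. \<eta> i \<omega>) > 2 * a}"
    proof (rule finite_measure_mono)
      show "{\<omega>\<in>space M. \<exists>j<n. norm (\<eta> j \<omega>) > 4 * a}
          \<subseteq> {\<omega>\<in>space M. \<exists>k\<le>n. norm (\<Sum>i<k. \<eta> i \<omega>) > 2 * a}"
      proof safe
        fix \<omega> j assume j: "j < n" "4 * a < norm (\<eta> j \<omega>)"
        have "norm (\<eta> j \<omega>) = norm ((\<Sum>i<Suc j. \<eta> i \<omega>) - (\<Sum>i<j. \<eta> i \<omega>))" by simp
        also have "\<dots> \<le> norm (\<Sum>i<Suc j. \<eta> i \<omega>) + norm (\<Sum>i<j. \<eta> i \<omega>)"
          by (rule norm_triangle_ineq4)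
        finally have "2 * a < norm (\<Sum>i<Suc j. \<eta> i \<omega>) \<or> 2 * a < norm (\<Sum>i<j. \<eta> i \<omega>)"
          using j(2) by linarith
        then show "\<exists>k\<le>n. norm (\<Sum>i<k. \<eta> i \<omega>) > 2 * a"
          using j(1) Suc_leI less_imp_le by blast
      qed
    qed measurable
    also have "\<dots> \<le> 1/3"
      by (rule ottaviani_inequality[OF ind tight])
    finally have "2/3 \<le> 1 - prob {\<omega>\<in>space M. \<exists>j<n. norm (\<eta> j \<omega>) > 4 * a}" by simp
    also have "\<dots> = prob (\<Inter>j\<in>{..<n}. \<eta> j -` {x. norm x \<le> 4 * a} \<inter> space M)"
      using False
      by (subst prob_compl[symmetric]) (force simp: not_less intro!: arg_cong[where f=prob])+
    also have "\<dots> = (\<Prod>j<n. prob (\<eta> j -` {x. norm x \<le> 4 * a} \<inter> space M))"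
      using False by (intro indep_varsD_finite[where M'="\<lambda>_. borel"] indep_vars_subset[OF ind]) auto
    also have "\<dots> = (\<Prod>j<n. 1 - p j)"
      unfolding p_def
      by (intro prod.cong refl, subst prob_compl[symmetric])
        (auto simp: not_less intro!: arg_cong[where f=prob])
    also have "\<dots> \<le> (\<Prod>j<n. exp (- p j))"
    proof (rule prod_mono)
      fix j show "0 \<le> 1 - p j \<and> 1 - p j \<le> exp (- p j)"
        using exp_ge_add_one_self[of "- p j"] by (simp add: p_def)
    qed
    also have "\<dots> = exp (- (\<Sum>j<n. p j))"
      by (simp add: exp_sum sum_negf[symmetric])
    finally have "ln (2/3) \<le> - (\<Sum>j<n. p j)"
      by (subst (asm) ln_le_cancel_iff[symmetric]) simp_all
    moreover have "ln (2/3 :: real) = - ln (3/2)" by (simp add: ln_div)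
    ultimately show ?thesis by simp
  qed simp
  then show "(\<Sum>j<n. prob {\<omega>\<in>space M. norm (\<eta> j \<omega>) > 4 * a}) \<le> ln (3/2)"
    by (simp add: p_def)
qed simp

end

section \<open>Logarithmic moments of sums of two variables\<close>

context prob_space
begin

text \<open>Tightness of a single variable, from \<open>V / (n + 1)\<close> tending to 0. The bound
  \<open>a \<ge> 1\<close> is convenient for comparing \<open>2 ^ n\<close> with
  \<open>a * 2 ^ n\<close> later.\<close>

lemma exists_tail_le_half:
  fixes V :: "'a \<Rightarrow> 'b::{second_countable_topology, real_normed_vector}"
  assumes [measurable]: "V \<in> borel_measurable M"
  shows "\<exists>a\<ge>1. prob {\<omega>\<in>space M. norm (V \<omega>) > a} \<le> 1/2"
proof -
  have "(\<lambda>n. prob {\<omega>\<in>space M. norm ((1 / real (Suc n)) *\<^sub>R V \<omega>) > 1}) \<longlonglongrightarrow> 0"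
  proof (rule AE_tendsto_imp_prob_tendsto_0)
    show "AE \<omega> in M. (\<lambda>n. (1 / real (Suc n)) *\<^sub>R V \<omega>) \<longlonglongrightarrow> 0"
    proof (rule AE_I2)
      fix \<omega>
      show "(\<lambda>n. (1 / real (Suc n)) *\<^sub>R V \<omega>) \<longlonglongrightarrow> 0"
        using tendsto_scaleR[OF LIMSEQ_inverse_real_of_nat tendsto_const[of "V \<omega>"]]
        by (simp add: inverse_eq_divide)
    qed
  qed auto
  then have "eventually (\<lambda>n. prob {\<omega>\<in>space M. norm ((1 / real (Suc n)) *\<^sub>R V \<omega>) > 1} < 1/2) sequentially"
    by (rule order_tendstoD) simp
  then obtain n where "prob {\<omega>\<in>space M. norm ((1 / real (Suc n)) *\<^sub>R V \<omega>) > 1} < 1/2"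
    by (auto simp: eventually_sequentially)
  moreover have "{\<omega>\<in>space M. norm ((1 / real (Suc n)) *\<^sub>R V \<omega>) > 1} = {\<omega>\<in>space M. norm (V \<omega>) > real (Suc n)}"
    by (auto simp: field_simps simp del: of_nat_Suc)
  ultimately show ?thesis
    by (intro exI[of _ "real (Suc n)"]) auto
qed

lemma log_integrable_distr:
  assumes "U \<in> borel_measurable M"
  shows "log_integrable U \<longleftrightarrow> integrable (distr M borel U) (\<lambda>x. max (ln (norm x)) 0)"
  unfolding log_integrable_def using assms by (subst integrable_distr_eq) auto

lemma log_integrable_iff_nn_integral:
  assumes [measurable]: "U \<in> borel_measurable M"
  shows "log_integrable U \<longleftrightarrow> (\<integral>\<^sup>+ x. ennreal (max (ln (norm x)) 0) \<partial>distr M borel U) < \<infinity>"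
  unfolding log_integrable_def by (simp add: integrable_iff_bounded nn_integral_distr)

lemma log_integrable_cong:
  assumes "U \<in> borel_measurable M" "V \<in> borel_measurable M" "distr M borel U = distr M borel V"
  shows "log_integrable U \<longleftrightarrow> log_integrable V"
  using assms by (simp add: log_integrable_distr)

text \<open>The norm of a sum is at most twice the larger norm, which costs the constant
  \<open>ln 2\<close> after taking logarithms.\<close>

lemma log_integrable_add:
  assumes [measurable]: "U \<in> borel_measurable M" "V \<in> borel_measurable M"
    and "log_integrable U" "log_integrable V"
  shows "log_integrable (\<lambda>\<omega>. U \<omega> + V \<omega>)"
  unfolding log_integrable_def
proof (rule Bochner_Integration.integrable_bound)
  show "integrable M (\<lambda>\<omega>. ln 2 + (max (ln (norm (U \<omega>))) 0 + max (ln (norm (V \<omega>))) 0))"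
    using assms(3,4) unfolding log_integrable_def by simp
  have *: "max (ln (norm (u + v))) 0 \<le> ln 2 + (max (ln (norm u)) 0 + max (ln (norm v)) 0)"
    for u v :: "real ^ 'd"
  proof (cases "u + v = 0")
    case False
    define m where "m = max (norm u) (norm v)"
    have "norm (u + v) \<le> 2 * m"
      using norm_triangle_ineq[of u v] by (simp add: m_def)
    moreover have "m > 0" using False by (auto simp: m_def less_max_iff_disj)
    ultimately have "ln (norm (u + v)) \<le> ln 2 + ln m"
      using False by (subst ln_mult_pos[symmetric]) simp_all
    moreover have "ln m \<le> max (ln (norm u)) 0 + max (ln (norm v)) 0"
      by (auto simp: m_def max_def)
    moreover have "0 \<le> ln (2::real) + (max (ln (norm u)) 0 + max (ln (norm v)) 0)"
      by (intro add_nonneg_nonneg) auto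
    ultimately show ?thesis by simp
  qed simp
  show "AE \<omega> in M. norm (max (ln (norm (U \<omega> + V \<omega>))) 0)
      \<le> norm (ln 2 + (max (ln (norm (U \<omega>))) 0 + max (ln (norm (V \<omega>))) 0))"
  proof (rule AE_I2)
    fix \<omega>
    show "norm (max (ln (norm (U \<omega> + V \<omega>))) 0)
        \<le> norm (ln 2 + (max (ln (norm (U \<omega>))) 0 + max (ln (norm (V \<omega>))) 0))"
      unfolding real_norm_def by (rule order_trans[OF _ abs_ge_self], subst abs_of_nonneg[OF max.cobounded2], rule *)
  qed
qed measurable

text \<open>With probability at least 1/2, \<open>V\<close> has norm at most \<open>a\<close>. If
  also \<open>norm U > 2 * a * 2 ^ n\<close>, then
  \<open>norm (U + V) > 2 * a * 2 ^ n - a \<ge> 2 ^ n\<close>. By independence, the tails of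
  \<open>U\<close> are at most twice those of \<open>U + V\<close> at the levels
  \<open>2 ^ n\<close>.\<close>

lemma log_integrable_indep_summand:
  assumes ind: "indep_var borel U borel V"
    and L: "log_integrable (\<lambda>\<omega>. U \<omega> + V \<omega>)"
  shows "log_integrable U"
proof -
  have [measurable]: "U \<in> borel_measurable M" "V \<in> borel_measurable M"
    using ind by (auto dest: indep_var_rv1 indep_var_rv2)
  obtain a where a: "a \<ge> 1" "prob {\<omega>\<in>space M. norm (V \<omega>) > a} \<le> 1/2"
    using exists_tail_le_half[of V] by auto
  have "prob (V -` {x. norm x \<le> a} \<inter> space M) = 1 - prob {\<omega>\<in>space M. norm (V \<omega>) > a}"
    by (subst prob_compl[symmetric]) (auto simp: not_less intro!: arg_cong[where f=prob])
  then have half: "prob (V -` {x. norm x \<le> a} \<inter> space M) \<ge> 1/2"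
    using a by simp
  show ?thesis
  proof (rule log_integrable_of_summable_tail)
    show "summable (\<lambda>n. prob {\<omega>\<in>space M. norm (U \<omega>) > 2 * a * 2 ^ n})"
    proof (rule summable_comparison_test)
      show "summable (\<lambda>n. 2 * prob {\<omega>\<in>space M. norm (U \<omega> + V \<omega>) > 2 ^ n})"
        by (intro summable_mult summable_tail_of_log_integrable L) auto
      have "prob {\<omega>\<in>space M. norm (U \<omega>) > 2 * a * 2 ^ n}
          \<le> 2 * prob {\<omega>\<in>space M. norm (U \<omega> + V \<omega>) > 2 ^ n}" for n
      proof -
        have "prob {\<omega>\<in>space M. norm (U \<omega>) > 2 * a * 2 ^ n} * (1/2)
            \<le> prob (U -` {x. norm x > 2 * a * 2 ^ n} \<inter> space M) * prob (V -` {x. norm x \<le> a} \<inter> space M)"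
          using half by (intro mult_mono) (auto simp: vimage_def Int_def conj_commute)
        also have "\<dots> = prob ((\<lambda>\<omega>. (U \<omega>, V \<omega>)) -` ({x. norm x > 2 * a * 2 ^ n} \<times> {x. norm x \<le> a}) \<inter> space M)"
          by (rule indep_varD[OF ind, symmetric]) auto
        also have "\<dots> \<le> prob {\<omega>\<in>space M. norm (U \<omega> + V \<omega>) > 2 ^ n}"
        proof (rule finite_measure_mono)
          show "(\<lambda>\<omega>. (U \<omega>, V \<omega>)) -` ({x. norm x > 2 * a * 2 ^ n} \<times> {x. norm x \<le> a}) \<inter> space M
              \<subseteq> {\<omega>\<in>space M. norm (U \<omega> + V \<omega>) > 2 ^ n}"
          proof safe
            fix \<omega> assume *: "2 * a * 2 ^ n < norm (U \<omega>)" "norm (V \<omega>) \<le> a"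
            have "a \<le> a * 2 ^ n" "2 ^ n \<le> a * 2 ^ n" using a(1) by simp_all
            then show "2 ^ n < norm (U \<omega> + V \<omega>)"
              using * norm_diff_ineq[of "U \<omega>" "V \<omega>"] by linarith
          qed
        qed measurable
        finally show ?thesis by simp
      qed
      then show "\<exists>N. \<forall>n\<ge>N. norm (prob {\<omega>\<in>space M. norm (U \<omega>) > 2 * a * 2 ^ n})
          \<le> 2 * prob {\<omega>\<in>space M. norm (U \<omega> + V \<omega>) > 2 ^ n}"
        by simp
    qed
  qed (use a in auto)
qed

end

subsection \<open>Independently scattered random measures\<close>

lemma bounded_borel_intervals [simp]:
  "{} \<in> bounded_borel" "{a} \<in> bounded_borel" "{a<..b} \<in> bounded_borel" "{a..b} \<in> bounded_borel"
  by (auto simp: bounded_borel_def)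

locale isrm_process = prob_space M for M :: "'w measure" +
  fixes \<Lambda> :: "real set \<Rightarrow> 'w \<Rightarrow> real ^ 'd" and X :: "real \<Rightarrow> 'w \<Rightarrow> real ^ 'd"
  assumes process: "hisrm_process M \<Lambda> X"
begin

lemma isrm: "isrm M \<Lambda>"
  using process by (simp add: hisrm_process_def homogeneous_isrm_def)

lemma measurable_Lambda: "B \<in> bounded_borel \<Longrightarrow> \<Lambda> B \<in> borel_measurable M"
  using isrm by (simp add: isrm_def)

lemma measurable_Lambda_Ioc [measurable]: "\<Lambda> {a<..b} \<in> borel_measurable M"
  by (rule measurable_Lambda) simp

lemma cadlag_X: "cadlag_process M X"
  using process by (simp add: hisrm_process_def)

lemma measurable_X [measurable]: "X t \<in> borel_measurable M"
  using cadlag_X by (simp add: cadlag_process_def)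

lemma Lambda_singleton: "AE \<omega> in M. \<Lambda> {a} \<omega> = 0"
  using isrm by (simp add: isrm_def)

lemma Lambda_sums:
  "(\<And>n::nat. B n \<in> bounded_borel) \<Longrightarrow> disjoint_family B \<Longrightarrow> bounded (\<Union>n. B n) \<Longrightarrow>
     AE \<omega> in M. (\<lambda>n. \<Lambda> (B n) \<omega>) sums \<Lambda> (\<Union>n. B n) \<omega>"
  using isrm by (simp add: isrm_def)

text \<open>Countable additivity for the constant family of empty sets: a constant series converges
  only if its term is 0.\<close>

lemma Lambda_empty: "AE \<omega> in M. \<Lambda> {} \<omega> = 0"
proof -
  have "AE \<omega> in M. (\<lambda>n::nat. \<Lambda> {} \<omega>) sums \<Lambda> (\<Union>n::nat. {}) \<omega>"
    by (rule Lambda_sums) (auto simp: disjoint_family_on_def)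
  then show ?thesis
    by eventually_elim (auto dest!: sums_summable summable_LIMSEQ_zero simp: LIMSEQ_const_iff)
qed

lemma Lambda_Un:
  assumes "A \<in> bounded_borel" "B \<in> bounded_borel" "A \<inter> B = {}"
  shows "AE \<omega> in M. \<Lambda> (A \<union> B) \<omega> = \<Lambda> A \<omega> + \<Lambda> B \<omega>"
proof -
  define C where "C n = (if n = 0 then A else if n = Suc 0 then B else {})" for n
  have U: "(\<Union>n. C n) = A \<union> B"
    by (auto simp: C_def split: if_splits)
  have "AE \<omega> in M. (\<lambda>n. \<Lambda> (C n) \<omega>) sums \<Lambda> (\<Union>n. C n) \<omega>"
    using assms unfolding U
    by (intro Lambda_sums[of C, unfolded U])
      (auto simp: C_def disjoint_family_on_def bounded_borel_def)
  then show ?thesis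
    using Lambda_empty
  proof eventually_elim
    case (elim \<omega>)
    have "(\<lambda>n. \<Lambda> (C n) \<omega>) sums (\<Sum>n\<in>{0, Suc 0}. \<Lambda> (C n) \<omega>)"
      by (rule sums_finite) (auto simp: C_def elim(2))
    then have "(\<lambda>n. \<Lambda> (C n) \<omega>) sums (\<Lambda> A \<omega> + \<Lambda> B \<omega>)"
      by (simp add: C_def)
    then show ?case using elim(1) U sums_unique2 by metis
  qed
qed

lemma Lambda_Ioc_split:
  assumes "r \<le> s" "s \<le> t"
  shows "AE \<omega> in M. \<Lambda> {r<..t} \<omega> = \<Lambda> {r<..s} \<omega> + \<Lambda> {s<..t} \<omega>"
proof -
  have "{r<..t} = {r<..s} \<union> {s<..t}" using assms by auto
  then show ?thesis using Lambda_Un[of "{r<..s}" "{s<..t}"] by auto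
qed

text \<open>Both representations are extended to \<open>t = 0\<close>, where they agree because the
  value on the empty set vanishes; the case distinctions by sign then overlap.\<close>

lemma X_eq_Lambda:
  "0 \<le> t \<Longrightarrow> AE \<omega> in M. X t \<omega> = \<Lambda> {0<..t} \<omega>"
  "t \<le> 0 \<Longrightarrow> AE \<omega> in M. X t \<omega> = - \<Lambda> {t<..0} \<omega>"
proof -
  have X0: "AE \<omega> in M. X 0 \<omega> = 0" using process by (simp add: hisrm_process_def)
  have "AE \<omega> in M. X 0 \<omega> = \<Lambda> {0<..0} \<omega>" "AE \<omega> in M. X 0 \<omega> = - \<Lambda> {0<..0} \<omega>"
    using X0 Lambda_empty by (auto elim!: eventually_elim2)
  then show "0 \<le> t \<Longrightarrow> AE \<omega> in M. X t \<omega> = \<Lambda> {0<..t} \<omega>"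
      "t \<le> 0 \<Longrightarrow> AE \<omega> in M. X t \<omega> = - \<Lambda> {t<..0} \<omega>"
    using process by (auto simp: hisrm_process_def order_le_less)
qed

lemma Lambda_Ioc_eq:
  assumes "s \<le> t"
  shows "AE \<omega> in M. \<Lambda> {s<..t} \<omega> = X t \<omega> - X s \<omega>"
proof (cases rule: linorder_cases[of s 0])
  case less
  show ?thesis
  proof (cases "t \<le> 0")
    case True
    show ?thesis
      using X_eq_Lambda(2)[OF True] X_eq_Lambda(2)[of s] Lambda_Ioc_split[OF assms True] less
      by (auto elim!: eventually_elim2)
  next
    case False
    then have "0 \<le> t" by simp
    from X_eq_Lambda(1)[OF this] X_eq_Lambda(2)[OF less_imp_le[OF less]]
      Lambda_Ioc_split[OF less_imp_le[OF less] this]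
    show ?thesis by eventually_elim simp
  qed
next
  case equal
  then have "0 \<le> t" "0 \<le> s" using assms by auto
  from X_eq_Lambda(1)[OF this(1)] X_eq_Lambda(1)[OF this(2)] Lambda_Ioc_split[OF this(2) assms]
  show ?thesis by eventually_elim simp
next
  case greater
  then have "0 \<le> t" "0 \<le> s" using assms by auto
  from X_eq_Lambda(1)[OF this(1)] X_eq_Lambda(1)[OF this(2)] Lambda_Ioc_split[OF this(2) assms]
  show ?thesis by eventually_elim simp
qed

lemma Lambda_endpoints:
  assumes "D \<subseteq> {s, t}"
  shows "AE \<omega> in M. \<Lambda> D \<omega> = 0"
proof -
  have "D = {} \<or> D = {s} \<or> D = {t} \<or> (D = {s} \<union> {t} \<and> s \<noteq> t)" using assms by auto
  moreover have "AE \<omega> in M. \<Lambda> ({s} \<union> {t}) \<omega> = 0" if "s \<noteq> t"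
    using Lambda_Un[of "{s}" "{t}"] Lambda_singleton[of s] Lambda_singleton[of t] that
    by (auto elim!: eventually_elim2 eventually_rev_mp)
  ultimately show ?thesis
    using Lambda_empty Lambda_singleton by metis
qed

text \<open>The level sets of the floor function are closed on the left, whereas the process is
  built from intervals closed on the right. Since points carry no mass, the endpoints do not
  matter.\<close>

lemma Lambda_interval_eq:
  assumes "s \<le> t" and B: "B \<in> sets borel" "{s<..<t} \<subseteq> B" "B \<subseteq> {s..t}"
  shows "AE \<omega> in M. \<Lambda> B \<omega> = X t \<omega> - X s \<omega>"
proof -
  have bb: "B \<in> bounded_borel" "{s..t} - B \<in> bounded_borel"
    using B by (auto simp: bounded_borel_def intro: bounded_subset[of "{s..t}"])
  have "{s..t} - B \<subseteq> {s, t}"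
  proof
    fix u assume "u \<in> {s..t} - B"
    then show "u \<in> {s, t}" using B(2) by (cases "s < u \<and> u < t") auto
  qed
  note 1 = Lambda_endpoints[OF this]
  have 2: "AE \<omega> in M. \<Lambda> {s..t} \<omega> = \<Lambda> B \<omega> + \<Lambda> ({s..t} - B) \<omega>"
    using Lambda_Un[OF bb] B(3) by (simp add: Un_absorb1)
  have "{s} \<union> {s<..t} = {s..t}" using assms(1) by auto
  then have 3: "AE \<omega> in M. \<Lambda> {s..t} \<omega> = \<Lambda> {s} \<omega> + \<Lambda> {s<..t} \<omega>"
    using Lambda_Un[of "{s}" "{s<..t}"] by simp
  from 1 2 3 Lambda_singleton[of s] Lambda_Ioc_eq[OF assms(1)] show ?thesis
    by eventually_elim simp
qed

text \<open>The definition gives independence for families indexed by an initial segment of the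
  naturals. A finite index set is numbered to reach this case, and independence of an infinite
  family is a statement about its finite subfamilies.\<close>

lemma Lambda_indep_vars:
  assumes B: "\<And>i. B i \<in> bounded_borel" and disj: "disjoint_family B"
  shows "indep_vars (\<lambda>_. borel) (\<lambda>i. \<Lambda> (B i)) (UNIV :: 'i set)"
proof -
  have fin: "indep_vars (\<lambda>_. borel) (\<lambda>i. \<Lambda> (B i)) J" if J: "finite J" for J :: "'i set"
  proof -
    obtain f and n :: nat where f: "f ` J = {i. i < n}" "inj_on f J"
      using finite_imp_inj_to_nat_seg[OF J] by blast
    define g where "g = the_inv_into J f"
    have g: "g (f j) = j" if "j \<in> J" for j
      using that f(2) by (simp add: g_def the_inv_into_f_f)
    have inj: "inj_on g {..<n}"
      using f inj_on_the_inv_into[OF f(2)] by (simp add: g_def lessThan_def)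
    have "disjoint_family_on (\<lambda>i. B (g i)) {..<n}"
      using disj inj by (auto simp: disjoint_family_on_def inj_on_def)
    then have "indep_vars (\<lambda>_. borel) (\<lambda>i. \<Lambda> (B (g i))) {..<n}"
      using isrm B by (simp add: isrm_def)
    then have "indep_vars (\<lambda>_. borel) (\<lambda>i. \<Lambda> (B (g i))) (f ` J)"
      using f(1) by (simp add: lessThan_def)
    from indep_vars_inj_reindex[OF f(2) this] show ?thesis
      by (rule indep_vars_cong[THEN iffD1, rotated -1]) (auto simp: g)
  qed
  show ?thesis
    unfolding indep_vars_def2
  proof (intro conjI ballI)
    show "indep_sets (\<lambda>i. {\<Lambda> (B i) -` A \<inter> space M |A. A \<in> sets borel}) UNIV"
      using fin by (subst indep_sets_finite_index_sets) (auto simp: indep_vars_def2)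
  qed (use B measurable_Lambda in auto)
qed

lemma Lambda_Ioc_indep_var:
  assumes "t \<le> u"
  shows "indep_var borel (\<Lambda> {s<..t}) borel (\<Lambda> {u<..v})"
proof -
  have "indep_vars (\<lambda>_. borel) (\<lambda>i. \<Lambda> (case_bool {s<..t} {u<..v} i)) UNIV"
    using assms by (intro Lambda_indep_vars) (auto split: bool.split simp: disjoint_family_on_def)
  then show ?thesis
    unfolding indep_var_def
    by (rule indep_vars_cong[THEN iffD1, rotated -1]) (auto split: bool.split)
qed

lemma Lambda_Ioc_distr: "distr M borel (\<Lambda> {s<..t}) = distr M borel (\<Lambda> {0<..t - s})"
proof -
  have "(\<lambda>x. x + (- s)) ` {s<..t} = {0<..t - s}"
    by (auto simp: image_iff algebra_simps intro!: bexI[of _ "_ + s"])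
  moreover have "distr M borel (\<Lambda> {s<..t}) = distr M borel (\<Lambda> ((\<lambda>x. x + (- s)) ` {s<..t}))"
    using process unfolding hisrm_process_def homogeneous_isrm_def by (metis bounded_borel_intervals(3))
  ultimately show ?thesis by simp
qed

text \<open>The mesh is an argument because infinite divisibility compares the grid with finer
  ones.\<close>

definition grid :: "real \<Rightarrow> int \<Rightarrow> 'w \<Rightarrow> real ^ 'd" where
  "grid c k = \<Lambda> {of_int k / c<..(of_int k + 1) / c}"

lemma measurable_grid [measurable]: "grid c k \<in> borel_measurable M"
  unfolding grid_def by measurable

lemma grid_eq:
  assumes "c > 0"
  shows "AE \<omega> in M. \<forall>k. grid c k \<omega> = X ((of_int k + 1) / c) \<omega> - X (of_int k / c) \<omega>"
  unfolding AE_all_countable grid_def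
  using assms by (intro allI Lambda_Ioc_eq) (simp add: divide_right_mono)

lemma iid_grid:
  assumes "c > 0"
  shows "iid (grid c) (distr M borel (\<Lambda> {0<..1 / c}))"
  unfolding iid_def
proof (intro conjI allI)
  have "disjoint_family (\<lambda>k::int. {of_int k / c<..(of_int k + 1) / c})"
    unfolding disjoint_family_on_def
  proof (intro ballI impI)
    fix k l :: int assume "k \<noteq> l"
    then consider "k + 1 \<le> l" | "l + 1 \<le> k" by linarith
    then show "{of_int k / c<..(of_int k + 1) / c} \<inter> {of_int l / c<..(of_int l + 1) / c} = {}"
    proof cases
      case 1
      then have "(of_int k + 1) / c \<le> of_int l / c"
        using assms by (intro divide_right_mono) linarith+
      then show ?thesis by auto
    next
      case 2
      then have "(of_int l + 1) / c \<le> of_int k / c"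
        using assms by (intro divide_right_mono) linarith+
      then show ?thesis by auto
    qed
  qed
  then show "indep_vars (\<lambda>_. borel) (grid c) UNIV"
    unfolding grid_def[abs_def] by (intro Lambda_indep_vars) auto
  fix k
  show "distr M borel (grid c k) = distr M borel (\<Lambda> {0<..1 / c})"
    unfolding grid_def using Lambda_Ioc_distr[of "of_int k / c" "(of_int k + 1) / c"]
    by (simp add: add_divide_distrib)
qed

text \<open>First up, then down: adding independent copies reaches all multiples of
  \<open>s\<close>, and \<open>\<Lambda> {0<..t}\<close> is an independent summand of the value on
  any longer interval \<open>{0<..n * s}\<close>.\<close>

lemma log_integrable_Lambda:
  assumes "s > 0" "t > 0" and L: "log_integrable (\<Lambda> {0<..s})"
  shows "log_integrable (\<Lambda> {0<..t})"
proof -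
  have mult: "log_integrable (\<Lambda> {0<..real (Suc n) * s})" for n
  proof (induction n)
    case (Suc n)
    have "distr M borel (\<Lambda> {real (Suc n) * s<..real (Suc (Suc n)) * s}) = distr M borel (\<Lambda> {0<..s})"
      by (subst Lambda_Ioc_distr) (simp add: algebra_simps)
    then have "log_integrable (\<Lambda> {real (Suc n) * s<..real (Suc (Suc n)) * s})"
      using L by (subst log_integrable_cong[of _ "\<Lambda> {0<..s}"]) auto
    then have "log_integrable (\<lambda>\<omega>. \<Lambda> {0<..real (Suc n) * s} \<omega> + \<Lambda> {real (Suc n) * s<..real (Suc (Suc n)) * s} \<omega>)"
      by (intro log_integrable_add Suc.IH) auto
    moreover have "distr M borel (\<lambda>\<omega>. \<Lambda> {0<..real (Suc n) * s} \<omega> + \<Lambda> {real (Suc n) * s<..real (Suc (Suc n)) * s} \<omega>)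
       = distr M borel (\<Lambda> {0<..real (Suc (Suc n)) * s})"
      using \<open>s > 0\<close> Lambda_Ioc_split[of 0 "real (Suc n) * s" "real (Suc (Suc n)) * s"]
      by (intro distr_AE_cong) (auto elim!: eventually_mono)
    ultimately show ?case by (subst log_integrable_cong[symmetric]) auto
  qed (use L in simp)
  obtain n where "t / s \<le> real n" using real_arch_simple by blast
  then have n: "t \<le> real (Suc n) * s" using \<open>s > 0\<close> by (simp add: field_simps)
  have "distr M borel (\<Lambda> {0<..real (Suc n) * s})
      = distr M borel (\<lambda>\<omega>. \<Lambda> {0<..t} \<omega> + \<Lambda> {t<..real (Suc n) * s} \<omega>)"
    using Lambda_Ioc_split[OF less_imp_le[OF \<open>t > 0\<close>] n] by (intro distr_AE_cong) auto
  then have "log_integrable (\<lambda>\<omega>. \<Lambda> {0<..t} \<omega> + \<Lambda> {t<..real (Suc n) * s} \<omega>)"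
    using mult[of n] by (subst log_integrable_cong[symmetric]) auto
  then show ?thesis
    by (rule log_integrable_indep_summand[rotated]) (rule Lambda_Ioc_indep_var, simp)
qed

lemma sum_grid_eq:
  assumes "c > 0"
  shows "AE \<omega> in M. \<forall>k. (\<Sum>i<n. grid c (k + int i) \<omega>)
     = X (of_int (k + int n) / c) \<omega> - X (of_int k / c) \<omega>"
  using grid_eq[OF assms]
proof eventually_elim
  case (elim \<omega>)
  show ?case
  proof
    fix k show "(\<Sum>i<n. grid c (k + int i) \<omega>) = X (of_int (k + int n) / c) \<omega> - X (of_int k / c) \<omega>"
      by (induction n) (simp_all add: elim algebra_simps)
  qed
qed

text \<open>The interval is cut into \<open>n\<close> cells of equal length. The factor
  \<open>r\<close> is 1 for the law of \<open>X 1\<close> and \<open>1 / b\<close> for the factor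
  \<open>\<rho>\<close> in the semi-selfdecomposition.\<close>

lemma scaled_Lambda_inf_divisible:
  assumes "t > 0"
  shows "distr M borel (\<lambda>\<omega>. r *\<^sub>R \<Lambda> {0<..t} \<omega>) \<in> inf_divisible"
proof (rule distr_sum_in_inf_divisible)
  fix n :: nat assume n: "n \<ge> 1"
  define c where "c = real n / t"
  have c: "c > 0" using n assms by (simp add: c_def)
  have "iid (\<lambda>i::nat. grid c (int i)) (distr M borel (\<Lambda> {0<..1 / c}))"
    by (rule iid_reindex[OF iid_grid[OF c]]) simp
  from iid_compose[OF this, of "\<lambda>x. r *\<^sub>R x"]
  have i: "iid (\<lambda>i \<omega>. r *\<^sub>R grid c (int i) \<omega>) (distr (distr M borel (\<Lambda> {0<..1 / c})) borel (\<lambda>x. r *\<^sub>R x))"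
    by simp
  have "AE \<omega> in M. r *\<^sub>R \<Lambda> {0<..t} \<omega> = (\<Sum>i<n. r *\<^sub>R grid c (int i) \<omega>)"
    using sum_grid_eq[OF c, of n] Lambda_Ioc_eq[OF less_imp_le[OF assms]]
  proof eventually_elim
    case (elim \<omega>)
    have "(\<Sum>i<n. grid c (int i) \<omega>) = X t \<omega> - X 0 \<omega>"
      using elim(1)[rule_format, of 0] n by (simp add: c_def)
    then show ?case using elim(2) assms by (simp add: scaleR_sum_right[symmetric])
  qed
  then show "\<exists>Y \<nu>. indep_vars (\<lambda>_. borel) Y {..<n} \<and> (\<forall>i<n. distr M borel (Y i) = \<nu>) \<and>
     (AE \<omega> in M. r *\<^sub>R \<Lambda> {0<..t} \<omega> = (\<Sum>i<n. Y i \<omega>))"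
    using i unfolding iid_def by (blast intro: indep_vars_subset)
qed measurable

section \<open>Increments of the process and integrals of step functions\<close>

lemma X_increment_distr:
  assumes "u \<le> v"
  shows "distr M borel (\<lambda>\<omega>. X v \<omega> - X u \<omega>) = distr M borel (X (v - u))"
proof -
  have "distr M borel (\<lambda>\<omega>. X v \<omega> - X u \<omega>) = distr M borel (\<Lambda> {u<..v})"
    using Lambda_Ioc_eq[OF assms] by (intro distr_AE_cong) (auto elim!: eventually_mono)
  also have "\<dots> = distr M borel (\<Lambda> {0<..v - u})" by (rule Lambda_Ioc_distr)
  also have "\<dots> = distr M borel (X (v - u))"
    using X_eq_Lambda(1)[of "v - u"] assms by (intro distr_AE_cong) (auto elim!: eventually_mono)
  finally show ?thesis .
qed

text \<open>The points \<open>u n\<close> may run off to infinity, so the increments need not be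
  bounded along a path. In law, however, each is \<open>X (v n - u n)\<close> with argument in
  \<open>{0..L}\<close>, where every path is bounded; the factors \<open>a n\<close> then give
  pointwise convergence.\<close>

lemma scaled_increment_tendsto_in_prob_0:
  assumes a: "a \<longlonglongrightarrow> 0" and uv: "\<And>n. u n \<le> v n" "\<And>n. v n \<le> u n + L"
  shows "tendsto_in_prob M (\<lambda>n \<omega>. a n *\<^sub>R (X (v n) \<omega> - X (u n) \<omega>)) (\<lambda>_. 0) sequentially"
  unfolding tendsto_in_prob_def diff_zero
proof (intro allI impI)
  fix \<epsilon> :: real assume "\<epsilon> > 0"
  have "(\<lambda>n. prob {\<omega>\<in>space M. norm (a n *\<^sub>R X (v n - u n) \<omega>) > \<epsilon>}) \<longlonglongrightarrow> 0"
  proof (rule AE_tendsto_imp_prob_tendsto_0[OF _ AE_I2 \<open>\<epsilon> > 0\<close>])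
    fix \<omega> assume "\<omega> \<in> space M"
    then have "bounded ((\<lambda>t. X t \<omega>) ` {0..L})"
      using cadlag_X by (intro cadlag_bounded) (auto simp: cadlag_process_def)
    then obtain K where "\<And>t. t \<in> {0..L} \<Longrightarrow> norm (X t \<omega>) \<le> K"
      unfolding bounded_iff by blast
    then have K: "norm (X (v n - u n) \<omega>) \<le> K" for n
      using uv[of n] by simp
    have "(\<lambda>n. \<bar>a n\<bar> * K) \<longlonglongrightarrow> 0"
      by (intro tendsto_mult_left_zero tendsto_rabs_zero a)
    then show "(\<lambda>n. a n *\<^sub>R X (v n - u n) \<omega>) \<longlonglongrightarrow> 0"
      by (rule Lim_null_comparison[rotated]) (simp add: K mult_left_mono)
  qed measurable
  moreover have "prob {\<omega>\<in>space M. norm (a n *\<^sub>R (X (v n) \<omega> - X (u n) \<omega>)) > \<epsilon>}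
      = prob {\<omega>\<in>space M. norm (a n *\<^sub>R X (v n - u n) \<omega>) > \<epsilon>}" for n
  proof -
    have "distr (distr M borel (\<lambda>\<omega>. X (v n) \<omega> - X (u n) \<omega>)) borel (\<lambda>x. a n *\<^sub>R x)
        = distr (distr M borel (X (v n - u n))) borel (\<lambda>x. a n *\<^sub>R x)"
      by (simp add: X_increment_distr[OF uv(1)])
    then have "distr M borel (\<lambda>\<omega>. a n *\<^sub>R (X (v n) \<omega> - X (u n) \<omega>))
        = distr M borel (\<lambda>\<omega>. a n *\<^sub>R X (v n - u n) \<omega>)"
      by (simp add: distr_distr comp_def)
    then show ?thesis by (simp add: prob_norm_distr del: norm_scaleR)
  qed
  ultimately show "(\<lambda>n. prob {\<omega>\<in>space M. norm (a n *\<^sub>R (X (v n) \<omega> - X (u n) \<omega>)) > \<epsilon>}) \<longlonglongrightarrow> 0"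
    by simp
qed

text \<open>Injectivity of \<open>g\<close> makes the level sets of the integrand exactly the cells
  of the floor function. The first and last terms are the cells cut off by \<open>s\<close> and
  \<open>t\<close>; they are distinct because the two floors differ.\<close>

lemma step_integral_floor:
  assumes c: "c > 0" and g: "inj g" and mn: "\<lfloor>c * s\<rfloor> < \<lfloor>c * t\<rfloor>"
  shows "AE \<omega> in M. step_integral \<Lambda> (\<lambda>u. g \<lfloor>c * u\<rfloor>) s t \<omega> =
     g \<lfloor>c * s\<rfloor> *\<^sub>R (X ((of_int \<lfloor>c * s\<rfloor> + 1) / c) \<omega> - X s \<omega>)
     + (\<Sum>k\<in>{\<lfloor>c * s\<rfloor><..<\<lfloor>c * t\<rfloor>}. g k *\<^sub>R grid c k \<omega>)
     + g \<lfloor>c * t\<rfloor> *\<^sub>R (X t \<omega> - X (of_int \<lfloor>c * t\<rfloor> / c) \<omega>)"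
proof -
  define m n where "m = \<lfloor>c * s\<rfloor>" and "n = \<lfloor>c * t\<rfloor>"
  have "m < n" using mn by (simp add: m_def n_def)
  \<comment> \<open>Effective endpoints: only cell \<open>m\<close> is truncated on the left and
    only cell \<open>n\<close> on the right.\<close>
  define lo where "lo k = (if k = m then s else of_int k / c)" for k
  define hi where "hi k = (if k = n then t else (of_int k + 1) / c)" for k
  define P where "P k = {u\<in>{s<..t}. \<lfloor>c * u\<rfloor> = k}" for k
  have fl: "\<lfloor>c * u\<rfloor> = k \<longleftrightarrow> of_int k / c \<le> u \<and> u < (of_int k + 1) / c" for u k
    using c by (simp add: floor_eq_iff field_simps)
  have s: "of_int m / c \<le> s" "s < (of_int m + 1) / c" using fl[of s m] by (simp_all add: m_def)
  have t: "of_int n / c \<le> t" "t < (of_int n + 1) / c" using fl[of t n] by (simp_all add: n_def)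
  have mono: "(of_int k + 1) / c \<le> of_int l / c" if "k < l" for k l :: int
  proof -
    have "of_int k + 1 \<le> (of_int l :: real)" using that by linarith
    then show ?thesis using c by (simp add: divide_right_mono)
  qed
  have step: "of_int k / c < (of_int k + 1) / c" for k :: int
    using c by (simp add: divide_strict_right_mono)
  have lohi: "lo k \<le> hi k" "{lo k<..<hi k} \<subseteq> P k" "P k \<subseteq> {lo k..hi k}" if k: "k \<in> {m..n}" for k
  proof -
    have 1: "(of_int m + 1) / c \<le> of_int k / c" if "k \<noteq> m" using mono[of m k] k that by auto
    have 2: "(of_int k + 1) / c \<le> of_int n / c" if "k \<noteq> n" using mono[of k n] k that by auto
    have 3: "(of_int m + 1) / c \<le> of_int n / c" using mono[of m n] \<open>m < n\<close> by auto
    show "lo k \<le> hi k" "{lo k<..<hi k} \<subseteq> P k" "P k \<subseteq> {lo k..hi k}"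
      using 1 2 3 s t step[of k] \<open>m < n\<close> by (auto simp: lo_def hi_def P_def fl)
  qed
  have img: "(\<lambda>u. g \<lfloor>c * u\<rfloor>) ` {s<..t} = g ` {m..n}"
  proof -
    have "(\<lambda>u. \<lfloor>c * u\<rfloor>) ` {s<..t} = {m..n}"
    proof (intro equalityI subsetI)
      fix k assume "k \<in> (\<lambda>u. \<lfloor>c * u\<rfloor>) ` {s<..t}"
      then show "k \<in> {m..n}" using c by (auto simp: m_def n_def intro!: floor_mono mult_left_mono)
    next
      fix k assume k: "k \<in> {m..n}"
      \<comment> \<open>The point \<open>s\<close> is excluded from \<open>{s<..t}\<close>, so cell
        \<open>m\<close> needs a representative strictly to its right; the other cells are
        represented by their left endpoints.\<close>
      obtain w where w: "s < w" "w < (of_int m + 1) / c" using dense[OF s(2)] by blast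
      define u where "u = (if k = m then w else of_int k / c)"
      have "(of_int m + 1) / c \<le> of_int n / c" using mono[of m n] \<open>m < n\<close> by auto
      moreover have "(of_int m + 1) / c \<le> of_int k / c" if "k \<noteq> m" using mono[of m k] k that by auto
      moreover have "of_int k / c \<le> of_int n / c" using k c by (simp add: divide_right_mono)
      ultimately have "u \<in> {s<..t} \<and> \<lfloor>c * u\<rfloor> = k"
        unfolding fl using s t w step[of k] by (auto simp: u_def)
      then show "k \<in> (\<lambda>u. \<lfloor>c * u\<rfloor>) ` {s<..t}" by blast
    qed
    then show ?thesis by (metis image_image)
  qed
  have "AE \<omega> in M. \<forall>k\<in>{m..n}. \<Lambda> (P k) \<omega> = X (hi k) \<omega> - X (lo k) \<omega>"
  proof (subst AE_ball_countable)
    have [measurable]: "P k \<in> sets borel" for k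
      unfolding P_def by measurable
    show "\<forall>k\<in>{m..n}. AE \<omega> in M. \<Lambda> (P k) \<omega> = X (hi k) \<omega> - X (lo k) \<omega>"
      by (intro ballI Lambda_interval_eq lohi) measurable
  qed auto
  then show ?thesis
    using grid_eq[OF c]
  proof eventually_elim
    case (elim \<omega>)
    have "step_integral \<Lambda> (\<lambda>u. g \<lfloor>c * u\<rfloor>) s t \<omega> = (\<Sum>k\<in>{m..n}. g k *\<^sub>R \<Lambda> (P k) \<omega>)"
      unfolding step_integral_def img
      using g by (subst sum.reindex) (auto simp: P_def inj_eq intro: inj_on_subset)
    also have "\<dots> = (\<Sum>k\<in>{m..n}. g k *\<^sub>R (X (hi k) \<omega> - X (lo k) \<omega>))"
      using elim by (intro sum.cong) auto
    also have "{m..n} = insert m (insert n {m<..<n})" using \<open>m < n\<close> by auto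
    also have "(\<Sum>k\<in>insert m (insert n {m<..<n}). g k *\<^sub>R (X (hi k) \<omega> - X (lo k) \<omega>))
        = g m *\<^sub>R (X (hi m) \<omega> - X (lo m) \<omega>) + (g n *\<^sub>R (X (hi n) \<omega> - X (lo n) \<omega>)
          + (\<Sum>k\<in>{m<..<n}. g k *\<^sub>R (X (hi k) \<omega> - X (lo k) \<omega>)))"
      using \<open>m < n\<close> by simp
    also have "(\<Sum>k\<in>{m<..<n}. g k *\<^sub>R (X (hi k) \<omega> - X (lo k) \<omega>)) = (\<Sum>k\<in>{m<..<n}. g k *\<^sub>R grid c k \<omega>)"
      using elim(2) by (intro sum.cong) (auto simp: lo_def hi_def)
    finally show ?case
      using \<open>m < n\<close> by (simp add: lo_def hi_def m_def n_def)
  qed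
qed

end

subsection \<open>The Langevin type equation\<close>

text \<open>The Stieltjes measure of the floor function has unit atoms at the points
  \<open>k / c\<close> and no other mass. A grid point lies in \<open>{s<..t}\<close> exactly if
  \<open>k\<close> exceeds the floor of \<open>c * s\<close> and is at most that of
  \<open>c * t\<close>.\<close>

lemma set_integral_interval_measure_floor:
  fixes f :: "real \<Rightarrow> 'a::{second_countable_topology, banach}"
  assumes c: "c > 0" and f [measurable]: "f \<in> borel_measurable borel"
  shows "(LINT u:{s<..t}|interval_measure (\<lambda>u. of_int \<lfloor>c * u\<rfloor>). f u)
    = (\<Sum>k\<in>{\<lfloor>c * s\<rfloor><..\<lfloor>c * t\<rfloor>}. f (of_int k / c))"
proof -
  define F :: "real \<Rightarrow> real" where "F u = of_int \<lfloor>c * u\<rfloor>" for u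
  define \<mu> where "\<mu> = interval_measure F"
  have [measurable_cong]: "sets \<mu> = sets borel" by (simp add: \<mu>_def)
  have em: "emeasure \<mu> {x<..y} = ennreal (F y - F x)" if "x \<le> y" for x y
    unfolding \<mu>_def
  proof (rule emeasure_interval_measure_Ioc[OF that])
    show "F x \<le> F y" if "x \<le> y" for x y
      using that c by (simp add: F_def floor_mono)
    show "continuous (at_right a) F" for a
      unfolding continuous_within F_def
      by (rule tendsto_eventually) (use eventually_floor_at_right[OF c, of a] in eventually_elim, simp)
  qed
  \<comment> \<open>The gaps between grid points are exhausted by countably many intervals closed on
    the right, since those are the sets whose measure is read off from \<open>F\<close>; the floor
    has no increment over any of them.\<close>
  define N where "N = (\<Union>k::int. \<Union>n::nat. {of_int k / c<..(of_int k + 1 - 1 / real (Suc n)) / c})"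
  have "N \<in> null_sets \<mu>"
    unfolding N_def
  proof (intro null_sets_UN')
    fix k :: int and n :: nat
    have "\<lfloor>of_int k + (1 - 1 / real (Suc n)) :: real\<rfloor> = k"
      by (auto simp: floor_eq_iff)
    then have "F ((of_int k + 1 - 1 / real (Suc n)) / c) = F (of_int k / c)"
      using c by (simp add: F_def add_diff_eq del: of_nat_Suc)
    moreover have "of_int k / c \<le> (of_int k + 1 - 1 / real (Suc n)) / c"
      using c by (intro divide_right_mono) auto
    ultimately have "emeasure \<mu> {of_int k / c<..(of_int k + 1 - 1 / real (Suc n)) / c} = 0"
      by (subst em) simp_all
    then show "{of_int k / c<..(of_int k + 1 - 1 / real (Suc n)) / c} \<in> null_sets \<mu>"
      by (intro null_setsI) auto
  qed auto
  then have "AE u in \<mu>. u \<notin> N" by (rule AE_not_in)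
  then have AE_int: "AE u in \<mu>. \<exists>j::int. u = of_int j / c"
  proof eventually_elim
    case (elim u)
    define k where "k = \<lfloor>c * u\<rfloor>"
    have k: "of_int k \<le> c * u" "c * u < of_int k + 1" by (simp_all add: k_def)
    show ?case
    proof (rule ccontr)
      assume "\<nexists>j::int. u = of_int j / c"
      then have "u \<noteq> of_int k / c" by blast
      then have "of_int k \<noteq> c * u" using c by (simp add: eq_divide_eq mult.commute)
      then have 1: "of_int k / c < u" using k c by (simp add: field_simps)
      obtain n where "inverse (real (Suc n)) < of_int k + 1 - c * u"
        using reals_Archimedean[of "of_int k + 1 - c * u"] k by auto
      then have "u \<le> (of_int k + 1 - 1 / real (Suc n)) / c"
        using c by (simp add: inverse_eq_divide pos_le_divide_eq mult.commute del: of_nat_Suc)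
      then show False using elim 1 by (auto simp: N_def)
    qed
  qed
  \<comment> \<open>The interval from the preceding grid point to this one has mass 1, and up to a
    null set this point is all of it.\<close>
  have atom: "emeasure \<mu> {of_int k / c} = 1" for k :: int
  proof -
    have "emeasure \<mu> {of_int k / c} = emeasure \<mu> {(of_int k - 1) / c<..of_int k / c}"
    proof (rule emeasure_eq_AE)
      show "AE u in \<mu>. u \<in> {of_int k / c} \<longleftrightarrow> u \<in> {(of_int k - 1) / c<..of_int k / c}"
        using AE_int
      proof eventually_elim
        case (elim u)
        then obtain j :: int where j: "u = of_int j / c" by blast
        have "(of_int j / c = of_int k / c) \<longleftrightarrow> j = k" using c by simp
        moreover have "(of_int k - 1) / c < of_int j / c \<longleftrightarrow> k - 1 < j"
          using c by (simp add: divide_less_cancel) linarith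
        moreover have "of_int j / c \<le> of_int k / c \<longleftrightarrow> j \<le> k"
          using c by (simp add: divide_le_cancel)
        ultimately show ?case by (auto simp: j)
      qed
    qed auto
    also have "\<dots> = 1"
      using c by (subst em) (simp_all add: F_def divide_right_mono)
    finally show ?thesis .
  qed
  let ?K = "{\<lfloor>c * s\<rfloor><..\<lfloor>c * t\<rfloor>}"
  have "(LINT u:{s<..t}|\<mu>. f u) = (\<integral>u. (\<Sum>k\<in>?K. indicator {of_int k / c} u *\<^sub>R f (of_int k / c)) \<partial>\<mu>)"
    unfolding set_lebesgue_integral_def
  proof (rule integral_cong_AE)
    show "AE u in \<mu>. indicator {s<..t} u *\<^sub>R f u = (\<Sum>k\<in>?K. indicator {of_int k / c} u *\<^sub>R f (of_int k / c))"
      using AE_int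
    proof eventually_elim
      case (elim u)
      then obtain j :: int where j: "u = of_int j / c" by blast
      then have cu: "c * u = of_int j" using c by simp
      have "u \<in> {s<..t} \<longleftrightarrow> c * s < c * u \<and> c * u \<le> c * t" using c by simp
      also have "\<dots> \<longleftrightarrow> j \<in> ?K" unfolding cu by (simp add: floor_less_iff le_floor_iff)
      finally have mem: "u \<in> {s<..t} \<longleftrightarrow> j \<in> ?K" .
      have "(\<Sum>k\<in>?K. indicator {of_int k / c} u *\<^sub>R f (of_int k / c)) = (\<Sum>k\<in>?K. if k = j then f u else 0)"
        using c by (intro sum.cong) (auto simp: j indicator_def)
      also have "\<dots> = (if j \<in> ?K then f u else 0)" by (subst sum.delta) auto
      finally show ?case using mem by (simp add: indicator_def)
    qed
  qed measurable
  also have "\<dots> = (\<Sum>k\<in>?K. \<integral>u. indicator {of_int k / c} u *\<^sub>R f (of_int k / c) \<partial>\<mu>)"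
    by (rule Bochner_Integration.integral_sum) (auto intro!: integrable_real_indicator simp: atom)
  also have "\<dots> = (\<Sum>k\<in>?K. f (of_int k / c))"
    by (intro sum.cong refl, subst integral_scaleR_left)
      (auto intro!: integrable_real_indicator simp: atom measure_def)
  finally show ?thesis by (simp add: \<mu>_def F_def[abs_def])
qed

context prob_space
begin

text \<open>Reduces the continuous limit to sequences, along which almost sure convergence implies
  convergence in probability by dominated convergence.\<close>

lemma tendsto_in_prob_at_bot_sequentially:
  assumes "\<And>s. filterlim s at_bot sequentially \<Longrightarrow> tendsto_in_prob M (\<lambda>n. Y (s n)) L sequentially"
  shows "tendsto_in_prob M Y L (at_bot :: real filter)"
  unfolding tendsto_in_prob_def
  by (intro allI impI tendsto_at_botI_sequentially) (use assms in \<open>auto simp: tendsto_in_prob_def\<close>)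

lemma tendsto_in_prob_at_top_sequentially:
  assumes "\<And>s. filterlim s at_top sequentially \<Longrightarrow> tendsto_in_prob M (\<lambda>n. Y (s n)) L sequentially"
  shows "tendsto_in_prob M Y L (at_top :: real filter)"
  unfolding tendsto_in_prob_def
  by (intro allI impI tendsto_at_topI_sequentially) (use assms in \<open>auto simp: tendsto_in_prob_def\<close>)

text \<open>One-dimensional marginals repeat with period \<open>p\<close>, so tightness on
  \<open>{0..p}\<close> is tightness for all times.\<close>

lemma semi_stationary_tight:
  assumes Z: "cadlag_process M Z" and ss: "semi_stationary M Z" and "\<epsilon> > 0"
  shows "\<exists>a>0. \<forall>t. prob {\<omega>\<in>space M. norm (Z t \<omega>) > a} \<le> \<epsilon>"
proof -
  have [measurable]: "Z t \<in> borel_measurable M" for t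
    using Z by (simp add: cadlag_process_def)
  obtain p where "p > 0" and fdd: "same_fdd M (\<lambda>t. Z (t + p)) Z"
    using ss by (auto simp: semi_stationary_def semi_stationary_with_period_def)
  have shift: "prob {\<omega>\<in>space M. norm (Z (t + p) \<omega>) > a} = prob {\<omega>\<in>space M. norm (Z t \<omega>) > a}" for t a
  proof -
    have "distr (distr M (Pi\<^sub>M {t} (\<lambda>_. borel)) (\<lambda>\<omega>. \<lambda>t\<in>{t}. Z (t + p) \<omega>)) borel (\<lambda>x. x t)
        = distr (distr M (Pi\<^sub>M {t} (\<lambda>_. borel)) (\<lambda>\<omega>. \<lambda>t\<in>{t}. Z t \<omega>)) borel (\<lambda>x. x t)"
      using fdd by (simp add: same_fdd_def)
    then have "distr M borel (Z (t + p)) = distr M borel (Z t)"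
      by (subst (asm) (1 2) distr_distr) (simp_all add: comp_def)
    then show ?thesis by (simp add: prob_norm_distr)
  qed
  have shift_n: "prob {\<omega>\<in>space M. norm (Z (t + real n * p) \<omega>) > a} = prob {\<omega>\<in>space M. norm (Z t \<omega>) > a}" for t a n
  proof (induction n)
    case (Suc n)
    then show ?case using shift[of a "t + real n * p"] by (simp add: algebra_simps)
  qed simp
  obtain a where a: "a > 0" "\<And>t. t \<in> {0..p} \<Longrightarrow> prob {\<omega>\<in>space M. norm (Z t \<omega>) > a} \<le> \<epsilon>"
    using cadlag_process_tight[OF Z \<open>\<epsilon> > 0\<close>] by blast
  have "prob {\<omega>\<in>space M. norm (Z t \<omega>) > a} \<le> \<epsilon>" for t
  proof -
    define j where "j = \<lfloor>t / p\<rfloor>"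
    define r where "r = t - of_int j * p"
    have "of_int j \<le> t / p" "t / p < of_int j + 1" by (simp_all add: j_def)
    then have "r \<in> {0..p}" using \<open>p > 0\<close> by (simp add: r_def field_simps)
    \<comment> \<open>\<open>shift_n\<close> moves only forward in time, so the smaller of
      \<open>r\<close> and \<open>t\<close> is shifted to the larger.\<close>
    moreover have "prob {\<omega>\<in>space M. norm (Z t \<omega>) > a} = prob {\<omega>\<in>space M. norm (Z r \<omega>) > a}"
    proof (cases "j \<ge> 0")
      case True
      then show ?thesis using shift_n[of a r "nat j"] by (simp add: r_def)
    next
      case False
      then show ?thesis using shift_n[of a t "nat (- j)"] by (simp add: r_def)
    qed
    ultimately show ?thesis using a(2) by simp
  qed
  then show ?thesis using a(1) by blast
qed

lemma char_vec_add_indep: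
  assumes ind: "indep_var borel U borel V"
  shows "char_vec (distr M borel (\<lambda>\<omega>. U \<omega> + V \<omega>)) z
    = char_vec (distr M borel U) z * char_vec (distr M borel V) z"
proof -
  have [measurable]: "U \<in> borel_measurable M" "V \<in> borel_measurable M"
    using ind by (auto dest: indep_var_rv1 indep_var_rv2)
  have "char_vec (distr M borel (\<lambda>\<omega>. U \<omega> + V \<omega>)) z = (CLINT \<omega>|M. iexp (z \<bullet> U \<omega>) * iexp (z \<bullet> V \<omega>))"
    unfolding char_vec_def
    by (subst integral_distr) (auto simp: inner_add_right exp_add ring_distribs)
  also have "\<dots> = (CLINT \<omega>|M. iexp (z \<bullet> U \<omega>)) * (CLINT \<omega>|M. iexp (z \<bullet> V \<omega>))"
    by (intro indep_var_lebesgue_integral indep_var_compose[unfolded comp_def, OF ind])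
      (auto intro!: integrable_const_bound[where B=1])
  finally show ?thesis
    unfolding char_vec_def by (simp add: integral_distr)
qed

lemma char_vec_scaleR:
  assumes [measurable]: "U \<in> borel_measurable M"
  shows "char_vec (distr M borel (\<lambda>\<omega>. r *\<^sub>R U \<omega>)) z = char_vec (distr M borel U) (r *\<^sub>R z)"
  unfolding char_vec_def by (simp add: integral_distr)

end

section \<open>The equation as an autoregression, and necessity of the logarithmic moment\<close>

locale langevin = isrm_process M \<Lambda> X for M :: "'w measure"
    and \<Lambda> :: "real set \<Rightarrow> 'w \<Rightarrow> real ^ 'd" and X :: "real \<Rightarrow> 'w \<Rightarrow> real ^ 'd" +
  fixes b c :: real
  assumes c: "c > 0" and b: "b > 1"
begin

definition W :: "int \<Rightarrow> 'w \<Rightarrow> real ^ 'd" where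
  "W k \<omega> = geom_sum b (\<lambda>i. grid c (k - 1 - int i) \<omega>)"

lemma measurable_W [measurable]: "W k \<in> borel_measurable M"
  unfolding W_def[abs_def] by measurable

text \<open>Allows time reversal: a series over past cells has the law of the series over future
  cells, which is the integral over the positive half-line.\<close>

lemma distr_geom_sum_grid:
  assumes "inj \<sigma>" "inj \<tau>"
  shows "distr M borel (\<lambda>\<omega>. geom_sum b (\<lambda>i. grid c (\<sigma> i) \<omega>))
    = distr M borel (\<lambda>\<omega>. geom_sum b (\<lambda>i. grid c (\<tau> i) \<omega>))"
  by (rule iid_distr_fun_eq[OF iid_reindex[OF iid_grid[OF c] assms(1)] iid_reindex[OF iid_grid[OF c] assms(2)]])
    measurable

lemma distr_W: "distr M borel (W k) = distr M borel (\<lambda>\<omega>. geom_sum b (\<lambda>i. grid c (int i) \<omega>))"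
  unfolding W_def[abs_def] by (rule distr_geom_sum_grid) (auto simp: inj_def)

lemma same_fdd_W: "same_fdd M (\<lambda>t. W \<lfloor>c * (t + 1 / c)\<rfloor>) (\<lambda>t. W \<lfloor>c * t\<rfloor>)"
  unfolding same_fdd_def
proof (intro allI impI)
  fix J :: "real set"
  \<comment> \<open>All times in \<open>J\<close> are read off from one two-sided noise sequence by
    one map; a time shift by \<open>1 / c\<close> only shifts that sequence by one index.\<close>
  define h where "h x = (\<lambda>t\<in>J. geom_sum b (\<lambda>i. x (\<lfloor>c * t\<rfloor> - 1 - int i)))" for x :: "int \<Rightarrow> real ^ 'd"
  have fl: "\<lfloor>c * (t + 1 / c)\<rfloor> = \<lfloor>c * t\<rfloor> + 1" for t
    using c by (simp add: ring_distribs)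
  have "distr M (Pi\<^sub>M J (\<lambda>_. borel)) (\<lambda>\<omega>. h (\<lambda>k. grid c (k + 1) \<omega>))
      = distr M (Pi\<^sub>M J (\<lambda>_. borel)) (\<lambda>\<omega>. h (\<lambda>k. grid c k \<omega>))"
  proof (rule iid_distr_fun_eq[where h=h and \<xi>="\<lambda>k. grid c (k + 1)" and \<eta>="grid c"])
    show "iid (\<lambda>k. grid c (k + 1)) (distr M borel (\<Lambda> {0<..1 / c}))"
      by (rule iid_reindex[OF iid_grid[OF c]]) (simp add: inj_def)
    show "h \<in> Pi\<^sub>M UNIV (\<lambda>_. borel) \<rightarrow>\<^sub>M Pi\<^sub>M J (\<lambda>_. borel)"
      unfolding h_def by measurable
  qed (rule iid_grid[OF c])
  then show "distr M (Pi\<^sub>M J (\<lambda>_. borel)) (\<lambda>\<omega>. \<lambda>t\<in>J. W \<lfloor>c * (t + 1 / c)\<rfloor> \<omega>)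
      = distr M (Pi\<^sub>M J (\<lambda>_. borel)) (\<lambda>\<omega>. \<lambda>t\<in>J. W \<lfloor>c * t\<rfloor> \<omega>)"
    by (simp add: h_def W_def fl algebra_simps)
qed

lemma measurable_step_integral:
  assumes [measurable]: "f \<in> borel_measurable borel"
  shows "step_integral \<Lambda> f s t \<in> borel_measurable M"
proof -
  have "{u\<in>{s<..t}. f u = a} \<in> bounded_borel" for a
  proof -
    have "{u\<in>{s<..t}. f u = a} \<in> sets borel" by measurable
    then show ?thesis
      by (auto simp: bounded_borel_def intro: bounded_subset[of "{s..t}"])
  qed
  then show ?thesis
    unfolding step_integral_def[abs_def]
    by (intro borel_measurable_sum borel_measurable_scaleR measurable_Lambda) auto
qed

lemma measurable_powi_floor [measurable]:
  "(\<lambda>u. b powi \<lfloor>c * u\<rfloor>) \<in> borel_measurable borel"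
  "(\<lambda>u. b powi (- \<lfloor>c * u\<rfloor> - 1)) \<in> borel_measurable borel"
proof -
  have 1: "(\<lambda>u. \<lfloor>c * u\<rfloor>) \<in> borel \<rightarrow>\<^sub>M count_space UNIV" by measurable
  show "(\<lambda>u. b powi \<lfloor>c * u\<rfloor>) \<in> borel_measurable borel"
    "(\<lambda>u. b powi (- \<lfloor>c * u\<rfloor> - 1)) \<in> borel_measurable borel"
    using measurable_compose[OF 1, of "\<lambda>k. b powi k" borel]
      measurable_compose[OF 1, of "\<lambda>k. b powi (- k - 1)" borel] by simp_all
qed

lemma inj_powi: "inj (\<lambda>k. b powi k)" "inj (\<lambda>k. b powi (- k - 1))"
proof -
  show 1: "inj (\<lambda>k. b powi k)"
    using b by (intro strict_mono_imp_inj_on strict_monoI power_int_strict_increasing) auto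
  show "inj (\<lambda>k. b powi (- k - 1))"
  proof (rule injI)
    fix x y :: int assume "b powi (- x - 1) = b powi (- y - 1)"
    then show "x = y" using injD[OF 1, of "- x - 1" "- y - 1"] by simp
  qed
qed

text \<open>Apply the equation between consecutive grid points. The integral over
  \<open>((k - 1) / c, k / c]\<close> is the value at the right endpoint, after the jump, so the
  scheme is implicit and the factor \<open>b\<close> falls on the new value. From the last grid
  point up to \<open>t\<close> both the noise and the integral vanish.\<close>

lemma langevin_solution_recursion:
  assumes Z: "langevin_solution M X b c Z"
  shows "AE \<omega> in M. (\<forall>k. Z (of_int (k - 1) / c) \<omega> = b *\<^sub>R Z (of_int k / c) \<omega> - grid c (k - 1) \<omega>)
    \<and> (\<forall>t. Z t \<omega> = Z (of_int \<lfloor>c * t\<rfloor> / c) \<omega>)"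
proof -
  have cad: "cadlag (\<lambda>t. Z t \<omega>)" if "\<omega> \<in> space M" for \<omega>
    using Z that by (simp add: langevin_solution_def cadlag_process_def)
  have "AE \<omega> in M. \<forall>s t. s \<le> t \<longrightarrow>
        Z t \<omega> - Z s \<omega> =
          X (of_int \<lfloor>c * t\<rfloor> / c) \<omega> - X (of_int \<lfloor>c * s\<rfloor> / c) \<omega>
          - (b - 1) *\<^sub>R (LINT u:{s<..t}|interval_measure (\<lambda>u. of_int \<lfloor>c * u\<rfloor>). Z u \<omega>)"
    using Z by (simp add: langevin_solution_def)
  then show ?thesis
    using grid_eq[OF c] AE_space
  proof eventually_elim
    case (elim \<omega>)
    have eq: "Z t \<omega> - Z s \<omega> = X (of_int \<lfloor>c * t\<rfloor> / c) \<omega> - X (of_int \<lfloor>c * s\<rfloor> / c) \<omega>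
          - (b - 1) *\<^sub>R (\<Sum>k\<in>{\<lfloor>c * s\<rfloor><..\<lfloor>c * t\<rfloor>}. Z (of_int k / c) \<omega>)" if "s \<le> t" for s t
      using elim(1) that
      by (simp add: set_integral_interval_measure_floor[OF c cadlag_measurable[OF cad[OF elim(3)]]])
    show ?case
    proof (intro conjI allI)
      fix k :: int
      have s: "{k - 1<..k} = {k}" by auto
      have fl: "\<lfloor>c * (of_int j / c)\<rfloor> = j" for j :: int using c by simp
      have i: "of_int (k - 1) + 1 = (of_int k :: real)" by simp
      have 1: "Z (of_int k / c) \<omega> - Z (of_int (k - 1) / c) \<omega>
          = X (of_int k / c) \<omega> - X (of_int (k - 1) / c) \<omega> - (b - 1) *\<^sub>R Z (of_int k / c) \<omega>"
        using eq[of "of_int (k - 1) / c" "of_int k / c", unfolded fl s] c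
        by (simp add: divide_right_mono del: of_int_diff)
      have 2: "grid c (k - 1) \<omega> = X (of_int k / c) \<omega> - X (of_int (k - 1) / c) \<omega>"
        using elim(2)[rule_format, of "k - 1"] unfolding i .
      show "Z (of_int (k - 1) / c) \<omega> = b *\<^sub>R Z (of_int k / c) \<omega> - grid c (k - 1) \<omega>"
        using 1 unfolding 2 by (simp add: algebra_simps del: of_int_diff)
    next
      fix t
      have "of_int \<lfloor>c * t\<rfloor> / c \<le> t"
        using c by (simp add: pos_divide_le_eq mult.commute)
      then show "Z t \<omega> = Z (of_int \<lfloor>c * t\<rfloor> / c) \<omega>"
        using eq[of "of_int \<lfloor>c * t\<rfloor> / c" t] c by simp
    qed
  qed
qed

text \<open>Iterating the recursion into the past expresses the sum of \<open>\<eta> i\<close> over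
  \<open>{k..<n}\<close> as a difference of two damped values of the solution, whose tails are
  bounded uniformly. The level 1/8 for each leaves the 1/4 that Ottaviani's inequality asks
  for.\<close>

lemma log_integrable_of_semi_stationary_solution:
  assumes Z: "langevin_solution M X b c Z" and ss: "semi_stationary M Z"
  shows "log_integrable (\<Lambda> {0<..1})"
proof -
  have cad: "cadlag_process M Z" using Z by (simp add: langevin_solution_def)
  then have [measurable]: "Z t \<in> borel_measurable M" for t
    by (simp add: cadlag_process_def)
  obtain a where a: "a > 0" "\<And>t. prob {\<omega>\<in>space M. norm (Z t \<omega>) > a} \<le> 1/8"
    using semi_stationary_tight[OF cad ss, of "1/8"] by auto
  define \<zeta> where "\<zeta> n = Z (of_int (- int n) / c)" for n
  define \<eta> where "\<eta> i \<omega> = (1 / b) ^ Suc i *\<^sub>R grid c (- 1 - int i) \<omega>" for i \<omega>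
  have [measurable]: "\<zeta> n \<in> borel_measurable M" "\<eta> n \<in> borel_measurable M" for n
    unfolding \<zeta>_def \<eta>_def[abs_def] by measurable
  have "indep_vars (\<lambda>_. borel) (\<lambda>i. grid c (- 1 - int i)) UNIV"
    using iid_reindex[OF iid_grid[OF c], of "\<lambda>i. - 1 - int i"] by (simp add: iid_def inj_def)
  then have ind: "indep_vars (\<lambda>_. borel) \<eta> UNIV"
    unfolding \<eta>_def[abs_def]
    by (rule indep_vars_compose2[where Y="\<lambda>i x. (1 / b) ^ Suc i *\<^sub>R x"]) simp
  have sums: "AE \<omega> in M. \<forall>k n. k \<le> n \<longrightarrow>
     (\<Sum>i\<in>{k..<n}. \<eta> i \<omega>) = (1 / b) ^ k *\<^sub>R \<zeta> k \<omega> + - ((1 / b) ^ n *\<^sub>R \<zeta> n \<omega>)"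
    using langevin_solution_recursion[OF Z]
  proof eventually_elim
    case (elim \<omega>)
    have step: "\<eta> i \<omega> = (1 / b) ^ i *\<^sub>R \<zeta> i \<omega> - (1 / b) ^ Suc i *\<^sub>R \<zeta> (Suc i) \<omega>" for i
    proof -
      have i: "- int (Suc i) = - int i - 1" "- 1 - int i = - int i - 1" by simp_all
      have "\<zeta> (Suc i) \<omega> = b *\<^sub>R \<zeta> i \<omega> - grid c (- 1 - int i) \<omega>"
        using elim[THEN conjunct1, rule_format, of "- int i"] unfolding \<zeta>_def i .
      then show ?thesis
        using b by (simp add: \<eta>_def scaleR_diff_right)
    qed
    show ?case
    proof (intro allI impI)
      fix k n :: nat assume "k \<le> n"
      then show "(\<Sum>i\<in>{k..<n}. \<eta> i \<omega>) = (1 / b) ^ k *\<^sub>R \<zeta> k \<omega> + - ((1 / b) ^ n *\<^sub>R \<zeta> n \<omega>)"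
        by (induction n rule: dec_induct) (simp_all add: step)
    qed
  qed
  have tail: "prob {\<omega>\<in>space M. norm ((1 / b) ^ k *\<^sub>R \<zeta> k \<omega>) > a} \<le> 1/8" for k
  proof -
    have "norm ((1 / b) ^ k *\<^sub>R \<zeta> k \<omega>) \<le> norm (\<zeta> k \<omega>)" for \<omega>
      using b by (simp add: mult_left_le_one_le power_le_one)
    then have "prob {\<omega>\<in>space M. norm ((1 / b) ^ k *\<^sub>R \<zeta> k \<omega>) > a} \<le> prob {\<omega>\<in>space M. norm (\<zeta> k \<omega>) > a}"
      by (intro finite_measure_mono) (auto intro: less_le_trans)
    then show ?thesis using a(2) unfolding \<zeta>_def by (rule order_trans)
  qed
  have "summable (\<lambda>j. prob {\<omega>\<in>space M. norm (\<eta> j \<omega>) > 4 * (2 * a)})"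
  proof (rule summable_tail_of_tight_sums[OF ind])
    fix k n :: nat assume "k \<le> n"
    have "prob {\<omega>\<in>space M. norm (\<Sum>i\<in>{k..<n}. \<eta> i \<omega>) > 2 * a}
        = prob {\<omega>\<in>space M. norm ((1 / b) ^ k *\<^sub>R \<zeta> k \<omega> + - ((1 / b) ^ n *\<^sub>R \<zeta> n \<omega>)) > a + a}"
      unfolding mult_2 by (rule prob_norm_AE_eq) (use sums \<open>k \<le> n\<close> in auto)
    also have "\<dots> \<le> prob {\<omega>\<in>space M. norm ((1 / b) ^ k *\<^sub>R \<zeta> k \<omega>) > a}
        + prob {\<omega>\<in>space M. norm (- ((1 / b) ^ n *\<^sub>R \<zeta> n \<omega>)) > a}"
      by (rule prob_norm_add_gt_le) measurable
    also have "\<dots> \<le> 1/8 + 1/8"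
      unfolding norm_minus_cancel by (intro add_mono tail)
    finally show "prob {\<omega>\<in>space M. norm (\<Sum>i\<in>{k..<n}. \<eta> i \<omega>) > 2 * a} \<le> 1/4" by simp
  qed
  \<comment> \<open>Multiplying by \<open>b ^ Suc j\<close> moves the weight into the level; its
    extra factor \<open>b\<close> is part of the constant \<open>8 * a * b\<close>.\<close>
  moreover have "prob {\<omega>\<in>space M. norm (\<eta> j \<omega>) > 4 * (2 * a)}
      = prob {\<omega>\<in>space M. norm (grid c 0 \<omega>) > 8 * a * b * b ^ j}" for j
  proof -
    have "prob {\<omega>\<in>space M. norm (\<eta> j \<omega>) > 4 * (2 * a)}
        = prob {\<omega>\<in>space M. norm (grid c (- 1 - int j) \<omega>) > 8 * a * b * b ^ j}"
      using b by (intro arg_cong[where f=prob] Collect_cong) (simp add: \<eta>_def field_simps)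
    also have "\<dots> = prob {\<omega>\<in>space M. norm (grid c 0 \<omega>) > 8 * a * b * b ^ j}"
      by (rule iid_prob_eq[OF iid_grid[OF c]])
    finally show ?thesis .
  qed
  ultimately have "log_integrable (grid c 0)"
    using a(1) b by (intro log_integrable_of_summable_tail[of _ b "8 * a * b"]) auto
  then have "log_integrable (\<Lambda> {0<..1 / c})" by (simp add: grid_def[abs_def])
  then show ?thesis using c by (intro log_integrable_Lambda[of "1 / c" 1]) auto
qed

end

lemma filterlim_int_diff_at_top:
  assumes "filterlim l at_bot F"
  shows "filterlim (\<lambda>n. m - l n :: int) at_top F"
  unfolding filterlim_at_top
proof
  fix Z
  have "eventually (\<lambda>n. l n \<le> m - Z) F" using assms by (simp add: filterlim_at_bot)
  then show "eventually (\<lambda>n. Z \<le> m - l n) F" by eventually_elim simp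
qed

lemma filterlim_int_diff_at_bot:
  assumes "filterlim l at_top F"
  shows "filterlim (\<lambda>n. m - l n :: int) at_bot F"
  unfolding filterlim_at_bot
proof
  fix Z
  have "eventually (\<lambda>n. m - Z \<le> l n) F" using assms by (simp add: filterlim_at_top)
  then show "eventually (\<lambda>n. m - l n \<le> Z) F" by eventually_elim simp
qed

section \<open>Convergence of the series and versions of the improper integrals\<close>

locale langevin_log = langevin M \<Lambda> X b c for M :: "'w measure"
    and \<Lambda> :: "real set \<Rightarrow> 'w \<Rightarrow> real ^ 'd" and X :: "real \<Rightarrow> 'w \<Rightarrow> real ^ 'd"
    and b c :: real +
  assumes log_int: "log_integrable (\<Lambda> {0<..1})"
begin

lemma AE_summable_grid:
  assumes "c' > 0" "inj \<sigma>"
  shows "AE \<omega> in M. summable (\<lambda>i::nat. (1 / b) ^ Suc i *\<^sub>R grid c' (\<sigma> i) \<omega>)"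
proof (rule geom_sum_AE_summable)
  show "iid (\<lambda>i. grid c' (\<sigma> i)) (distr M borel (\<Lambda> {0<..1 / c'}))"
    by (rule iid_reindex[OF iid_grid[OF assms(1)] assms(2)])
  have "distr M borel (grid c' (\<sigma> 0)) = distr M borel (\<Lambda> {0<..1 / c'})"
    using iid_grid[OF assms(1)] by (simp add: iid_def)
  moreover have "log_integrable (\<Lambda> {0<..1 / c'})"
    using log_integrable_Lambda[OF _ _ log_int, of "1 / c'"] assms(1) by simp
  ultimately show "log_integrable (grid c' (\<sigma> 0))"
    by (subst log_integrable_cong[of _ "\<Lambda> {0<..1 / c'}"]) auto
qed (rule b)

lemma AE_summable_W:
  "AE \<omega> in M. \<forall>k. summable (\<lambda>i. (1 / b) ^ Suc i *\<^sub>R grid c (k - 1 - int i) \<omega>)"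
  unfolding AE_all_countable by (intro allI AE_summable_grid[OF c]) (simp add: inj_def)

lemma W_recursion: "AE \<omega> in M. \<forall>k. W (k - 1) \<omega> = b *\<^sub>R W k \<omega> - grid c (k - 1) \<omega>"
  using AE_summable_W
proof eventually_elim
  case (elim \<omega>)
  show ?case
  proof
    fix k
    have i: "k - 1 - int (Suc i) = k - 1 - 1 - int i" for i by simp
    show "W (k - 1) \<omega> = b *\<^sub>R W k \<omega> - grid c (k - 1) \<omega>"
      unfolding W_def geom_sum_Suc[OF elim[rule_format, of k]] i using b by simp
  qed
qed

text \<open>Counting cells backwards from \<open>m - 1\<close> turns the complete cells of the
  integral into a partial sum of the series for \<open>W m\<close>. The cell \<open>l\<close>, which
  may be incomplete, is left out.\<close>

lemma sum_grid_reindex: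
  "(\<Sum>k\<in>{l<..<m}. b powi k *\<^sub>R grid c k \<omega>)
    = b powi m *\<^sub>R (\<Sum>i<nat (m - 1 - l). (1 / b) ^ Suc i *\<^sub>R grid c (m - 1 - int i) \<omega>)"
proof -
  have "(\<Sum>k\<in>{l<..<m}. b powi k *\<^sub>R grid c k \<omega>)
      = (\<Sum>i<nat (m - 1 - l). b powi (m - 1 - int i) *\<^sub>R grid c (m - 1 - int i) \<omega>)"
    by (rule sum.reindex_bij_witness[of _ "\<lambda>i. m - 1 - int i" "\<lambda>k. nat (m - 1 - k)"]) auto
  also have "\<dots> = (\<Sum>i<nat (m - 1 - l). b powi m *\<^sub>R ((1 / b) ^ Suc i *\<^sub>R grid c (m - 1 - int i) \<omega>))"
  proof (rule sum.cong[OF refl])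
    fix i
    have "b powi (m - 1 - int i) = b powi (m - int (Suc i))" by (simp add: algebra_simps)
    also have "\<dots> = b powi m * (1 / b) ^ Suc i"
      using b by (subst power_int_diff) (simp_all add: power_divide del: power_Suc of_nat_Suc)
    finally show "b powi (m - 1 - int i) *\<^sub>R grid c (m - 1 - int i) \<omega>
       = b powi m *\<^sub>R ((1 / b) ^ Suc i *\<^sub>R grid c (m - 1 - int i) \<omega>)" by simp
  qed
  finally show ?thesis by (simp add: scaleR_sum_right)
qed

lemma powi_tendsto_0:
  assumes "filterlim k at_bot F"
  shows "((\<lambda>n. b powi (k n :: int)) \<longlongrightarrow> 0) F"
proof -
  have "filterlim (\<lambda>n. - k n) at_top F"
    using filterlim_int_diff_at_top[OF assms, of 0] by simp
  then have 1: "filterlim (\<lambda>n. nat (- k n)) sequentially F"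
    by (rule filterlim_compose[OF filterlim_nat_sequentially])
  have "((\<lambda>n. (1 / b) ^ nat (- k n)) \<longlongrightarrow> 0) F"
    using b by (intro filterlim_compose[OF _ 1] LIMSEQ_realpow_zero) auto
  moreover have "eventually (\<lambda>n. k n \<le> 0) F"
    using assms by (simp add: filterlim_at_bot)
  then have "eventually (\<lambda>n. (1 / b) ^ nat (- k n) = b powi (k n)) F"
    by eventually_elim (simp add: power_int_def inverse_eq_divide)
  ultimately show ?thesis by (rule Lim_transform_eventually)
qed

lemma floor_at_top:
  assumes "filterlim s at_top F"
  shows "filterlim (\<lambda>n. \<lfloor>c * s n\<rfloor>) at_top F"
proof -
  have "filterlim (\<lambda>n. c * s n) at_top F"
    by (rule filterlim_tendsto_pos_mult_at_top[OF tendsto_const c assms])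
  then show ?thesis by (rule filterlim_compose[OF filterlim_floor_sequentially])
qed

lemma floor_at_bot:
  assumes "filterlim s at_bot F"
  shows "filterlim (\<lambda>n. \<lfloor>c * s n\<rfloor>) at_bot F"
  unfolding filterlim_at_bot
proof
  fix Z :: int
  have "eventually (\<lambda>n. s n \<le> of_int Z / c) F"
    using assms by (simp add: filterlim_at_bot)
  then show "eventually (\<lambda>n. \<lfloor>c * s n\<rfloor> \<le> Z) F"
  proof eventually_elim
    case (elim n)
    then have "c * s n \<le> of_int Z" using c by (simp add: field_simps)
    then show ?case by linarith
  qed
qed

text \<open>The complete cells up to the last grid point contribute \<open>b powi m\<close> times
  \<open>W m\<close>, and the current cell the increment of \<open>X\<close> with the same weight.
  The terms are grouped to fit \<open>cadlag_floor_affine\<close>.\<close>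

definition minf_integral :: "real \<Rightarrow> 'w \<Rightarrow> real ^ 'd" where
  "minf_integral t \<omega> = b powi \<lfloor>c * t\<rfloor> *\<^sub>R (W \<lfloor>c * t\<rfloor> \<omega> - X (of_int \<lfloor>c * t\<rfloor> / c) \<omega>) + b powi \<lfloor>c * t\<rfloor> *\<^sub>R X t \<omega>"

lemma cadlag_minf_integral: "cadlag_process M minf_integral"
  unfolding cadlag_process_def
proof (intro conjI allI ballI)
  fix \<omega> assume "\<omega> \<in> space M"
  then have "cadlag (\<lambda>t. X t \<omega>)" using cadlag_X by (simp add: cadlag_process_def)
  then show "cadlag (\<lambda>t. minf_integral t \<omega>)"
    unfolding minf_integral_def by (rule cadlag_floor_affine[OF _ c])
qed (simp add: minf_integral_def[abs_def])

lemma measurable_minf_integral [measurable]: "minf_integral t \<in> borel_measurable M"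
  using cadlag_minf_integral by (simp add: cadlag_process_def)

text \<open>The integral over \<open>{s<..t}\<close> splits into \<open>T\<close>, which converges
  almost surely by summability, and the incomplete cell \<open>N\<close> at \<open>s\<close>, whose
  weight tends to 0 while its length stays at most \<open>1 / c\<close>.\<close>

lemma integral_from_minf_version: "is_integral_from_minf M \<Lambda> (\<lambda>u. b powi \<lfloor>c * u\<rfloor>) t (minf_integral t)"
  unfolding is_integral_from_minf_def
proof (intro conjI tendsto_in_prob_at_bot_sequentially)
  fix s :: "nat \<Rightarrow> real" assume s: "filterlim s at_bot sequentially"
  define m where "m = \<lfloor>c * t\<rfloor>"
  define l where "l n = \<lfloor>c * s n\<rfloor>" for n
  have l: "filterlim l at_bot sequentially"
    unfolding l_def by (rule floor_at_bot[OF s])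
  define T where "T n \<omega> = (\<Sum>k\<in>{l n<..<m}. b powi k *\<^sub>R grid c k \<omega>)
     + b powi m *\<^sub>R (X t \<omega> - X (of_int m / c) \<omega>)" for n \<omega>
  define N where "N n \<omega> = b powi l n *\<^sub>R (X ((of_int (l n) + 1) / c) \<omega> - X (s n) \<omega>)" for n \<omega>
  have [measurable]: "T n \<in> borel_measurable M" "N n \<in> borel_measurable M" for n
    unfolding T_def[abs_def] N_def[abs_def] by measurable
  have T: "tendsto_in_prob M T (minf_integral t) sequentially"
  proof (rule tendsto_in_prob_AE)
    show "AE \<omega> in M. (\<lambda>n. T n \<omega>) \<longlonglongrightarrow> minf_integral t \<omega>"
      using AE_summable_W
    proof eventually_elim
      case (elim \<omega>)
      have "filterlim (\<lambda>n. nat (m - 1 - l n)) sequentially sequentially"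
        by (rule filterlim_compose[OF filterlim_nat_sequentially filterlim_int_diff_at_top[OF l]])
      then have "(\<lambda>n. \<Sum>i<nat (m - 1 - l n). (1 / b) ^ Suc i *\<^sub>R grid c (m - 1 - int i) \<omega>) \<longlonglongrightarrow> W m \<omega>"
        unfolding W_def geom_sum_def
        by (rule filterlim_compose[rotated]) (rule summable_LIMSEQ[OF elim[rule_format, of m]])
      then have "(\<lambda>n. T n \<omega>) \<longlonglongrightarrow> b powi m *\<^sub>R W m \<omega> + b powi m *\<^sub>R (X t \<omega> - X (of_int m / c) \<omega>)"
        unfolding T_def sum_grid_reindex by (intro tendsto_intros)
      then show ?case by (simp add: minf_integral_def m_def algebra_simps)
    qed
  qed measurable
  have N: "tendsto_in_prob M N (\<lambda>_. 0) sequentially"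
    unfolding N_def[abs_def]
  proof (rule scaled_increment_tendsto_in_prob_0[where L="1 / c"])
    show "(\<lambda>n. b powi l n) \<longlonglongrightarrow> 0" by (rule powi_tendsto_0[OF l])
    fix n
    have "of_int (l n) \<le> c * s n" "c * s n \<le> of_int (l n) + 1"
      unfolding l_def by linarith+
    then show "s n \<le> (of_int (l n) + 1) / c" "(of_int (l n) + 1) / c \<le> s n + 1 / c"
      using c by (simp_all add: field_simps)
  qed
  show "tendsto_in_prob M (\<lambda>n. step_integral \<Lambda> (\<lambda>u. b powi \<lfloor>c * u\<rfloor>) (s n) t) (minf_integral t) sequentially"
  proof (rule tendsto_in_prob_cong[OF _ _ _ _ _ _ tendsto_in_prob_add_null[OF _ _ _ T N]])
    \<comment> \<open>The cell formula requires the two endpoints to lie in different cells, which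
      holds from some \<open>n\<close> on.\<close>
    have "eventually (\<lambda>n. l n \<le> m - 1) sequentially"
      using l unfolding filterlim_at_bot by blast
    then show "eventually (\<lambda>n. AE \<omega> in M. T n \<omega> + N n \<omega> = step_integral \<Lambda> (\<lambda>u. b powi \<lfloor>c * u\<rfloor>) (s n) t \<omega>) sequentially"
    proof eventually_elim
      case (elim n)
      then have "\<lfloor>c * s n\<rfloor> < \<lfloor>c * t\<rfloor>" by (simp add: l_def m_def)
      from step_integral_floor[OF c inj_powi(1) this] show ?case
        by eventually_elim (simp add: T_def N_def l_def m_def algebra_simps)
    qed
  qed (auto intro: measurable_step_integral)
qed measurable

lemma cadlag_minf_integral_version: "cadlag_integral_from_minf M \<Lambda> (\<lambda>u. b powi \<lfloor>c * u\<rfloor>) minf_integral"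
  by (simp add: cadlag_integral_from_minf_def cadlag_minf_integral integral_from_minf_version)

text \<open>Limits in probability are almost surely unique, and the countably many grid points are
  the only values of \<open>Y\<close> that the formula for the solution uses.\<close>

lemma integral_from_minf_grid_eq:
  assumes Y: "cadlag_integral_from_minf M \<Lambda> (\<lambda>u. b powi \<lfloor>c * u\<rfloor>) Y"
  shows "AE \<omega> in M. \<forall>k. Y (of_int k / c) \<omega> = b powi k *\<^sub>R W k \<omega>"
  unfolding AE_all_countable
proof
  fix k
  have "AE \<omega> in M. Y (of_int k / c) \<omega> = minf_integral (of_int k / c) \<omega>"
  proof (rule tendsto_in_prob_unique)
    show "tendsto_in_prob M (\<lambda>s. step_integral \<Lambda> (\<lambda>u. b powi \<lfloor>c * u\<rfloor>) s (of_int k / c)) (Y (of_int k / c)) at_bot"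
      using Y by (simp add: cadlag_integral_from_minf_def is_integral_from_minf_def)
    show "tendsto_in_prob M (\<lambda>s. step_integral \<Lambda> (\<lambda>u. b powi \<lfloor>c * u\<rfloor>) s (of_int k / c)) (minf_integral (of_int k / c)) at_bot"
      using integral_from_minf_version by (simp add: is_integral_from_minf_def)
  qed (use Y in \<open>auto simp: cadlag_integral_from_minf_def is_integral_from_minf_def intro: measurable_step_integral\<close>)
  then show "AE \<omega> in M. Y (of_int k / c) \<omega> = b powi k *\<^sub>R W k \<omega>"
    using c by (simp add: minf_integral_def algebra_simps)
qed

lemma integral_0_inf: "is_integral_0_inf M \<Lambda> (\<lambda>u. b powi (- \<lfloor>c * u\<rfloor> - 1)) (\<lambda>\<omega>. geom_sum b (\<lambda>i. grid c (int i) \<omega>))"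
  unfolding is_integral_0_inf_def
proof (intro conjI tendsto_in_prob_at_top_sequentially)
  let ?V = "\<lambda>\<omega>. geom_sum b (\<lambda>i. grid c (int i) \<omega>)"
  fix s :: "nat \<Rightarrow> real" assume s: "filterlim s at_top sequentially"
  define l where "l n = \<lfloor>c * s n\<rfloor>" for n
  have l: "filterlim l at_top sequentially"
    unfolding l_def by (rule floor_at_top[OF s])
  define T where "T n \<omega> = (\<Sum>i<nat (l n). (1 / b) ^ Suc i *\<^sub>R grid c (int i) \<omega>)" for n \<omega>
  define N where "N n \<omega> = b powi (- l n - 1) *\<^sub>R (X (s n) \<omega> - X (of_int (l n) / c) \<omega>)" for n \<omega>
  have [measurable]: "T n \<in> borel_measurable M" "N n \<in> borel_measurable M" for n
    unfolding T_def[abs_def] N_def[abs_def] by measurable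
  have T: "tendsto_in_prob M T ?V sequentially"
  proof (rule tendsto_in_prob_AE)
    show "AE \<omega> in M. (\<lambda>n. T n \<omega>) \<longlonglongrightarrow> ?V \<omega>"
      using AE_summable_grid[OF c inj_of_nat]
    proof eventually_elim
      case (elim \<omega>)
      have "filterlim (\<lambda>n. nat (l n)) sequentially sequentially"
        by (rule filterlim_compose[OF filterlim_nat_sequentially l])
      then show ?case
        unfolding T_def geom_sum_def
        by (rule filterlim_compose[rotated]) (rule summable_LIMSEQ[OF elim])
    qed
  qed measurable
  have N: "tendsto_in_prob M N (\<lambda>_. 0) sequentially"
    unfolding N_def[abs_def]
  proof (rule scaled_increment_tendsto_in_prob_0[where L="1 / c"])
    show "(\<lambda>n. b powi (- l n - 1)) \<longlonglongrightarrow> 0"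
      using powi_tendsto_0[OF filterlim_int_diff_at_bot[OF l, of "- 1"]]
      by (simp only: diff_conv_add_uminus add.commute)
    fix n
    have "of_int (l n) \<le> c * s n" "c * s n \<le> of_int (l n) + 1"
      unfolding l_def by linarith+
    then show "of_int (l n) / c \<le> s n" "s n \<le> of_int (l n) / c + 1 / c"
      using c by (simp_all add: field_simps)
  qed
  show "tendsto_in_prob M (\<lambda>n. step_integral \<Lambda> (\<lambda>u. b powi (- \<lfloor>c * u\<rfloor> - 1)) 0 (s n)) ?V sequentially"
  proof (rule tendsto_in_prob_cong[OF _ _ _ _ _ _ tendsto_in_prob_add_null[OF _ _ _ T N]])
    have "eventually (\<lambda>n. 1 \<le> l n) sequentially"
      using l unfolding filterlim_at_top by blast
    then show "eventually (\<lambda>n. AE \<omega> in M. T n \<omega> + N n \<omega> = step_integral \<Lambda> (\<lambda>u. b powi (- \<lfloor>c * u\<rfloor> - 1)) 0 (s n) \<omega>) sequentially"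
    proof eventually_elim
      case (elim n)
      then have "\<lfloor>c * 0\<rfloor> < \<lfloor>c * s n\<rfloor>" by (simp add: l_def)
      from step_integral_floor[OF c inj_powi(2) this] grid_eq[OF c] show ?case
      proof eventually_elim
        case (elim \<omega>)
        have "T n \<omega> = (\<Sum>k\<in>{0..<l n}. b powi (- k - 1) *\<^sub>R grid c k \<omega>)"
          unfolding T_def
        proof (rule sum.reindex_bij_witness[of _ nat int])
          fix i assume "i \<in> {..<nat (l n)}"
          have "b powi (- int i - 1) = b powi (- int (Suc i))"
            by (rule arg_cong[where f="\<lambda>k. b powi k"]) simp
          also have "\<dots> = (1 / b) ^ Suc i"
            unfolding power_int_minus power_int_of_nat by (simp add: power_divide inverse_eq_divide)
          finally show "b powi (- int i - 1) *\<^sub>R grid c (int i) \<omega> = (1 / b) ^ Suc i *\<^sub>R grid c (int i) \<omega>"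
            by simp
        qed auto
        \<comment> \<open>The lower limit 0 is a grid point, so the first boundary cell is complete
          and is the term \<open>k = 0\<close> of the series; only the upper end leaves an
          incomplete cell.\<close>
        also have "{0..<l n} = insert 0 {0<..<l n}" using \<open>1 \<le> l n\<close> by auto
        also have "(\<Sum>k\<in>insert 0 {0<..<l n}. b powi (- k - 1) *\<^sub>R grid c k \<omega>)
            = b powi (- 1) *\<^sub>R (X (1 / c) \<omega> - X 0 \<omega>) + (\<Sum>k\<in>{0<..<l n}. b powi (- k - 1) *\<^sub>R grid c k \<omega>)"
          using elim(2)[rule_format, of 0] by simp
        finally show ?case
          using elim(1) by (simp add: N_def l_def)
      qed
    qed
  qed (auto intro: measurable_step_integral)
qed measurable

section \<open>Processes with grid values \<open>W\<close>: equation, period, law and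
  uniqueness\<close>

context
  fixes Z :: "real \<Rightarrow> 'w \<Rightarrow> real ^ 'd"
  assumes Z: "cadlag_process M Z" and Z_eq: "AE \<omega> in M. \<forall>t. Z t \<omega> = W \<lfloor>c * t\<rfloor> \<omega>"
begin

lemma measurable_Z [measurable]: "Z t \<in> borel_measurable M"
  using Z by (simp add: cadlag_process_def)

lemma langevin_solution_Z: "langevin_solution M X b c Z"
  unfolding langevin_solution_def
proof (intro conjI Z)
  show "AE \<omega> in M. \<forall>s t. s \<le> t \<longrightarrow>
        Z t \<omega> - Z s \<omega> =
          X (of_int \<lfloor>c * t\<rfloor> / c) \<omega> - X (of_int \<lfloor>c * s\<rfloor> / c) \<omega>
          - (b - 1) *\<^sub>R (LINT u:{s<..t}|interval_measure (\<lambda>u. of_int \<lfloor>c * u\<rfloor>). Z u \<omega>)"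
    using Z_eq W_recursion grid_eq[OF c] AE_space
  proof eventually_elim
    case (elim \<omega>)
    have "cadlag (\<lambda>t. Z t \<omega>)" using Z elim(4) by (simp add: cadlag_process_def)
    note int = set_integral_interval_measure_floor[OF c cadlag_measurable[OF this]]
    \<comment> \<open>The recursion in the form
      \<open>W (n + 1) - W n = grid c n - (b - 1) W (n + 1)\<close>, telescoped; the sum is the
      integral against \<open>d[cu]\<close>.\<close>
    have tele: "W n \<omega> - W m \<omega> = X (of_int n / c) \<omega> - X (of_int m / c) \<omega> - (b - 1) *\<^sub>R (\<Sum>k\<in>{m<..n}. W k \<omega>)"
      if "m \<le> n" for m n :: int
      using that
    proof (induction n rule: int_ge_induct)
      case (step n)
      have ins: "{m<..n + 1} = insert (n + 1) {m<..n}" using step.hyps by auto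
      have d: "W (n + 1) \<omega> - W n \<omega>
          = X (of_int (n + 1) / c) \<omega> - X (of_int n / c) \<omega> - (b - 1) *\<^sub>R W (n + 1) \<omega>"
        using elim(2)[rule_format, of "n + 1"] elim(3) by (simp add: algebra_simps)
      have "W (n + 1) \<omega> - W m \<omega> = (W (n + 1) \<omega> - W n \<omega>) + (W n \<omega> - W m \<omega>)" by simp
      also have "\<dots> = (X (of_int (n + 1) / c) \<omega> - X (of_int n / c) \<omega> - (b - 1) *\<^sub>R W (n + 1) \<omega>)
          + (X (of_int n / c) \<omega> - X (of_int m / c) \<omega> - (b - 1) *\<^sub>R (\<Sum>k\<in>{m<..n}. W k \<omega>))"
        unfolding d step.IH ..
      also have "\<dots> = X (of_int (n + 1) / c) \<omega> - X (of_int m / c) \<omega> - (b - 1) *\<^sub>R (\<Sum>k\<in>{m<..n + 1}. W k \<omega>)"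
        unfolding ins by (simp add: scaleR_add_right)
      finally show ?case .
    qed simp
    show ?case
    proof (intro allI impI)
      fix s t :: real assume "s \<le> t"
      then have "\<lfloor>c * s\<rfloor> \<le> \<lfloor>c * t\<rfloor>" using c by (intro floor_mono mult_left_mono) auto
      then show "Z t \<omega> - Z s \<omega> =
          X (of_int \<lfloor>c * t\<rfloor> / c) \<omega> - X (of_int \<lfloor>c * s\<rfloor> / c) \<omega>
          - (b - 1) *\<^sub>R (LINT u:{s<..t}|interval_measure (\<lambda>u. of_int \<lfloor>c * u\<rfloor>). Z u \<omega>)"
        unfolding int using tele[of "\<lfloor>c * s\<rfloor>" "\<lfloor>c * t\<rfloor>"] c by (simp add: elim(1))
    qed
  qed
qed

lemma semi_stationary_Z: "semi_stationary_with_period M (1 / c) Z"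
  unfolding semi_stationary_with_period_def same_fdd_def
proof (intro conjI allI impI)
  fix J :: "real set" assume "finite J"
  have "distr M (Pi\<^sub>M J (\<lambda>_. borel)) (\<lambda>\<omega>. \<lambda>t\<in>J. Z (t + 1 / c) \<omega>)
      = distr M (Pi\<^sub>M J (\<lambda>_. borel)) (\<lambda>\<omega>. \<lambda>t\<in>J. W \<lfloor>c * (t + 1 / c)\<rfloor> \<omega>)"
    by (rule distr_cong_AE) (use Z_eq in auto)
  also have "\<dots> = distr M (Pi\<^sub>M J (\<lambda>_. borel)) (\<lambda>\<omega>. \<lambda>t\<in>J. W \<lfloor>c * t\<rfloor> \<omega>)"
    using same_fdd_W \<open>finite J\<close> by (simp add: same_fdd_def)
  also have "\<dots> = distr M (Pi\<^sub>M J (\<lambda>_. borel)) (\<lambda>\<omega>. \<lambda>t\<in>J. Z t \<omega>)"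
    by (rule distr_cong_AE) (use Z_eq in auto)
  finally show "distr M (Pi\<^sub>M J (\<lambda>_. borel)) (\<lambda>\<omega>. \<lambda>t\<in>J. Z (t + 1 / c) \<omega>)
      = distr M (Pi\<^sub>M J (\<lambda>_. borel)) (\<lambda>\<omega>. \<lambda>t\<in>J. Z t \<omega>)" .
qed (use c in simp)

lemma distr_Z: "distr M borel (Z t) = distr M borel (\<lambda>\<omega>. geom_sum b (\<lambda>i. grid c (int i) \<omega>))"
proof -
  have "distr M borel (Z t) = distr M borel (W \<lfloor>c * t\<rfloor>)"
    using Z_eq by (intro distr_AE_cong) (auto elim: eventually_mono)
  then show ?thesis by (simp add: distr_W)
qed

text \<open>The noise cancels in the difference \<open>D\<close>, which therefore grows by the
  factor \<open>b\<close> with each step into the past. The two processes may have different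
  periods, so \<open>D\<close> is not claimed to be semi-stationary; its tails are bounded by those
  of the two solutions separately. A power with \<open>b ^ n * \<epsilon> > a' + a\<close> then
  bounds the tail of \<open>D k\<close> at \<open>\<epsilon>\<close> by
  \<open>\<delta>\<close>.\<close>

lemma semi_stationary_solution_unique:
  assumes Z': "langevin_solution M X b c Z'" "semi_stationary M Z'"
  shows "AE \<omega> in M. \<forall>t. Z' t \<omega> = Z t \<omega>"
proof -
  have cad': "cadlag_process M Z'" using Z'(1) by (simp add: langevin_solution_def)
  then have [measurable]: "Z' t \<in> borel_measurable M" for t
    by (simp add: cadlag_process_def)
  define D where "D k \<omega> = Z' (of_int k / c) \<omega> - Z (of_int k / c) \<omega>" for k :: int and \<omega>
  have [measurable]: "D k \<in> borel_measurable M" for k unfolding D_def[abs_def] by measurable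
  note rec' = langevin_solution_recursion[OF Z'(1)]
  note rec = langevin_solution_recursion[OF langevin_solution_Z]
  have D_rec: "AE \<omega> in M. \<forall>k n. D (k - int n) \<omega> = b ^ n *\<^sub>R D k \<omega>"
    using rec rec'
  proof eventually_elim
    case (elim \<omega>)
    have step: "D (k - 1) \<omega> = b *\<^sub>R D k \<omega>" for k
      unfolding D_def elim(1)[THEN conjunct1, rule_format, of k] elim(2)[THEN conjunct1, rule_format, of k]
      by (simp add: scaleR_diff_right)
    show ?case
    proof (intro allI)
      fix k n
      show "D (k - int n) \<omega> = b ^ n *\<^sub>R D k \<omega>"
      proof (induction n)
        case (Suc n)
        have i: "k - int (Suc n) = k - int n - 1" by simp
        show ?case unfolding i using step[of "k - int n"] Suc by simp
      qed simp
    qed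
  qed
  have "AE \<omega> in M. \<forall>k. D k \<omega> = 0"
    unfolding AE_all_countable
  proof
    fix k
    show "AE \<omega> in M. D k \<omega> = 0"
    proof (rule AE_eq_0_if_prob_small)
      fix \<epsilon> \<delta> :: real assume "\<epsilon> > 0" "\<delta> > 0"
      have "semi_stationary M Z" using semi_stationary_Z by (auto simp: semi_stationary_def)
      from semi_stationary_tight[OF Z this, of "\<delta>/2"] obtain a
        where a: "a > 0" "\<And>t. prob {\<omega>\<in>space M. norm (Z t \<omega>) > a} \<le> \<delta>/2" using \<open>\<delta> > 0\<close> by auto
      from semi_stationary_tight[OF cad' Z'(2), of "\<delta>/2"] obtain a'
        where a': "a' > 0" "\<And>t. prob {\<omega>\<in>space M. norm (Z' t \<omega>) > a'} \<le> \<delta>/2" using \<open>\<delta> > 0\<close> by auto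
      obtain n where "(a' + a) / \<epsilon> < b ^ n" using real_arch_pow[OF b] by blast
      then have n: "a' + a < b ^ n * \<epsilon>" using \<open>\<epsilon> > 0\<close> by (simp add: field_simps)
      have "prob {\<omega>\<in>space M. norm (D k \<omega>) > \<epsilon>} = prob {\<omega>\<in>space M. norm (b ^ n *\<^sub>R D k \<omega>) > b ^ n * \<epsilon>}"
        using b by (intro arg_cong[where f=prob] Collect_cong) simp
      also have "\<dots> = prob {\<omega>\<in>space M. norm (D (k - int n) \<omega>) > b ^ n * \<epsilon>}"
        by (rule prob_norm_AE_eq) (use D_rec in \<open>auto elim: eventually_mono\<close>)
      also have "\<dots> \<le> prob {\<omega>\<in>space M. norm (D (k - int n) \<omega>) > a' + a}"
        using n by (intro finite_measure_mono) auto
      also have "\<dots> \<le> prob {\<omega>\<in>space M. norm (Z' (of_int (k - int n) / c) \<omega>) > a'}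
          + prob {\<omega>\<in>space M. norm (- Z (of_int (k - int n) / c) \<omega>) > a}"
        unfolding D_def diff_conv_add_uminus by (rule prob_norm_add_gt_le) measurable
      also have "\<dots> \<le> \<delta>/2 + \<delta>/2"
        unfolding norm_minus_cancel by (intro add_mono a a')
      finally show "prob {\<omega>\<in>space M. norm (D k \<omega>) > \<epsilon>} \<le> \<delta>" by simp
    qed measurable
  qed
  \<comment> \<open>Both solutions are constant on cells, so agreement at the grid points is
    agreement at all times.\<close>
  then show ?thesis
    using rec rec' by eventually_elim (metis D_def eq_iff_diff_eq_0)
qed

end

text \<open>Cut every cell into \<open>n\<close> equal ones and collect in \<open>Y j\<close> the
  fine cells in position \<open>j\<close> of their coarse cell. Passing to the next coarse cell
  still costs one factor \<open>1 / b\<close>, so each \<open>Y j\<close> is a series of the same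
  kind. The residue classes modulo \<open>n\<close> are disjoint, which makes the \<open>Y j\<close>
  independent, and reindexing gives them equal laws.\<close>

lemma geom_sum_grid_inf_divisible:
  "distr M borel (\<lambda>\<omega>. geom_sum b (\<lambda>i. grid c (int i) \<omega>)) \<in> inf_divisible"
proof (rule distr_sum_in_inf_divisible)
  fix n :: nat assume n: "n \<ge> 1"
  define c' where "c' = c * real n"
  have c': "c' > 0" using c n by (simp add: c'_def)
  define \<sigma> where "\<sigma> j i = int n * int i + int j" for j i :: nat
  define Y where "Y j \<omega> = geom_sum b (\<lambda>i. grid c' (\<sigma> j i) \<omega>)" for j \<omega>
  have inj: "inj (\<sigma> j)" for j using n by (auto simp: \<sigma>_def inj_def)
  have "AE \<omega> in M. \<forall>j. summable (\<lambda>i. (1 / b) ^ Suc i *\<^sub>R grid c' (\<sigma> j i) \<omega>)"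
    unfolding AE_all_countable by (intro allI AE_summable_grid[OF c' inj])
  then have decomp: "AE \<omega> in M. geom_sum b (\<lambda>i. grid c (int i) \<omega>) = (\<Sum>j<n. Y j \<omega>)"
    using grid_eq[OF c] sum_grid_eq[OF c', of n]
  proof eventually_elim
    case (elim \<omega>)
    have "grid c (int i) \<omega> = (\<Sum>j<n. grid c' (\<sigma> j i) \<omega>)" for i
    proof -
      have "(\<Sum>j<n. grid c' (\<sigma> j i) \<omega>) = X (of_int (int n * int i + int n) / c') \<omega> - X (of_int (int n * int i) / c') \<omega>"
        unfolding \<sigma>_def using elim(3) by blast
      also have "of_int (int n * int i + int n) / c' = (of_int (int i) + 1) / c"
        using n c by (simp add: c'_def field_simps)
      also have "of_int (int n * int i) / c' = of_int (int i) / c"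
        using n c by (simp add: c'_def field_simps)
      finally show ?thesis using elim(2) by simp
    qed
    then have "geom_sum b (\<lambda>i. grid c (int i) \<omega>) = (\<Sum>i. \<Sum>j<n. (1 / b) ^ Suc i *\<^sub>R grid c' (\<sigma> j i) \<omega>)"
      by (simp add: geom_sum_def scaleR_sum_right)
    also have "\<dots> = (\<Sum>j<n. \<Sum>i. (1 / b) ^ Suc i *\<^sub>R grid c' (\<sigma> j i) \<omega>)"
      using elim(1) by (intro suminf_sum) auto
    finally show ?case by (simp add: Y_def geom_sum_def)
  qed
  have ident: "distr M borel (Y j) = distr M borel (Y 0)" for j
    unfolding Y_def[abs_def]
    by (rule iid_distr_fun_eq[OF iid_reindex[OF iid_grid[OF c'] inj] iid_reindex[OF iid_grid[OF c'] inj]])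
      measurable
  have "indep_vars (\<lambda>_. borel) Y {..<n}"
  proof -
    have "disjoint_family_on (\<lambda>j. range (\<sigma> j)) {..<n}"
      unfolding disjoint_family_on_def
    proof (intro ballI impI)
      fix j l assume jl: "j \<in> {..<n}" "l \<in> {..<n}" "j \<noteq> l"
      have "\<sigma> j i mod int n = int j" if "j < n" for i j
        using that by (simp add: \<sigma>_def)
      then show "range (\<sigma> j) \<inter> range (\<sigma> l) = {}"
        using jl by (auto, metis of_nat_eq_iff)
    qed
    then have "indep_vars (\<lambda>j. PiM (range (\<sigma> j)) (\<lambda>_. borel))
        (\<lambda>j \<omega>. restrict (\<lambda>k. grid c' k \<omega>) (range (\<sigma> j))) {..<n}"
      using iid_grid[OF c'] by (intro indep_vars_restrict[where I=UNIV]) (auto simp: iid_def)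
    then have "indep_vars (\<lambda>_. borel) (\<lambda>j \<omega>. geom_sum b
        (\<lambda>i. restrict (\<lambda>k. grid c' k \<omega>) (range (\<sigma> j)) (\<sigma> j i))) {..<n}"
      by (rule indep_vars_compose2[where Y="\<lambda>j x. geom_sum b (\<lambda>i. x (\<sigma> j i))"])
        (auto intro!: geom_sum_measurable measurable_component_singleton)
    then show ?thesis by (simp add: Y_def[abs_def])
  qed
  then show "\<exists>Y \<nu>. indep_vars (\<lambda>_. borel) Y {..<n} \<and> (\<forall>j<n. distr M borel (Y j) = \<nu>) \<and>
     (AE \<omega> in M. geom_sum b (\<lambda>i. grid c (int i) \<omega>) = (\<Sum>j<n. Y j \<omega>))"
    using ident decomp by blast
qed measurable

text \<open>The series equals \<open>1 / b\<close> times its own shift plus \<open>1 / b\<close>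
  times the first cell. The shift has the law of the series itself and is independent of that cell,
  so \<open>\<rho>\<close> is the law of \<open>(1 / b) *\<^sub>R grid c 0\<close>.\<close>

lemma geom_sum_grid_semi_selfdecomposable:
  "distr M borel (\<lambda>\<omega>. geom_sum b (\<lambda>i. grid c (int i) \<omega>)) \<in> semi_selfdecomposable b"
proof -
  define V where "V \<omega> = geom_sum b (\<lambda>i. grid c (int i) \<omega>)" for \<omega>
  define V' where "V' \<omega> = geom_sum b (\<lambda>i. grid c (int (Suc i)) \<omega>)" for \<omega>
  define R where "R \<omega> = (1 / b) *\<^sub>R grid c 0 \<omega>" for \<omega>
  have [measurable]: "V \<in> borel_measurable M" "V' \<in> borel_measurable M" "R \<in> borel_measurable M"
    unfolding V_def[abs_def] V'_def[abs_def] R_def[abs_def] by measurable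
  have V: "AE \<omega> in M. V \<omega> = (1 / b) *\<^sub>R V' \<omega> + R \<omega>"
    using AE_summable_grid[OF c inj_of_nat]
    by eventually_elim (simp add: V_def V'_def R_def geom_sum_Suc scaleR_add_right)
  have V': "distr M borel V' = distr M borel V"
    unfolding V_def[abs_def] V'_def[abs_def] by (rule distr_geom_sum_grid) (auto simp: inj_def)
  \<comment> \<open>The shifted series and the first term depend on the disjoint blocks
    \<open>k \<ge> 1\<close> and \<open>k = 0\<close>.\<close>
  have "indep_var (PiM {1..} (\<lambda>_. borel)) (\<lambda>\<omega>. restrict (\<lambda>k. grid c k \<omega>) {1..})
      (PiM {0} (\<lambda>_. borel)) (\<lambda>\<omega>. restrict (\<lambda>k. grid c k \<omega>) {0})"
    using iid_grid[OF c] by (intro indep_var_restrict[where I=UNIV]) (auto simp: iid_def)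
  then have "indep_var borel ((\<lambda>x. (1 / b) *\<^sub>R geom_sum b (\<lambda>i. x (int (Suc i)))) \<circ> (\<lambda>\<omega>. restrict (\<lambda>k. grid c k \<omega>) {1..}))
     borel ((\<lambda>x. (1 / b) *\<^sub>R x 0) \<circ> (\<lambda>\<omega>. restrict (\<lambda>k. grid c k \<omega>) {0}))"
    by (rule indep_var_compose)
      (auto intro!: borel_measurable_scaleR geom_sum_measurable measurable_component_singleton)
  then have ind: "indep_var borel (\<lambda>\<omega>. (1 / b) *\<^sub>R V' \<omega>) borel R"
    by (simp add: comp_def V'_def[abs_def] R_def[abs_def])
  have \<rho>: "distr M borel R \<in> inf_divisible"
    using scaled_Lambda_inf_divisible[of "1 / c" "1 / b"] c by (simp add: R_def[abs_def] grid_def)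
  have "char_vec (distr M borel V) z = char_vec (distr M borel V) ((1 / b) *\<^sub>R z) * char_vec (distr M borel R) z" for z
  proof -
    have "distr M borel V = distr M borel (\<lambda>\<omega>. (1 / b) *\<^sub>R V' \<omega> + R \<omega>)"
      by (rule distr_AE_cong[OF _ _ V]) measurable
    then have "char_vec (distr M borel V) z
        = char_vec (distr M borel (\<lambda>\<omega>. (1 / b) *\<^sub>R V' \<omega>)) z * char_vec (distr M borel R) z"
      by (simp only: char_vec_add_indep[OF ind])
    also have "char_vec (distr M borel (\<lambda>\<omega>. (1 / b) *\<^sub>R V' \<omega>)) z = char_vec (distr M borel V) ((1 / b) *\<^sub>R z)"
      unfolding V'[symmetric] by (rule char_vec_scaleR) measurable
    finally show ?thesis .
  qed
  then have "\<forall>z. char_vec (distr M borel V) z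
      = char_vec (distr M borel V) ((1 / b) *\<^sub>R z) * char_vec (distr M borel R) z" by (rule allI)
  moreover have "distr M borel V \<in> inf_divisible"
    unfolding V_def[abs_def] by (rule geom_sum_grid_inf_divisible)
  ultimately have "distr M borel V \<in> semi_selfdecomposable b"
    unfolding semi_selfdecomposable_def using \<rho> by blast
  then show ?thesis unfolding V_def[abs_def] .
qed

lemma integral_0_inf_distr:
  assumes "is_integral_0_inf M \<Lambda> (\<lambda>u. b powi (- \<lfloor>c * u\<rfloor> - 1)) V"
  shows "distr M borel V = distr M borel (\<lambda>\<omega>. geom_sum b (\<lambda>i. grid c (int i) \<omega>))"
proof (rule distr_AE_cong)
  show V: "V \<in> borel_measurable M" using assms by (simp add: is_integral_0_inf_def)
  show "AE \<omega> in M. V \<omega> = geom_sum b (\<lambda>i. grid c (int i) \<omega>)"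
    using assms integral_0_inf
    by (intro tendsto_in_prob_unique[where F=at_top and
        Y="step_integral \<Lambda> (\<lambda>u. b powi (- \<lfloor>c * u\<rfloor> - 1)) 0"] measurable_step_integral V)
      (auto simp: is_integral_0_inf_def)
qed measurable

end

section \<open>From the law of \<open>X 1\<close> to the equivalence\<close>

lemma (in isrm_process) distr_X_1: "distr M borel (X 1) = distr M borel (\<Lambda> {0<..1})"
  by (rule distr_AE_cong) (use X_eq_Lambda(1)[of 1] in auto)

text \<open>The law of \<open>X 1\<close> is infinitely divisible in any case, by equal subdivision
  of the unit interval, so membership is only a matter of the logarithmic moment.\<close>

lemma (in isrm_process) inf_divisible_log_iff:
  "distr M borel (X 1) \<in> inf_divisible_log \<longleftrightarrow> log_integrable (\<Lambda> {0<..1})"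
proof -
  have "distr M borel (X 1) \<in> inf_divisible"
    using scaled_Lambda_inf_divisible[of 1 1] by (simp add: distr_X_1)
  then show ?thesis
    by (simp add: inf_divisible_log_def distr_X_1 log_integrable_iff_nn_integral)
qed

text \<open>The process depends on \<open>t\<close> through the floor alone, so its paths are cadlag
  step functions; the prefactor cancels the weight \<open>b powi k\<close> in the grid values of the
  integral.\<close>

lemma (in langevin_log) of_integral_process:
  assumes Y: "cadlag_integral_from_minf M \<Lambda> (\<lambda>u. b powi \<lfloor>c * u\<rfloor>) Y"
    and Z_def: "Z = (\<lambda>t \<omega>. b powi (- \<lfloor>c * t\<rfloor>) *\<^sub>R Y (of_int \<lfloor>c * t\<rfloor> / c) \<omega>)"
  shows cadlag_process_of_integral: "cadlag_process M Z"
    and AE_of_integral_eq_W: "AE \<omega> in M. \<forall>t. Z t \<omega> = W \<lfloor>c * t\<rfloor> \<omega>"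
proof -
  have Y_meas: "Y t \<in> borel_measurable M" for t
    using Y unfolding cadlag_integral_from_minf_def cadlag_process_def by blast
  show "cadlag_process M Z"
    unfolding cadlag_process_def
  proof (intro conjI allI ballI)
    fix t show "Z t \<in> borel_measurable M"
      unfolding Z_def by (intro borel_measurable_scaleR borel_measurable_const Y_meas)
  next
    fix \<omega>
    have "cadlag (\<lambda>_. 0 :: real ^ 'd)"
      unfolding cadlag_def by (blast intro: continuous_const tendsto_const)
    from cadlag_floor_affine[OF this c, of "\<lambda>k. b powi (- k) *\<^sub>R Y (of_int k / c) \<omega>" "\<lambda>_. 0"]
    show "cadlag (\<lambda>t. Z t \<omega>)"
      unfolding Z_def scaleR_zero_left add_0_right .
  qed
  show "AE \<omega> in M. \<forall>t. Z t \<omega> = W \<lfloor>c * t\<rfloor> \<omega>"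
    using integral_from_minf_grid_eq[OF Y]
  proof eventually_elim
    case (elim \<omega>)
    have powi: "b powi (- k) * b powi k = 1" for k
      using b power_int_add[of b "- k" k] by simp
    show ?case
    proof
      fix t
      show "Z t \<omega> = W \<lfloor>c * t\<rfloor> \<omega>"
        unfolding Z_def elim[rule_format] scaleR_scaleR powi scaleR_one ..
    qed
  qed
qed

lemma (in langevin_log) semi_stationary_solution_properties:
  assumes Y: "cadlag_integral_from_minf M \<Lambda> (\<lambda>u. b powi \<lfloor>c * u\<rfloor>) Y"
    and Z_def: "Z = (\<lambda>t \<omega>. b powi (- \<lfloor>c * t\<rfloor>) *\<^sub>R Y (of_int \<lfloor>c * t\<rfloor> / c) \<omega>)"
  shows "langevin_solution M X b c Z \<and> semi_stationary M Z \<and>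
     (\<forall>Z'. langevin_solution M X b c Z' \<and> semi_stationary M Z' \<longrightarrow>
        (AE \<omega> in M. \<forall>t. Z' t \<omega> = Z t \<omega>)) \<and>
     (\<forall>V t. is_integral_0_inf M \<Lambda> (\<lambda>u. b powi (- \<lfloor>c * u\<rfloor> - 1)) V \<longrightarrow>
        distr M borel (Z t) = distr M borel V) \<and>
     (\<forall>t. distr M borel (Z t) \<in> semi_selfdecomposable b) \<and>
     semi_stationary_with_period M (1 / c) Z"
proof -
  note Z = cadlag_process_of_integral[OF Y Z_def] AE_of_integral_eq_W[OF Y Z_def]
  have 1: "langevin_solution M X b c Z" by (rule langevin_solution_Z[OF Z])
  have 2: "semi_stationary_with_period M (1 / c) Z" by (rule semi_stationary_Z[OF Z])
  then have 3: "semi_stationary M Z" unfolding semi_stationary_def by blast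
  have 4: "\<forall>Z'. langevin_solution M X b c Z' \<and> semi_stationary M Z' \<longrightarrow>
      (AE \<omega> in M. \<forall>t. Z' t \<omega> = Z t \<omega>)"
    by (intro allI impI, elim conjE) (rule semi_stationary_solution_unique[OF Z])
  have 5: "\<forall>V t. is_integral_0_inf M \<Lambda> (\<lambda>u. b powi (- \<lfloor>c * u\<rfloor> - 1)) V \<longrightarrow>
      distr M borel (Z t) = distr M borel V"
    by (intro allI impI) (simp only: distr_Z[OF Z] integral_0_inf_distr)
  have 6: "\<forall>t. distr M borel (Z t) \<in> semi_selfdecomposable b"
    unfolding distr_Z[OF Z] by (rule allI) (rule geom_sum_grid_semi_selfdecomposable)
  show ?thesis by (intro conjI 1 2 3 4 5 6)
qed

text \<open>Improper integrals are relations here; the existence of versions \<open>Y\<close> and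
  \<open>V\<close> is asserted so that the claims quantified over all versions are not
  vacuous.\<close>

theorem theorem6p3:
  fixes M :: "'w measure"
    and \<Lambda> :: "real set \<Rightarrow> 'w \<Rightarrow> real ^ 'd"
    and X :: "real \<Rightarrow> 'w \<Rightarrow> real ^ 'd"
    and b c :: real
  assumes "prob_space M"
    and "hisrm_process M \<Lambda> X"
    and "c > 0"
    and "b > 1"
  shows
    "(distr M borel (X 1) \<in> inf_divisible_log \<longleftrightarrow>
        (\<exists>Z. langevin_solution M X b c Z \<and> semi_stationary M Z))
     \<and>
     (distr M borel (X 1) \<in> inf_divisible_log \<longrightarrow>
        (\<exists>Y. cadlag_integral_from_minf M \<Lambda> (\<lambda>u. b powi \<lfloor>c * u\<rfloor>) Y) \<and>
        (\<exists>V. is_integral_0_inf M \<Lambda> (\<lambda>u. b powi (- \<lfloor>c * u\<rfloor> - 1)) V) \<and>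
        (\<forall>Y Z. cadlag_integral_from_minf M \<Lambda> (\<lambda>u. b powi \<lfloor>c * u\<rfloor>) Y \<longrightarrow>
           Z = (\<lambda>t \<omega>. b powi (- \<lfloor>c * t\<rfloor>) *\<^sub>R Y (of_int \<lfloor>c * t\<rfloor> / c) \<omega>) \<longrightarrow>
             langevin_solution M X b c Z \<and>
             semi_stationary M Z \<and>
             (\<forall>Z'. langevin_solution M X b c Z' \<and> semi_stationary M Z' \<longrightarrow>
                (AE \<omega> in M. \<forall>t. Z' t \<omega> = Z t \<omega>)) \<and>
             (\<forall>V t. is_integral_0_inf M \<Lambda> (\<lambda>u. b powi (- \<lfloor>c * u\<rfloor> - 1)) V \<longrightarrow>
                distr M borel (Z t) = distr M borel V) \<and>
             (\<forall>t. distr M borel (Z t) \<in> semi_selfdecomposable b) \<and>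
             semi_stationary_with_period M (1 / c) Z))"
proof -
  have L: "langevin M \<Lambda> X b c"
    by (intro langevin.intro isrm_process.intro isrm_process_axioms.intro langevin_axioms.intro assms)
  note iff = isrm_process.inf_divisible_log_iff[OF langevin.axioms(1)[OF L]]
  show ?thesis
    unfolding iff
  proof (intro conjI impI iffI)
    assume "prob_space.log_integrable M (\<Lambda> {0<..1})"
    then have LL: "langevin_log M \<Lambda> X b c"
      by (intro langevin_log.intro langevin_log_axioms.intro L)
    note cad = langevin_log.cadlag_minf_integral_version[OF LL]
    show "\<exists>Z. langevin_solution M X b c Z \<and> semi_stationary M Z"
      using langevin_log.semi_stationary_solution_properties[OF LL cad refl] by (elim conjE) (intro exI conjI)
    show "\<exists>Y. cadlag_integral_from_minf M \<Lambda> (\<lambda>u. b powi \<lfloor>c * u\<rfloor>) Y"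
      by (rule exI) (rule cad)
    show "\<exists>V. is_integral_0_inf M \<Lambda> (\<lambda>u. b powi (- \<lfloor>c * u\<rfloor> - 1)) V"
      by (rule exI) (rule langevin_log.integral_0_inf[OF LL])
    show "\<forall>Y Z. cadlag_integral_from_minf M \<Lambda> (\<lambda>u. b powi \<lfloor>c * u\<rfloor>) Y \<longrightarrow>
           Z = (\<lambda>t \<omega>. b powi (- \<lfloor>c * t\<rfloor>) *\<^sub>R Y (of_int \<lfloor>c * t\<rfloor> / c) \<omega>) \<longrightarrow>
             langevin_solution M X b c Z \<and>
             semi_stationary M Z \<and>
             (\<forall>Z'. langevin_solution M X b c Z' \<and> semi_stationary M Z' \<longrightarrow>
                (AE \<omega> in M. \<forall>t. Z' t \<omega> = Z t \<omega>)) \<and>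
             (\<forall>V t. is_integral_0_inf M \<Lambda> (\<lambda>u. b powi (- \<lfloor>c * u\<rfloor> - 1)) V \<longrightarrow>
                distr M borel (Z t) = distr M borel V) \<and>
             (\<forall>t. distr M borel (Z t) \<in> semi_selfdecomposable b) \<and>
             semi_stationary_with_period M (1 / c) Z"
      by (intro allI impI) (rule langevin_log.semi_stationary_solution_properties[OF LL])
  next
    assume "\<exists>Z. langevin_solution M X b c Z \<and> semi_stationary M Z"
    then show "prob_space.log_integrable M (\<Lambda> {0<..1})"
      by (elim exE conjE) (rule langevin.log_integrable_of_semi_stationary_solution[OF L])
  qed
qed

end
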